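(* Let $r,d\geqslant 1$ and let $\xi_k,\gamma_{jk},\beta_j\in\mathbb{C}$ ($1\leqslant j\leqslant d$, $1\leqslant k\leqslant r$) with $|\xi_k|\leqslant 1$, $\Re\gamma_{jk}\geqslant0$, $\Re\beta_j>0$, and such that for each $j$ at least one $\Re\gamma_{jk}>0$. Let $\delta(k)=1$ if $\xi_k=1$ and $\delta(k)=0$ otherwise, and define the desingularized multiple zeta-function $$\zeta_r^{\rm des}((s_j);(\xi_k);(\gamma_{jk});(\beta_j)):=\lim_{c\to1}\frac{1}{\prod_{k=1}^r(1-\delta(k)c)}\cdot\frac{1}{\prod_{j=1}^d(e^{2\pi i s_j}-1)\Gamma(s_j)}\int_{\mathcal{C}^d}\prod_{j=1}^d x_j^{s_j-1}e^{(\sum_{k=1}^r\gamma_{jk}-\beta_j)x_j}dx_j\prod_{k=1}^r\Biggl(\frac{1}{e^{\sum_{j=1}^d\gamma_{jk}x_j}-\xi_k}-\delta(k)\frac{c}{e^{c\sum_{j=1}^d\gamma_{jk}x_j}-1}\Biggr),$$ the limit being over real $c$. Then $$\zeta_r^{\rm des}((s_j);(\xi_k);(\gamma_{jk});(\beta_j))=\frac{1}{\prod_{j=1}^d(e^{2\pi i s_j}-1)\Gamma(s_j)}\int_{\mathcal{C}^d}\prod_{j=1}^d x_j^{s_j-1}e^{(\sum_{k=1}^r\gamma_{jk}-\beta_j)x_j}dx_j\prod_{k=1}^r F_{\delta(k)}\Bigl(\sum_{j=1}^d\gamma_{jk}x_j,\xi_k\Bigr),$$ where $F_{\delta}(y,\xi)=\frac{1}{e^y-\xi}-\delta\frac{ye^y}{(e^y-1)^2}$,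 and this function of $(s_1,\dots,s_d)$ is analytically continued to $\mathbb{C}^d$ as an entire function.
   Context: $\mathcal{C}$ is the Hankel contour: it comes from $+\infty$ along the upper side of the positive real axis, goes counterclockwise around the origin on a circle of sufficiently small radius $\varepsilon$, and returns to $+\infty$ along the lower side; $x^{s-1}$ is defined with $\arg x=0$ on the upper side and $\arg x=2\pi$ on the lower side. For $s_j$ outside the poles, the factor $1/((e^{2\pi is_j}-1)\Gamma(s_j))$ is understood by analytic continuation. When all $\xi_k\neq1$, this is the standard integral representation of $\zeta_r((s_j);(\xi_k);(\gamma_{jk});(\beta_j))=\sum_{m_1,\dots,m_r\geqslant0}\prod_k\xi_k^{m_k}/\prod_j(\beta_j+\sum_k\gamma_{jk}m_k)^{s_j}$.
   Formalization: Added: for small ε no denominator e^{y_k}−ξ_k vanishes on the contour except at y_k=0, i.e. if |ξ_k|=1 each γ_jk is 0 or has positive real part; else (γ=(1,i), ξ=(1/2,1)) poles lie on the contour. Factors at the removable point y_k=0 take their limit value. *)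

theory Defs
  imports "HOL-Complex_Analysis.Complex_Analysis"
begin

no_notation fps_nth (infixl \<open>$\<close> 75)

text \<open>
  The Hankel contour with radius \<open>\<epsilon>\<close>, parametrised by the whole real line: the incoming upper side
  for \<open>t < 0\<close>, the circle for \<open>0 \<le> t \<le> 2\<pi>\<close>, the outgoing lower side for \<open>t > 2\<pi>\<close>.  The two sides are
  the same set of complex numbers, so the branch of \<open>x\<^sup>s\<close> depends on the parameter \<open>t\<close> and not just
  on the point \<open>x = hankel \<epsilon> t\<close>.
\<close>

definition hankel_abs :: "real \<Rightarrow> real \<Rightarrow> real" where
  "hankel_abs \<epsilon> t = (if t < 0 then \<epsilon> - t else if t \<le> 2 * pi then \<epsilon> else \<epsilon> + (t - 2 * pi))"

definition hankel_arg :: "real \<Rightarrow> real" where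
  "hankel_arg t = (if t < 0 then 0 else if t \<le> 2 * pi then t else 2 * pi)"

definition hankel :: "real \<Rightarrow> real \<Rightarrow> complex" where
  "hankel \<epsilon> t = rcis (hankel_abs \<epsilon> t) (hankel_arg t)"

definition hankel_powr :: "real \<Rightarrow> real \<Rightarrow> complex \<Rightarrow> complex" where
  "hankel_powr \<epsilon> t s = exp (s * Complex (ln (hankel_abs \<epsilon> t)) (hankel_arg t))"

definition hankel_form :: "real \<Rightarrow> complex^'r^'d \<Rightarrow> real^'d \<Rightarrow> 'r \<Rightarrow> complex" where
  "hankel_form \<epsilon> \<gamma> t k = (\<Sum>j\<in>UNIV. \<gamma> $ j $ k * hankel \<epsilon> (t $ j))"

text \<open>
  For all sufficiently small radii, no denominator \<open>e\<^sup>y - \<xi>\<^sub>k\<close> vanishes on the product contour, except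
  possibly at \<open>y = 0\<close> (so \<open>\<xi>\<^sub>k = 1\<close>), where the singularity of the integrands below is removable.
\<close>

definition hankel_regular :: "complex^'r \<Rightarrow> complex^'r^'d \<Rightarrow> bool" where
  "hankel_regular \<xi> \<gamma> \<longleftrightarrow>
     (\<forall>\<^sub>F \<epsilon> in at_right 0. \<forall>t k. exp (hankel_form \<epsilon> \<gamma> t k) = \<xi> $ k \<longrightarrow> hankel_form \<epsilon> \<gamma> t k = 0)"

definition delta_one :: "complex \<Rightarrow> complex" where
  "delta_one \<xi> = (if \<xi> = 1 then 1 else 0)"

definition des_F :: "complex \<Rightarrow> complex \<Rightarrow> complex \<Rightarrow> complex" where
  "des_F \<delta> y \<xi> = 1 / (exp y - \<xi>) - \<delta> * (y * exp y / (exp y - 1)\<^sup>2)"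

definition des_F_approx :: "real \<Rightarrow> complex \<Rightarrow> complex \<Rightarrow> complex \<Rightarrow> complex" where
  "des_F_approx c \<delta> y \<xi> =
     1 / (exp y - \<xi>) - \<delta> * (complex_of_real c / (exp (complex_of_real c * y) - 1))"

text \<open>
  The pullback to the parameter space of the differential form
  \<open>\<Prod>j. x\<^sub>j\<^bsup>s\<^sub>j - 1\<^esup> e\<^bsup>(\<Sum>k. \<gamma>\<^sub>j\<^sub>k - \<beta>\<^sub>j) x\<^sub>j\<^esup> dx\<^sub>j \<cdot> \<Prod>k. G\<^sub>k(\<Sum>j. \<gamma>\<^sub>j\<^sub>k x\<^sub>j)\<close>.  The factors \<open>G\<^sub>k\<close> are
  extended over their removable singularities, because division by zero would otherwise give them
  a spurious value at \<open>0\<close>.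
\<close>

definition hankel_integrand ::
  "real \<Rightarrow> complex^'r^'d \<Rightarrow> complex^'d \<Rightarrow> complex^'d \<Rightarrow> ('r \<Rightarrow> complex \<Rightarrow> complex) \<Rightarrow> real^'d \<Rightarrow> complex"
where
  "hankel_integrand \<epsilon> \<gamma> \<beta> s G t =
     (\<Prod>j\<in>UNIV. hankel_powr \<epsilon> (t $ j) (s $ j - 1)
               * exp (((\<Sum>k\<in>UNIV. \<gamma> $ j $ k) - \<beta> $ j) * hankel \<epsilon> (t $ j))
               * vector_derivative (hankel \<epsilon>) (at (t $ j)))
     * (\<Prod>k\<in>UNIV. remove_sings (G k) (hankel_form \<epsilon> \<gamma> t k))"

text \<open>
  Removing singularities supplies the analytic continuation of the factor to \<open>s = 0, -1, -2, \<dots>\<close>.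
  The points \<open>s = 1, 2, 3, \<dots>\<close> are genuine poles.
\<close>

definition hankel_factor :: "complex \<Rightarrow> complex" where
  "hankel_factor = remove_sings (\<lambda>s. 1 / ((exp (2 * of_real pi * \<i> * s) - 1) * Gamma s))"

definition hankel_value ::
  "real \<Rightarrow> complex^'r^'d \<Rightarrow> complex^'d \<Rightarrow> complex^'d \<Rightarrow> ('r \<Rightarrow> complex \<Rightarrow> complex) \<Rightarrow> complex"
where
  "hankel_value \<epsilon> \<gamma> \<beta> s G =
     (\<Prod>j\<in>UNIV. hankel_factor (s $ j)) * (\<integral>t. hankel_integrand \<epsilon> \<gamma> \<beta> s G t \<partial>lborel)"

definition zeta_des_approx ::
  "real \<Rightarrow> complex^'r \<Rightarrow> complex^'r^'d \<Rightarrow> complex^'d \<Rightarrow> complex^'d \<Rightarrow> real \<Rightarrow> complex"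
where
  "zeta_des_approx \<epsilon> \<xi> \<gamma> \<beta> s c =
     1 / (\<Prod>k\<in>UNIV. 1 - delta_one (\<xi> $ k) * complex_of_real c)
     * hankel_value \<epsilon> \<gamma> \<beta> s (\<lambda>k y. des_F_approx c (delta_one (\<xi> $ k)) y (\<xi> $ k))"

definition zeta_des ::
  "real \<Rightarrow> complex^'r \<Rightarrow> complex^'r^'d \<Rightarrow> complex^'d \<Rightarrow> complex^'d \<Rightarrow> complex"
where
  "zeta_des \<epsilon> \<xi> \<gamma> \<beta> s = Lim (at 1) (zeta_des_approx \<epsilon> \<xi> \<gamma> \<beta> s)"

definition entire_fun :: "(complex^'d \<Rightarrow> complex) \<Rightarrow> bool" where
  "entire_fun f \<longleftrightarrow> (\<forall>s. \<exists>L. (f has_derivative L) (at s) \<and> (\<forall>a v. L (a *s v) = a * L v))"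

text \<open>
  Under the bounds on \<open>\<xi>\<close> and \<open>\<gamma>\<close>, regularity excludes exactly the nonzero purely imaginary \<open>\<gamma>\<^sub>j\<^sub>k\<close> with
  \<open>|\<xi>\<^sub>k| = 1\<close>: there the integrand has poles on the contour for every radius, so that the contour
  integral is not defined.
\<close>

lemma hankel_cases:
  assumes "\<epsilon> > 0"
  shows "norm (hankel \<epsilon> t) = \<epsilon> \<or> (\<exists>u\<ge>\<epsilon>. hankel \<epsilon> t = complex_of_real u)"
proof -
  have "\<exists>u\<ge>\<epsilon>. hankel \<epsilon> t = complex_of_real u" if "t < 0"
    using that by (intro exI[of _ "\<epsilon> - t"]) (auto simp: hankel_def hankel_abs_def hankel_arg_def rcis_def)
  moreover have "\<exists>u\<ge>\<epsilon>. hankel \<epsilon> t = complex_of_real u" if "t > 2 * pi"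
    using that pi_gt_zero
    by (intro exI[of _ "\<epsilon> + (t - 2 * pi)"]) (auto simp: hankel_def hankel_abs_def hankel_arg_def rcis_def simp del: pi_gt_zero)
  moreover have "norm (hankel \<epsilon> t) = \<epsilon>" if "0 \<le> t" "t \<le> 2 * pi"
    using that assms by (auto simp: hankel_def hankel_abs_def)
  ultimately show ?thesis by (meson not_less)
qed

lemma hankel_circle:
  assumes "\<epsilon> > 0" "norm x = \<epsilon>"
  shows "\<exists>t. hankel \<epsilon> t = x"
proof -
  have "x = rcis \<epsilon> (Arg2pi x)"
    using assms Arg2pi_eq[of x] by (simp add: rcis_def cis_conv_exp)
  thus ?thesis using Arg2pi_ge_0[of x] Arg2pi_lt_2pi[of x]
    by (intro exI[of _ "Arg2pi x"]) (auto simp: hankel_def hankel_abs_def hankel_arg_def)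
qed

lemma hankel_ray:
  assumes "u > \<epsilon>"
  shows "hankel \<epsilon> (\<epsilon> - u) = complex_of_real u"
  using assms by (auto simp: hankel_def hankel_abs_def hankel_arg_def rcis_def)

lemma hankel_regular_iff:
  fixes \<xi> :: "complex^'r" and \<gamma> :: "complex^'r^'d"
  assumes xi: "\<And>k. norm (\<xi> $ k) \<le> 1" and re: "\<And>j k. Re (\<gamma> $ j $ k) \<ge> 0"
  shows "hankel_regular \<xi> \<gamma> \<longleftrightarrow>
    (\<forall>k. norm (\<xi> $ k) = 1 \<longrightarrow> (\<forall>j. \<gamma> $ j $ k = 0 \<or> Re (\<gamma> $ j $ k) > 0))"
proof (intro iffI allI impI)
  fix k j
  assume reg: "hankel_regular \<xi> \<gamma>" and k: "norm (\<xi> $ k) = 1"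
  show "\<gamma> $ j $ k = 0 \<or> Re (\<gamma> $ j $ k) > 0"
  proof (rule ccontr)
    assume "\<not> ?thesis"
    hence nz: "\<gamma> $ j $ k \<noteq> 0" and re0: "Re (\<gamma> $ j $ k) = 0" using re[of j k] by auto
    define b where "b = Im (\<gamma> $ j $ k)"
    have b: "\<gamma> $ j $ k = \<i> * b" "b \<noteq> 0"
      using nz re0 by (auto simp: b_def complex_eq_iff)
    obtain \<epsilon> :: real where e: "\<epsilon> > 0"
      "\<And>t. exp (hankel_form \<epsilon> \<gamma> t k) = \<xi> $ k \<Longrightarrow> hankel_form \<epsilon> \<gamma> t k = 0"
    proof -
      have "\<forall>\<^sub>F \<epsilon> in at_right 0. (\<forall>t k. exp (hankel_form \<epsilon> \<gamma> t k) = \<xi> $ k \<longrightarrow> hankel_form \<epsilon> \<gamma> t k = 0) \<and> \<epsilon> > 0"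
        using reg eventually_at_right_less[of "0::real"] unfolding hankel_regular_def
        by (rule eventually_conj)
      then obtain \<epsilon> :: real where "(\<forall>t k. exp (hankel_form \<epsilon> \<gamma> t k) = \<xi> $ k \<longrightarrow> hankel_form \<epsilon> \<gamma> t k = 0) \<and> \<epsilon> > 0"
        using eventually_happens trivial_limit_at_right_real by blast
      thus ?thesis using that by blast
    qed
    have "\<exists>t. Re (\<gamma> $ l $ k * hankel \<epsilon> t) = 0" for l
    proof (cases "\<gamma> $ l $ k = 0")
      case False
      define x where "x = \<epsilon> * \<i> * cnj (\<gamma> $ l $ k) / norm (\<gamma> $ l $ k)"
      have "norm x = \<epsilon>" using e(1) False by (simp add: x_def norm_mult norm_divide)
      then obtain t where t: "hankel \<epsilon> t = x" using hankel_circle e(1) by blast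
      have "\<gamma> $ l $ k * x = \<epsilon> * \<i> * (\<gamma> $ l $ k * cnj (\<gamma> $ l $ k)) / norm (\<gamma> $ l $ k)"
        by (simp add: x_def)
      also have "\<dots> = \<i> * of_real (\<epsilon> * norm (\<gamma> $ l $ k))"
        using False by (simp add: complex_norm_square[symmetric] power2_eq_square)
      finally have "Re (\<gamma> $ l $ k * hankel \<epsilon> t) = 0" unfolding t by simp
      thus ?thesis ..
    qed auto
    then obtain T where T: "\<And>l. Re (\<gamma> $ l $ k * hankel \<epsilon> (T l)) = 0" by metis
    define A where "A = (\<Sum>l\<in>UNIV-{j}. Im (\<gamma> $ l $ k * hankel \<epsilon> (T l)))"
    have A: "(\<Sum>l\<in>UNIV-{j}. \<gamma> $ l $ k * hankel \<epsilon> (T l)) = \<i> * A"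
      unfolding A_def of_real_sum sum_distrib_left
      by (rule sum.cong) (use T in \<open>auto simp: complex_eq_iff\<close>)
    define \<phi> where "\<phi> = Arg (\<xi> $ k)"
    have phi: "\<xi> $ k = exp (\<i> * \<phi>)"
      using k Arg_eq[of "\<xi> $ k"] by (cases "\<xi> $ k = 0") (auto simp: \<phi>_def)
    obtain N :: nat where N: "2 * pi * N > \<bar>A\<bar> + \<bar>\<phi>\<bar> + \<bar>b\<bar> * \<epsilon>"
      using reals_Archimedean2[of "(\<bar>A\<bar> + \<bar>\<phi>\<bar> + \<bar>b\<bar> * \<epsilon>) / (2 * pi)"]
      by (auto simp: field_simps)
    define n :: int where "n = (if b > 0 then int N else - int N)"
    define u where "u = (\<phi> + 2 * pi * n - A) / b"
    have bu: "b * u = \<phi> + 2 * pi * n - A" using b by (simp add: u_def)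
    have u: "u > \<epsilon>"
    proof (cases "b > 0")
      case True
      thus ?thesis using N by (simp add: u_def n_def field_simps)
    next
      case False
      hence "b < 0" using b by auto
      thus ?thesis using N by (simp add: u_def n_def field_simps)
    qed
    define t :: "real^'d" where "t = (\<chi> l. if l = j then \<epsilon> - u else T l)"
    have "hankel_form \<epsilon> \<gamma> t k = \<gamma> $ j $ k * hankel \<epsilon> (t $ j) + (\<Sum>l\<in>UNIV-{j}. \<gamma> $ l $ k * hankel \<epsilon> (t $ l))"
      unfolding hankel_form_def by (rule sum.remove) auto
    also have "(\<Sum>l\<in>UNIV-{j}. \<gamma> $ l $ k * hankel \<epsilon> (t $ l)) = \<i> * A"
      unfolding A[symmetric] by (rule sum.cong) (auto simp: t_def)
    also have "\<gamma> $ j $ k * hankel \<epsilon> (t $ j) = \<i> * of_real (b * u)"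
      using hankel_ray[OF u] by (simp add: t_def b)
    also have "\<i> * of_real (b * u) + \<i> * A = \<i> * of_real (\<phi> + 2 * pi * n)"
      unfolding bu by (simp add: algebra_simps)
    finally have y: "hankel_form \<epsilon> \<gamma> t k = \<i> * of_real (\<phi> + 2 * pi * n)" .
    have "exp (hankel_form \<epsilon> \<gamma> t k) = exp (\<i> * \<phi>)"
      unfolding y exp_eq by (intro exI[of _ n]) (simp add: algebra_simps)
    hence "hankel_form \<epsilon> \<gamma> t k = 0" using e(2) phi by simp
    hence "\<phi> + 2 * pi * n = 0" unfolding y by (simp del: of_real_add of_real_mult)
    moreover have "\<bar>b\<bar> * \<epsilon> \<ge> 0" using e by simp
    ultimately show False using N by (auto simp: n_def split: if_splits)
  qed
next
  assume R: "\<forall>k. norm (\<xi> $ k) = 1 \<longrightarrow> (\<forall>j. \<gamma> $ j $ k = 0 \<or> Re (\<gamma> $ j $ k) > 0)"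
  have "\<forall>\<^sub>F \<epsilon> in at_right 0. \<forall>t. exp (hankel_form \<epsilon> \<gamma> t k) = \<xi> $ k \<longrightarrow> hankel_form \<epsilon> \<gamma> t k = 0" for k
  proof -
    define C where "C = (\<Sum>j\<in>UNIV. norm (\<gamma> $ j $ k))"
    have C0: "C \<ge> 0" by (simp add: C_def sum_nonneg)
    have low: "Re (\<gamma> $ j $ k * hankel \<epsilon> s) \<ge> - (norm (\<gamma> $ j $ k) * \<epsilon>)" if "\<epsilon> > 0" for j \<epsilon> s
    proof -
      have "\<bar>Re (\<gamma> $ j $ k * hankel \<epsilon> s)\<bar> \<le> norm (\<gamma> $ j $ k) * norm (hankel \<epsilon> s)"
        using abs_Re_le_cmod[of "\<gamma> $ j $ k * hankel \<epsilon> s"] by (simp add: norm_mult)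
      moreover have "0 \<le> norm (\<gamma> $ j $ k) * \<epsilon>" using that by simp
      moreover have "Re (\<gamma> $ j $ k * of_real u) \<ge> 0" if "u \<ge> \<epsilon>" for u :: real
        using re[of j k] that \<open>\<epsilon> > 0\<close> by simp
      ultimately show ?thesis using hankel_cases[OF that, of s] by fastforce
    qed
    show ?thesis
    proof (cases "norm (\<xi> $ k) = 1")
      case False
      hence lt: "norm (\<xi> $ k) < 1" using xi[of k] by simp
      have "((\<lambda>\<epsilon>. exp (- (C * \<epsilon>))) \<longlongrightarrow> exp (- (C * 0))) (at_right (0::real))"
        by (intro tendsto_intros)
      hence "\<forall>\<^sub>F \<epsilon> in at_right 0. exp (- (C * \<epsilon>)) > norm (\<xi> $ k)"
        using lt by (intro order_tendstoD(1)) auto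
      thus ?thesis using eventually_at_right_less[of "0::real"]
      proof eventually_elim
        case (elim \<epsilon>)
        have "Re (hankel_form \<epsilon> \<gamma> t k) \<ge> - (C * \<epsilon>)" for t
          unfolding hankel_form_def C_def Re_sum sum_distrib_right sum_negf[symmetric]
          by (rule sum_mono) (use low elim in auto)
        hence "norm (exp (hankel_form \<epsilon> \<gamma> t k)) > norm (\<xi> $ k)" for t
          using elim(1) by (smt (verit) exp_le_cancel_iff norm_exp_eq_Re)
        thus ?case by (metis less_irrefl)
      qed
    next
      case True
      define M where "M = Min (insert 1 ((\<lambda>j. Re (\<gamma> $ j $ k)) ` {j. \<gamma> $ j $ k \<noteq> 0}))"
      have M0: "M > 0" using R True by (auto simp: M_def)
      have M: "M \<le> Re (\<gamma> $ j $ k)" if "\<gamma> $ j $ k \<noteq> 0" for j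
        using that by (auto simp: M_def)
      define D where "D = C * (1 + C / M)"
      have D: "norm (hankel_form \<epsilon> \<gamma> t k) \<le> D * \<epsilon>"
        if e: "\<epsilon> > 0" and eq: "exp (hankel_form \<epsilon> \<gamma> t k) = \<xi> $ k" for \<epsilon> t
      proof -
        have Re0: "Re (hankel_form \<epsilon> \<gamma> t k) = 0"
          using True eq norm_exp_eq_Re[of "hankel_form \<epsilon> \<gamma> t k"] by simp
        have "norm (\<gamma> $ j $ k * hankel \<epsilon> (t $ j)) \<le> norm (\<gamma> $ j $ k) * ((1 + C / M) * \<epsilon>)" for j
        proof (cases "\<gamma> $ j $ k = 0")
          case False
          have "Re (\<gamma> $ j $ k * hankel \<epsilon> (t $ j)) = - (\<Sum>l\<in>UNIV-{j}. Re (\<gamma> $ l $ k * hankel \<epsilon> (t $ l)))"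
            using Re0 unfolding hankel_form_def Re_sum by (subst (asm) sum.remove[of _ j]) auto
          also have "\<dots> \<le> (\<Sum>l\<in>UNIV-{j}. norm (\<gamma> $ l $ k) * \<epsilon>)"
            unfolding sum_negf[symmetric] by (rule sum_mono) (metis low[OF e] minus_le_iff)
          also have "\<dots> \<le> C * \<epsilon>"
            unfolding C_def sum_distrib_right by (rule sum_mono2) (use e in auto)
          finally have up: "Re (\<gamma> $ j $ k * hankel \<epsilon> (t $ j)) \<le> C * \<epsilon>" .
          have "norm (hankel \<epsilon> (t $ j)) \<le> (1 + C / M) * \<epsilon>"
            using hankel_cases[OF e, of "t $ j"]
          proof
            assume "norm (hankel \<epsilon> (t $ j)) = \<epsilon>"
            moreover have "C / M * \<epsilon> \<ge> 0" using C0 M0 e by simp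
            ultimately show ?thesis by (simp add: algebra_simps)
          next
            assume "\<exists>u\<ge>\<epsilon>. hankel \<epsilon> (t $ j) = complex_of_real u"
            then obtain u where u: "u \<ge> \<epsilon>" "hankel \<epsilon> (t $ j) = complex_of_real u" by blast
            have "M * u \<le> Re (\<gamma> $ j $ k) * u" using M[OF False] u e by (intro mult_right_mono) auto
            also have "\<dots> \<le> C * \<epsilon>" using up u by simp
            finally have "u \<le> C / M * \<epsilon>" using M0 by (simp add: field_simps)
            thus ?thesis using u e by (simp add: algebra_simps)
          qed
          thus ?thesis unfolding norm_mult by (intro mult_left_mono) auto
        qed auto
        hence "norm (hankel_form \<epsilon> \<gamma> t k) \<le> (\<Sum>j\<in>UNIV. norm (\<gamma> $ j $ k) * ((1 + C / M) * \<epsilon>))"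
          unfolding hankel_form_def by (intro sum_norm_le) auto
        thus ?thesis unfolding sum_distrib_right[symmetric] C_def[symmetric] by (simp add: D_def mult_ac)
      qed
      have lim: "((\<lambda>\<epsilon>. D * \<epsilon>) \<longlongrightarrow> D * 0) (at_right (0::real))" by (intro tendsto_intros)
      have "isCont (exp :: complex \<Rightarrow> complex) 0" by simp
      then obtain r where r: "r > 0"
        "\<And>y::complex. norm y < r \<Longrightarrow> \<xi> $ k \<noteq> 1 \<Longrightarrow> norm (exp y - 1) < norm (\<xi> $ k - 1)"
      proof (cases "\<xi> $ k = 1")
        case False
        assume "isCont (exp :: complex \<Rightarrow> complex) 0"
        with False have "\<exists>d>0. \<forall>y::complex. dist y 0 < d \<longrightarrow> dist (exp y) (exp 0) < norm (\<xi> $ k - 1)"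
          unfolding continuous_at_eps_delta by auto
        thus ?thesis using that by (auto simp: dist_norm)
      qed (use zero_less_one in blast)
      have "\<forall>\<^sub>F \<epsilon> in at_right 0. D * \<epsilon> < min r (2 * pi)"
        using lim r(1) by (intro order_tendstoD(2)) auto
      thus ?thesis using eventually_at_right_less[of "0::real"]
      proof eventually_elim
        case (elim \<epsilon>)
        show ?case
        proof (intro allI impI)
          fix t assume eq: "exp (hankel_form \<epsilon> \<gamma> t k) = \<xi> $ k"
          let ?y = "hankel_form \<epsilon> \<gamma> t k"
          have sm: "norm ?y < r" "norm ?y < 2 * pi" using D[OF elim(2) eq] elim(1) by auto
          have "\<xi> $ k = 1" using r(2)[OF sm(1)] eq by auto
          hence "exp ?y = 1" using eq by simp
          then obtain n :: int where n: "Re ?y = 0" "Im ?y = of_int (2 * n) * pi"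
            unfolding exp_eq_1 by auto
          have "2 * \<bar>real_of_int n\<bar> * pi \<le> norm ?y"
            using abs_Im_le_cmod[of ?y] n by (simp add: abs_mult)
          hence "\<bar>real_of_int n\<bar> * (2 * pi) < 1 * (2 * pi)" using sm(2) by linarith
          hence "\<bar>real_of_int n\<bar> < 1" by (rule mult_right_less_imp_less) simp
          hence "n = 0" by linarith
          thus "?y = 0" using n by (simp add: complex_eq_iff)
        qed
      qed
    qed
  qed
  hence "\<forall>\<^sub>F \<epsilon> in at_right 0. \<forall>k. \<forall>t. exp (hankel_form \<epsilon> \<gamma> t k) = \<xi> $ k \<longrightarrow> hankel_form \<epsilon> \<gamma> t k = 0"
    by (subst eventually_all_finite) auto
  thus "hankel_regular \<xi> \<gamma>" unfolding hankel_regular_def by (rule eventually_mono) blast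
qed

end

theory Submission
  imports Defs
begin

text \<open>
  With \<open>\<phi>(y) = y / (e\<^sup>y - 1)\<close> the two factors belonging to \<open>\<xi>\<^sub>k = 1\<close> are \<open>F\<^sub>1(y, 1) = \<phi>'(y)\<close>
  and \<open>1 / (e\<^sup>y - 1) - c / (e\<^bsup>cy\<^esup> - 1) = (\<phi>(y) - \<phi>(cy)) / y\<close>, so that division by \<open>1 - c\<close>
  gives the difference quotient of \<open>\<phi>\<close> between \<open>cy\<close> and \<open>y\<close>. The values of the linear forms
  lie in a sector \<open>|y| \<le> A Re y + \<eta>\<close> with small \<open>\<eta>\<close>, on which \<open>\<phi>'\<close> is holomorphic and
  \<open>O(e\<^bsup>-(1-\<kappa>) Re y\<^esup>)\<close>; for small \<open>\<kappa>\<close> the decay of \<open>e\<^bsup>-\<beta>x\<^esup>\<close> absorbs the loss, and the limit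
  \<open>c \<rightarrow> 1\<close> is dominated convergence.

  For the analytic continuation, one variable at a time: in the coordinate \<open>z = log x\<close> the
  integrand \<open>x\<^bsup>s-1\<^esup> g(x) dx\<close> becomes \<open>e\<^bsup>sz\<^esup> g(e\<^sup>z) dz\<close>, which has a primitive on a left
  half-plane. Hence the Hankel integral does not depend on the radius, and for \<open>Re s > 0\<close> it
  equals \<open>e\<^bsup>2\<pi>is\<^esup> - 1\<close> times the integral over \<open>(0, \<infinity>)\<close>. So in each variable the Hankel
  representation (holomorphic for \<open>s \<noteq> 1, 2, 3, \<dots>\<close>) can be exchanged for \<open>\<Gamma>(s)\<^bsup>-1\<^esup> \<integral>\<^sub>0\<^sup>\<infinity>\<close>
  (holomorphic for \<open>Re s > 0\<close>), and these representations glue to an entire function.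
\<close>

section \<open>Complex differentiability in several variables\<close>

definition has_complex_derivative ::
  "(complex^'d \<Rightarrow> complex) \<Rightarrow> (complex^'d \<Rightarrow> complex) \<Rightarrow> complex^'d \<Rightarrow> bool" where
  "has_complex_derivative f L s \<longleftrightarrow> (f has_derivative L) (at s) \<and> (\<forall>a v. L (a *s v) = a * L v)"

definition complex_differentiable_at :: "(complex^'d \<Rightarrow> complex) \<Rightarrow> complex^'d \<Rightarrow> bool" where
  "complex_differentiable_at f s \<longleftrightarrow> (\<exists>L. has_complex_derivative f L s)"

lemma entire_fun_iff: "entire_fun f \<longleftrightarrow> (\<forall>s. complex_differentiable_at f s)"
  by (simp add: entire_fun_def complex_differentiable_at_def has_complex_derivative_def)

lemma complex_differentiable_at_prod:
  fixes f :: "'i \<Rightarrow> complex^'d \<Rightarrow> complex"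
  assumes "\<And>i. i \<in> I \<Longrightarrow> complex_differentiable_at (f i) s"
  shows "complex_differentiable_at (\<lambda>s. \<Prod>i\<in>I. f i s) s"
proof -
  obtain L where derivatives: "\<And>i. i \<in> I \<Longrightarrow> has_complex_derivative (f i) (L i) s"
    using assms unfolding complex_differentiable_at_def by metis
  have "has_complex_derivative (\<lambda>s. \<Prod>i\<in>I. f i s) (\<lambda>v. \<Sum>i\<in>I. L i v * (\<Prod>j\<in>I - {i}. f j s)) s"
    unfolding has_complex_derivative_def using derivatives
    by (intro conjI has_derivative_prod)
       (auto simp: has_complex_derivative_def sum_distrib_left mult.assoc intro!: sum.cong)
  thus ?thesis unfolding complex_differentiable_at_def by blast
qed

lemma complex_differentiable_at_mult:
  assumes "complex_differentiable_at f s" "complex_differentiable_at g s"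
  shows "complex_differentiable_at (\<lambda>s. f s * g s) s"
  using complex_differentiable_at_prod[of "UNIV :: bool set" "\<lambda>b. if b then f else g" s] assms
  by (simp add: UNIV_bool mult.commute)

lemma complex_differentiable_at_const: "complex_differentiable_at (\<lambda>s. c) s"
  unfolding complex_differentiable_at_def has_complex_derivative_def by (intro exI[of _ "\<lambda>_. 0"]) auto

lemma complex_differentiable_at_component:
  assumes "h field_differentiable at (s $ j)"
  shows "complex_differentiable_at (\<lambda>s. h (s $ j)) s"
proof -
  obtain h' where derivative_h: "(h has_field_derivative h') (at (s $ j))"
    using assms by (auto simp: field_differentiable_def)
  have "((\<lambda>s. s $ j) has_derivative (\<lambda>v. v $ j)) (at s)"
    by (intro bounded_linear_imp_has_derivative bounded_linear_vec_nth)
  hence "((\<lambda>s. h (s $ j)) has_derivative (\<lambda>v. h' * v $ j)) (at s)"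
    using derivative_h by (auto simp: has_field_derivative_def intro: has_derivative_compose)
  hence "has_complex_derivative (\<lambda>s. h (s $ j)) (\<lambda>v. h' * v $ j) s"
    by (simp add: has_complex_derivative_def)
  thus ?thesis unfolding complex_differentiable_at_def by blast
qed

lemma complex_differentiable_at_transform_open:
  assumes "complex_differentiable_at f s" "open S" "s \<in> S" "\<And>x. x \<in> S \<Longrightarrow> f x = g x"
  shows "complex_differentiable_at g s"
  using assms has_derivative_transform_within_open[OF _ assms(2,3)]
  unfolding complex_differentiable_at_def has_complex_derivative_def by blast

lemma norm_vector_scalar_mult_complex: "norm (a *s (v::complex^'d)) = norm a * norm v"
  by (simp add: norm_vec_def norm_mult L2_set_right_distrib)

lemma has_field_derivative_along_line:
  assumes "has_complex_derivative f L (s + z *s v)"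
  shows "((\<lambda>z. f (s + z *s v)) has_field_derivative L v) (at z)"
proof -
  have "bounded_linear (\<lambda>z. z *s v)"
    by (rule bounded_linear_intro[of _ "norm v"])
       (auto simp: vec_eq_iff algebra_simps norm_vector_scalar_mult_complex)
  hence "((\<lambda>z. s + z *s v) has_derivative (\<lambda>z. 0 + z *s v)) (at z)"
    by (intro has_derivative_add has_derivative_const bounded_linear_imp_has_derivative)
  from has_derivative_compose[OF this, of f L] assms
  have "((\<lambda>z. f (s + z *s v)) has_derivative (\<lambda>z. L (z *s v))) (at z)"
    by (simp add: has_complex_derivative_def)
  thus ?thesis using assms
    by (simp add: has_complex_derivative_def has_field_derivative_def mult.commute[of _ "L v"])
qed

lemma norm_deriv_deriv_le:
  assumes hol: "h holomorphic_on ball z r" and r_pos: "r > 0"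
    and bound: "\<And>x. x \<in> ball z r \<Longrightarrow> norm (h x) \<le> B" and x_in: "x \<in> cball z (r / 4)"
  shows "norm (deriv (deriv h) x) \<le> 32 * B / r\<^sup>2"
proof -
  have sub: "cball x (r / 4) \<subseteq> ball z r"
  proof
    fix y assume "y \<in> cball x (r / 4)"
    thus "y \<in> ball z r" using x_in r_pos dist_triangle[of z y x] by simp
  qed
  have "norm ((deriv ^^ 2) h x) \<le> fact 2 * B / (r / 4) ^ 2"
  proof (rule Cauchy_inequality)
    show "h holomorphic_on ball x (r / 4)"
      using hol sub by (meson ball_subset_cball holomorphic_on_subset order_trans)
    show "continuous_on (cball x (r / 4)) h"
      using hol sub by (meson holomorphic_on_imp_continuous_on continuous_on_subset)
    show "norm (h y) \<le> B" if "norm (x - y) = r / 4" for y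
      using that sub by (intro bound) (auto simp: subset_iff dist_norm)
  qed (use r_pos in auto)
  thus ?thesis by (simp add: numeral_2_eq_2 power2_eq_square)
qed

lemma holomorphic_first_order_remainder:
  assumes hol: "h holomorphic_on ball z r" and r_pos: "r > 0"
    and bound: "\<And>x. x \<in> ball z r \<Longrightarrow> norm (h x) \<le> B" and w_small: "norm w \<le> r / 4"
  shows "norm (h (z + w) - h z - deriv h z * w) \<le> 32 * B / r\<^sup>2 * (norm w)\<^sup>2"
proof -
  have "norm ((deriv ^^ 0) h (z + w) - (\<Sum>i\<le>1. (deriv ^^ i) h z * (z + w - z) ^ i / fact i))
      \<le> 32 * B / r\<^sup>2 * norm (z + w - z) ^ Suc 1 / fact 1"
  proof (rule complex_Taylor[of "cball z (r / 4)"])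
    fix x assume x_in: "x \<in> cball z (r / 4)"
    show "((deriv ^^ i) h has_field_derivative (deriv ^^ Suc i) h x) (at x within cball z (r / 4))"
        for i
    proof -
      have "((deriv ^^ i) h has_field_derivative deriv ((deriv ^^ i) h) x) (at x)"
        using x_in r_pos
        by (intro holomorphic_derivI[of _ "ball z r"] holomorphic_higher_deriv hol) auto
      thus ?thesis by (simp add: has_field_derivative_at_within)
    qed
    show "norm ((deriv ^^ Suc 1) h x) \<le> 32 * B / r\<^sup>2"
      using norm_deriv_deriv_le[OF hol r_pos bound x_in] by simp
  qed (use w_small r_pos in \<open>auto simp: dist_norm\<close>)
  thus ?thesis by (simp add: power2_eq_square algebra_simps)
qed

lemma complex_first_order_remainder:
  assumes R_pos: "R > 0" and diff: "\<And>s. s \<in> ball s0 R \<Longrightarrow> complex_differentiable_at f s"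
    and bound: "\<And>s. s \<in> ball s0 R \<Longrightarrow> norm (f s) \<le> B"
    and derivative: "has_complex_derivative f L s0" and v_small: "norm v \<le> R / 4"
  shows "norm (f (s0 + v) - f s0 - L v) \<le> 32 * B / R\<^sup>2 * (norm v)\<^sup>2"
proof (cases "v = 0")
  case True
  have "linear L" using derivative unfolding has_complex_derivative_def
    by (blast intro: has_derivative_linear)
  thus ?thesis using True linear_0 by fastforce
next
  case False
  define h where "h z = f (s0 + z *s v)" for z
  have in_ball: "s0 + z *s v \<in> ball s0 R" if "z \<in> ball 0 (R / norm v)" for z
    using that False by (simp add: dist_norm norm_vector_scalar_mult_complex field_simps)
  have hol: "h holomorphic_on ball 0 (R / norm v)"
    using diff[OF in_ball] has_field_derivative_along_line
    unfolding h_def holomorphic_on_def field_differentiable_def complex_differentiable_at_def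
    by (blast intro: has_field_derivative_at_within)
  have deriv: "deriv h 0 = L v"
    using has_field_derivative_along_line[of f L s0 0 v] derivative
    by (simp add: h_def[abs_def] DERIV_imp_deriv)
  have "norm (h (0 + 1) - h 0 - deriv h 0 * 1) \<le> 32 * B / (R / norm v)\<^sup>2 * (norm (1::complex))\<^sup>2"
    using v_small False R_pos
    by (intro holomorphic_first_order_remainder hol)
       (auto simp: h_def field_simps intro!: bound in_ball)
  thus ?thesis unfolding deriv by (simp add: h_def power_divide)
qed

lemma has_derivative_if_quadratic_remainder:
  assumes "bounded_linear L" and "r > 0"
    and remainder: "\<And>v. norm v \<le> r \<Longrightarrow> norm (f (x + v) - f x - L v) \<le> K * (norm v)\<^sup>2"
  shows "(f has_derivative L) (at x)"
  unfolding has_derivative_at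
proof (intro conjI assms(1))
  have "((\<lambda>v. K * norm v) \<longlongrightarrow> K * 0) (at (0::'a))" by (intro tendsto_intros tendsto_norm_zero)
  hence "((\<lambda>v. K * norm v) \<longlongrightarrow> 0) (at (0::'a))" by simp
  moreover have "\<forall>\<^sub>F v in at 0. norm (norm (f (x + v) - f x - L v) / norm v) \<le> K * norm v"
    unfolding eventually_at
  proof (intro exI[of _ r] conjI ballI impI)
    fix v :: 'a assume "v \<noteq> 0 \<and> dist v 0 < r"
    thus "norm (norm (f (x + v) - f x - L v) / norm v) \<le> K * norm v"
      using remainder[of v] by (simp add: field_simps power2_eq_square)
  qed fact
  ultimately show "(\<lambda>v. norm (f (x + v) - f x - L v) / norm v) \<midarrow>0\<rightarrow> 0"
    by (rule Lim_null_comparison[rotated])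
qed

context
  fixes f :: "complex^'d \<Rightarrow> 'a \<Rightarrow> complex" and L :: "'a \<Rightarrow> complex^'d \<Rightarrow> complex"
    and M :: "'a measure" and B :: "'a \<Rightarrow> real" and s0 :: "complex^'d" and R :: real
  assumes R_pos: "R > 0"
    and measurable_f: "\<And>s. s \<in> ball s0 R \<Longrightarrow> f s \<in> borel_measurable M"
    and differentiable_f: "\<And>s t. s \<in> ball s0 R \<Longrightarrow> complex_differentiable_at (\<lambda>s. f s t) s"
    and bound_f: "\<And>s t. s \<in> ball s0 R \<Longrightarrow> norm (f s t) \<le> B t"
    and integrable_B: "integrable M B"
    and derivative_L: "\<And>t. has_complex_derivative (\<lambda>s. f s t) (L t) s0"
begin

lemma linear_pointwise_derivative: "linear (L t)"
  using derivative_L[of t] unfolding has_complex_derivative_def by (blast intro: has_derivative_linear)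

lemma pointwise_remainder:
  assumes "norm v \<le> R / 4"
  shows "norm (f (s0 + v) t - f s0 t - L t v) \<le> 32 * B t / R\<^sup>2 * (norm v)\<^sup>2"
  using complex_first_order_remainder[OF R_pos differentiable_f bound_f derivative_L assms] .

lemma integrable_family:
  assumes "s \<in> ball s0 R"
  shows "integrable M (f s)"
  by (rule Bochner_Integration.integrable_bound[OF integrable_B measurable_f[OF assms]])
     (use bound_f[OF assms] in \<open>auto intro!: AE_I2 order_trans[OF _ abs_ge_self]\<close>)

lemma measurable_pointwise_derivative:
  assumes v_small: "norm v < R"
  shows "(\<lambda>t. L t v) \<in> borel_measurable M"
proof (rule borel_measurable_LIMSEQ_metric)
  let ?h = "\<lambda>n. complex_of_real (inverse (real (Suc n)))"
  let ?quotient = "\<lambda>n t. (f (s0 + ?h n *s v) t - f s0 t) / ?h n"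
  have "s0 + ?h n *s v \<in> ball s0 R" for n
  proof -
    have "norm (?h n) \<le> 1"
      unfolding norm_of_real using inverse_le_1_iff[of "real (Suc n)"] by simp
    hence "norm (?h n *s v) \<le> norm v"
      unfolding norm_vector_scalar_mult_complex by (intro mult_left_le_one_le) auto
    thus ?thesis using v_small by (simp add: dist_norm)
  qed
  thus "?quotient n \<in> borel_measurable M" for n
    using R_pos by (intro borel_measurable_divide borel_measurable_diff measurable_f) auto
  fix t
  have "(\<lambda>n. ?h n) \<longlonglongrightarrow> of_real 0" by (intro tendsto_of_real LIMSEQ_inverse_real_of_nat)
  moreover have "?h n \<noteq> 0" for n unfolding of_real_eq_0_iff by simp
  ultimately have "filterlim ?h (at 0) sequentially"
    unfolding filterlim_at of_real_0 by (intro conjI always_eventually allI UNIV_I)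
  moreover have "((\<lambda>z. (f (s0 + z *s v) t - f s0 t) / z) \<longlongrightarrow> L t v) (at 0)"
    using has_field_derivative_along_line[of "\<lambda>s. f s t" "L t" s0 0 v] derivative_L[of t]
    by (simp add: has_field_derivative_iff)
  ultimately show "(\<lambda>n. ?quotient n t) \<longlonglongrightarrow> L t v"
    by (rule filterlim_compose[rotated])
qed

lemma integrable_pointwise_derivative: "integrable M (\<lambda>t. L t v)"
proof -
  have small: "integrable M (\<lambda>t. L t v)" if v_small: "norm v \<le> R / 4" for v
  proof -
    have in_ball: "s0 \<in> ball s0 R" "s0 + v \<in> ball s0 R" using v_small R_pos by (auto simp: dist_norm)
    have "integrable M (\<lambda>t. f (s0 + v) t - f s0 t - L t v)"
    proof (rule Bochner_Integration.integrable_bound)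
      show "integrable M (\<lambda>t. 32 * B t / R\<^sup>2 * (norm v)\<^sup>2)" using integrable_B by simp
      show "(\<lambda>t. f (s0 + v) t - f s0 t - L t v) \<in> borel_measurable M"
        using in_ball v_small R_pos
        by (intro borel_measurable_diff measurable_f measurable_pointwise_derivative) auto
      show "AE t in M. norm (f (s0 + v) t - f s0 t - L t v) \<le> norm (32 * B t / R\<^sup>2 * (norm v)\<^sup>2)"
        using pointwise_remainder[OF v_small]
        by (intro AE_I2) (metis abs_ge_self order_trans real_norm_def)
    qed
    from Bochner_Integration.integrable_diff[OF Bochner_Integration.integrable_diff[OF
        integrable_family[OF in_ball(2)] integrable_family[OF in_ball(1)]] this]
    show ?thesis by simp
  qed
  show ?thesis
  proof (cases "v = 0")
    case False
    define a where "a = R / (4 * norm v)"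
    have scaled_v: "a > 0" "norm (a *\<^sub>R v) \<le> R / 4" using R_pos False by (auto simp: a_def)
    have "L t v = L t (a *\<^sub>R v) /\<^sub>R a" for t
      using scaled_v linear_pointwise_derivative by (simp add: linear_cmul)
    thus ?thesis using small[OF scaled_v(2)] by simp
  qed (use small[of v] R_pos in auto)
qed

lemma has_complex_derivative_integral:
  "has_complex_derivative (\<lambda>s. \<integral>t. f s t \<partial>M) (\<lambda>v. \<integral>t. L t v \<partial>M) s0"
proof -
  have "linear (\<lambda>v. \<integral>t. L t v \<partial>M)"
    using linear_pointwise_derivative integrable_pointwise_derivative
    by (intro linearI) (simp_all add: linear_add linear_cmul Bochner_Integration.integral_add)
  hence bounded: "bounded_linear (\<lambda>v. \<integral>t. L t v \<partial>M)" using linear_conv_bounded_linear by blast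
  have "((\<lambda>s. \<integral>t. f s t \<partial>M) has_derivative (\<lambda>v. \<integral>t. L t v \<partial>M)) (at s0)"
  proof (rule has_derivative_if_quadratic_remainder[OF bounded])
    fix v :: "complex^'d" assume v_small: "norm v \<le> R / 4"
    have integrable: "integrable M (f s0)" "integrable M (f (s0 + v))"
      using v_small R_pos by (auto intro!: integrable_family simp: dist_norm)
    have "(\<integral>t. f (s0 + v) t \<partial>M) - (\<integral>t. f s0 t \<partial>M) - (\<integral>t. L t v \<partial>M) =
        (\<integral>t. f (s0 + v) t - f s0 t - L t v \<partial>M)"
      using integrable integrable_pointwise_derivative by simp
    also have "norm \<dots> \<le> (\<integral>t. norm (f (s0 + v) t - f s0 t - L t v) \<partial>M)"
      by (rule integral_norm_bound)
    also have "\<dots> \<le> (\<integral>t. 32 * B t / R\<^sup>2 * (norm v)\<^sup>2 \<partial>M)"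
      using integrable integrable_pointwise_derivative integrable_B pointwise_remainder[OF v_small]
      by (intro integral_mono) auto
    also have "\<dots> = 32 * (\<integral>t. B t \<partial>M) / R\<^sup>2 * (norm v)\<^sup>2" by simp
    finally show "norm ((\<integral>t. f (s0 + v) t \<partial>M) - (\<integral>t. f s0 t \<partial>M) - (\<integral>t. L t v \<partial>M))
        \<le> 32 * (\<integral>t. B t \<partial>M) / R\<^sup>2 * (norm v)\<^sup>2" .
  qed (use R_pos in auto)
  thus ?thesis using derivative_L by (simp add: has_complex_derivative_def)
qed

end

lemma complex_differentiable_at_integral:
  fixes f :: "complex^'d \<Rightarrow> 'a \<Rightarrow> complex"
  assumes "R > 0"
    and "\<And>s. s \<in> ball s0 R \<Longrightarrow> f s \<in> borel_measurable M"
    and "\<And>s t. s \<in> ball s0 R \<Longrightarrow> complex_differentiable_at (\<lambda>s. f s t) s"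
    and "\<And>s t. s \<in> ball s0 R \<Longrightarrow> norm (f s t) \<le> B t"
    and "integrable M B"
  shows "complex_differentiable_at (\<lambda>s. \<integral>t. f s t \<partial>M) s0"
proof -
  have "\<forall>t. \<exists>L. has_complex_derivative (\<lambda>s. f s t) L s0"
    using assms(1,3) by (simp add: complex_differentiable_at_def)
  then obtain L where "\<And>t. has_complex_derivative (\<lambda>s. f s t) (L t) s0" by metis
  from has_complex_derivative_integral[OF assms this] show ?thesis
    unfolding complex_differentiable_at_def by blast
qed

section \<open>Hankel contours and their kernels\<close>

definition keyhole :: "real \<Rightarrow> complex set" where
  "keyhole e = ball 0 e \<union> of_real ` {0..}"

text \<open>
  Radius \<open>0\<close> encodes the representation by \<open>\<integral>\<^sub>0\<^sup>\<infinity> u\<^bsup>s-1\<^esup> du / \<Gamma>(s)\<close>, which replaces the Hankel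
  contour near \<open>s = 1, 2, 3, \<dots>\<close>, where the factor of the latter has poles.
\<close>

definition contour_point :: "real \<Rightarrow> real \<Rightarrow> complex" where
  "contour_point r t = (if r = 0 then of_real (max 0 t) else hankel r t)"

definition contour_kernel :: "real \<Rightarrow> complex \<Rightarrow> real \<Rightarrow> complex" where
  "contour_kernel r s t =
     (if r = 0 then if t > 0 then exp ((s - 1) * of_real (ln t)) else 0
      else hankel_powr r t (s - 1) * vector_derivative (hankel r) (at t))"

definition contour_factor :: "real \<Rightarrow> complex \<Rightarrow> complex" where
  "contour_factor r s = (if r = 0 then rGamma s else hankel_factor s)"

definition contour_domain :: "real \<Rightarrow> complex set" where
  "contour_domain r = (if r = 0 then {s. Re s > 0} else - of_nat ` {1..})"

abbreviation monodromy :: "complex \<Rightarrow> complex" where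
  "monodromy s \<equiv> exp (2 * of_real pi * \<i> * s)"

lemma keyhole_cases [case_names disc ray, consumes 1]:
  assumes "x \<in> keyhole e"
  obtains "norm x < e" | u where "u \<ge> 0" "x = of_real u"
  using assms by (auto simp: keyhole_def)

lemma zero_in_keyhole: "0 \<in> keyhole e"
  by (force simp: keyhole_def)

lemma hankel_abs_eq: "hankel_abs r t = r + max 0 (-t) + max 0 (t - 2 * pi)"
  using pi_gt_zero by (auto simp: hankel_abs_def max_def simp del: pi_gt_zero)

lemma hankel_arg_eq: "hankel_arg t = max 0 (min t (2 * pi))"
  using pi_gt_zero by (auto simp: hankel_arg_def max_def min_def simp del: pi_gt_zero)

lemma hankel_abs_ge: "hankel_abs r t \<ge> r"
  by (simp add: hankel_abs_eq)

lemma norm_hankel: "r > 0 \<Longrightarrow> norm (hankel r t) = hankel_abs r t"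
  using hankel_abs_ge[of r t] by (simp add: hankel_def)

lemma continuous_hankel: "continuous_on UNIV (hankel r)"
  unfolding hankel_def[abs_def] rcis_def cis_conv_exp hankel_abs_eq hankel_arg_eq
  by (intro continuous_intros)

lemma hankel_upper: "t < 0 \<Longrightarrow> hankel r t = of_real (r - t)"
  by (simp add: hankel_def hankel_abs_def hankel_arg_def rcis_def)

lemma hankel_circle_eq:
  assumes "r > 0" "0 \<le> t" "t \<le> 2 * pi"
  shows "hankel r t = exp (Complex (ln r) t)"
  using assms by (simp add: hankel_def hankel_abs_def hankel_arg_def rcis_def cis_conv_exp
      Complex_eq exp_add exp_of_real)

lemma hankel_lower: "2 * pi < t \<Longrightarrow> hankel r t = of_real (r + (t - 2 * pi))"
  using pi_gt_zero
  by (auto simp: hankel_def hankel_abs_def hankel_arg_def rcis_def simp del: pi_gt_zero)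

lemma vector_derivative_eq_on_open:
  assumes "(f has_vector_derivative d) (at t)" "open S" "t \<in> S" "\<And>x. x \<in> S \<Longrightarrow> f x = g x"
  shows "vector_derivative g (at t) = d"
  using has_vector_derivative_transform_within_open[OF assms] by (rule vector_derivative_at)

lemma vector_derivative_hankel_upper: "t < 0 \<Longrightarrow> vector_derivative (hankel r) (at t) = -1"
  by (rule vector_derivative_eq_on_open[of "\<lambda>t. of_real (r - t)" _ _ "{..<0}"])
     (auto simp: hankel_upper intro!: derivative_eq_intros)

lemma vector_derivative_hankel_lower: "2 * pi < t \<Longrightarrow> vector_derivative (hankel r) (at t) = 1"
  by (rule vector_derivative_eq_on_open[of "\<lambda>t. of_real (r + (t - 2 * pi))" _ _ "{2 * pi<..}"])
     (auto simp: hankel_lower intro!: derivative_eq_intros)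

lemma vector_derivative_hankel_circle:
  assumes "r > 0" "0 < t" "t < 2 * pi"
  shows "vector_derivative (hankel r) (at t) = \<i> * hankel r t"
proof (rule vector_derivative_eq_on_open[of "\<lambda>t. exp (Complex (ln r) t)" _ _ "{0<..<2 * pi}"])
  have "((\<lambda>z. exp (of_real (ln r) + \<i> * z)) has_field_derivative \<i> * hankel r t) (at (of_real t))"
    using assms by (auto simp: hankel_circle_eq Complex_eq intro!: derivative_eq_intros)
  thus "((\<lambda>t. exp (Complex (ln r) t)) has_vector_derivative \<i> * hankel r t) (at t)"
    unfolding Complex_eq by (rule has_vector_derivative_real_field)
qed (use assms in \<open>auto simp: hankel_circle_eq\<close>)

lemma bounded_vector_derivative_hankel:
  assumes r_pos: "r > 0"
  shows "bounded (range (\<lambda>t. vector_derivative (hankel r) (at t)))"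
proof -
  let ?d = "\<lambda>t. vector_derivative (hankel r) (at t)"
  have "?d t \<in> cball 0 (max 1 r) \<union> {?d 0, ?d (2 * pi)}" for t
  proof -
    consider "t < 0" | "t = 0" | "0 < t" "t < 2 * pi" | "t = 2 * pi" | "t > 2 * pi" by linarith
    thus ?thesis
      by cases (use r_pos in \<open>auto simp: vector_derivative_hankel_upper vector_derivative_hankel_circle
          vector_derivative_hankel_lower norm_mult norm_hankel hankel_abs_def\<close>)
  qed
  hence "range ?d \<subseteq> cball 0 (max 1 r) \<union> {?d 0, ?d (2 * pi)}" by blast
  moreover have "bounded (cball 0 (max 1 r) \<union> {?d 0, ?d (2 * pi)})" by simp
  ultimately show ?thesis by (rule bounded_subset[rotated])
qed

lemma continuous_contour_point: "continuous_on UNIV (contour_point r)"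
proof (cases "r = 0")
  case True
  thus ?thesis unfolding contour_point_def[abs_def] by (simp, intro continuous_intros)
next
  case False
  thus ?thesis unfolding contour_point_def[abs_def] using continuous_hankel[of r] by simp
qed

lemma contour_point_in_keyhole:
  assumes "0 \<le> r" "r < e"
  shows "contour_point r t \<in> keyhole e"
proof (cases "r = 0")
  case False
  thus ?thesis using hankel_cases[of r t] assms by (auto simp: contour_point_def keyhole_def)
qed (auto simp: contour_point_def keyhole_def)

lemma norm_contour_point: "r > 0 \<Longrightarrow> norm (contour_point r t) = hankel_abs r t"
  by (simp add: contour_point_def norm_hankel)

lemma norm_contour_point_0: "norm (contour_point 0 t) = max 0 t"
  by (simp add: contour_point_def)

lemma contour_upper:
  assumes "r > 0" "t < 0"
  shows "contour_point r t = contour_point 0 (r - t)"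
    and "contour_kernel r s t = - contour_kernel 0 s (r - t)"
  using assms by (simp_all add: contour_point_def contour_kernel_def hankel_upper
      vector_derivative_hankel_upper hankel_powr_def hankel_abs_def hankel_arg_def Complex_eq)

lemma contour_circle:
  assumes "r > 0" "0 < t" "t < 2 * pi"
  shows "contour_point r t = exp (Complex (ln r) t)"
    and "contour_kernel r s t = \<i> * exp (s * Complex (ln r) t)"
proof -
  show point: "contour_point r t = exp (Complex (ln r) t)"
    using assms by (simp add: contour_point_def hankel_circle_eq)
  have "exp ((s - 1) * Complex (ln r) t) * exp (Complex (ln r) t) = exp (s * Complex (ln r) t)"
    by (simp add: algebra_simps flip: exp_add)
  thus "contour_kernel r s t = \<i> * exp (s * Complex (ln r) t)"
    using assms by (simp add: contour_kernel_def hankel_powr_def hankel_abs_def hankel_arg_def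
        vector_derivative_hankel_circle hankel_circle_eq)
qed

lemma contour_lower:
  assumes r_pos: "r > 0" and t_gt: "2 * pi < t"
  shows "contour_point r t = contour_point 0 (r + (t - 2 * pi))"
    and "contour_kernel r s t = monodromy s * contour_kernel 0 s (r + (t - 2 * pi))"
proof -
  show "contour_point r t = contour_point 0 (r + (t - 2 * pi))"
    using r_pos t_gt by (simp add: contour_point_def hankel_lower)
  have "(s - 1) * Complex (ln (r + (t - 2 * pi))) (2 * pi)
      = 2 * of_real pi * \<i> * s + (s - 1) * of_real (ln (r + (t - 2 * pi))) - 2 * of_real pi * \<i>"
    by (simp add: Complex_eq algebra_simps)
  hence "exp ((s - 1) * Complex (ln (r + (t - 2 * pi))) (2 * pi))
      = monodromy s * exp ((s - 1) * of_real (ln (r + (t - 2 * pi))))"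
    by (simp add: exp_diff exp_add)
  moreover have "\<not> t < 0" "\<not> t \<le> 2 * pi" using t_gt pi_gt_zero by linarith+
  ultimately show "contour_kernel r s t =
      monodromy s * contour_kernel 0 s (r + (t - 2 * pi))"
    using r_pos t_gt by (simp add: contour_kernel_def hankel_powr_def hankel_abs_def hankel_arg_def
        vector_derivative_hankel_lower)
qed

lemma measurable_contour_kernel [measurable]:
  assumes "r \<ge> 0"
  shows "contour_kernel r s \<in> borel_measurable borel"
proof (cases "r = 0")
  case True
  have "(\<lambda>t. if t > 0 then exp ((s - 1) * complex_of_real (ln t)) else 0) \<in> borel_measurable borel"
    by measurable
  thus ?thesis using True by (simp add: contour_kernel_def[abs_def])
next
  case False
  hence r_pos: "r > 0" using assms by simp
  define d where "d t = vector_derivative (hankel r) (at t)" for t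
  have [measurable]: "hankel r \<in> borel_measurable borel"
    by (rule borel_measurable_continuous_onI, rule continuous_hankel)
  have "d = (\<lambda>t. if t < 0 then -1 else if t = 0 then d 0 else if t < 2 * pi then \<i> * hankel r t
                 else if t = 2 * pi then d (2 * pi) else 1)"
    using r_pos by (auto simp: fun_eq_iff d_def vector_derivative_hankel_upper
        vector_derivative_hankel_circle vector_derivative_hankel_lower)
  hence [measurable]: "d \<in> borel_measurable borel" by (rule ssubst) measurable
  have "continuous_on UNIV (\<lambda>t. hankel_powr r t (s - 1))"
    unfolding hankel_powr_def hankel_abs_eq hankel_arg_eq Complex_eq
    by (intro continuous_intros ballI) (use r_pos in \<open>auto simp: max_def\<close>)
  hence [measurable]: "(\<lambda>t. hankel_powr r t (s - 1)) \<in> borel_measurable borel"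
    by (rule borel_measurable_continuous_onI)
  have "(\<lambda>t. hankel_powr r t (s - 1) * d t) \<in> borel_measurable borel" by measurable
  thus ?thesis using False by (simp add: contour_kernel_def[abs_def] d_def)
qed

lemma contour_kernel_field_differentiable:
  "(\<lambda>s. contour_kernel r s t) field_differentiable at s"
proof -
  have "(\<lambda>s. exp ((s - 1) * c) * d) field_differentiable at s" for c d :: complex
    by (intro holomorphic_on_imp_differentiable_at[of _ UNIV] holomorphic_intros) auto
  from this[of "of_real (ln t)" 1] this[of _ "vector_derivative (hankel r) (at t)"]
  show ?thesis
    unfolding contour_kernel_def hankel_powr_def by (cases "r = 0"; cases "t > 0") auto
qed

subsection \<open>Integrable majorants\<close>

lemma integrable_powr_exp:
  fixes a b :: real
  assumes "a > -1" "b > 0"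
  shows "integrable lborel (\<lambda>u. indicator {0<..} u * (u powr a * exp (- (b * u))))"
proof -
  let ?f = "\<lambda>t.
      indicator {0<..} t *\<^sub>R (complex_of_real t powr (of_real (a + 1) - 1) / of_real (exp (b * t)))"
  have "integrable lebesgue ?f"
    using absolutely_integrable_Gamma_integral[of "of_real (a + 1)" b] assms
    by (simp add: set_integrable_def)
  hence "integrable lebesgue (\<lambda>t. norm (?f t))" by (rule integrable_norm)
  also have "(\<lambda>t. norm (?f t)) = (\<lambda>u. indicator {0<..} u * (u powr a * exp (- (b * u))))"
    by (auto simp: fun_eq_iff indicator_def norm_divide exp_minus field_simps powr_of_real)
  finally show ?thesis by (subst (asm) integrable_completion) auto
qed

lemma integrable_powr_exp_truncated:
  fixes a b r :: real
  assumes r_pos: "r > 0" and b_pos: "b > 0"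
  shows "integrable lborel (\<lambda>u. indicator {r..} u * (u powr a * exp (- (b * u))))"
proof (rule Bochner_Integration.integrable_bound)
  define a' where "a' = max a 0"
  let ?g = "\<lambda>u. r powr (a - a') * (indicator {0<..} u * (u powr a' * exp (- (b * u))))"
  show "integrable lborel ?g"
    using b_pos by (intro integrable_mult_right integrable_powr_exp) (auto simp: a'_def)
  have "u powr a \<le> r powr (a - a') * u powr a'" if "u \<ge> r" for u
  proof -
    have "u powr a = u powr (a - a') * u powr a'" by (simp add: powr_add[symmetric])
    also have "\<dots> \<le> r powr (a - a') * u powr a'"
      using r_pos that by (intro mult_right_mono powr_mono2') (auto simp: a'_def)
    finally show ?thesis .
  qed
  thus "AE u in lborel. norm (indicator {r..} u * (u powr a * exp (- (b * u)))) \<le> norm (?g u)"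
    using r_pos by (intro AE_I2) (auto simp: indicator_def)
qed auto

lemma integrable_hankel_abs:
  fixes a b r :: real
  assumes r_pos: "r > 0" and b_pos: "b > 0"
  shows "integrable lborel (\<lambda>t. hankel_abs r t powr a * exp (- (b * hankel_abs r t)))"
proof -
  define h where "h u = indicator {r..} u * (u powr a * exp (- (b * u)))" for u
  have integrable_h: "integrable lborel h"
    unfolding h_def[abs_def] by (rule integrable_powr_exp_truncated[OF assms])
  have "integrable lborel (\<lambda>t. indicator {..<0} t *\<^sub>R h (r + (-1) * t))"
    by (intro integrable_mult_indicator lborel_integrable_real_affine integrable_h) auto
  moreover have "integrable lborel (\<lambda>t. indicator {2*pi<..} t *\<^sub>R h ((r - 2 * pi) + 1 * t))"
    by (intro integrable_mult_indicator lborel_integrable_real_affine integrable_h) auto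
  moreover have "integrable lborel (\<lambda>t. indicator {0..2*pi} t * (r powr a * exp (- (b * r))))"
    by (intro integrable_mult_left integrable_real_indicator) auto
  moreover have "(\<lambda>t. hankel_abs r t powr a * exp (- (b * hankel_abs r t))) =
    (\<lambda>t. indicator {..<0} t *\<^sub>R h (r + (-1) * t) + indicator {2*pi<..} t *\<^sub>R h ((r - 2 * pi) + 1 * t)
        + indicator {0..2*pi} t * (r powr a * exp (- (b * r))))"
    using pi_gt_zero
    by (auto simp: fun_eq_iff hankel_abs_def h_def indicator_def algebra_simps simp del: pi_gt_zero)
  ultimately show ?thesis by simp
qed

lemma integrable_contour_powr_exp:
  assumes r_nonneg: "r \<ge> 0" and b_pos: "b > 0" and exponent: "r = 0 \<Longrightarrow> a > -1"
  shows "integrable lborel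
    (\<lambda>t. norm (contour_point r t) powr a * exp (- (b * norm (contour_point r t))))"
proof (cases "r = 0")
  case True
  have "(\<lambda>t. max 0 t powr a * exp (- (b * max 0 t)))
      = (\<lambda>t. indicator {0<..} t * (t powr a * exp (- (b * t))))"
    by (auto simp: fun_eq_iff max_def indicator_def)
  thus ?thesis using integrable_powr_exp[OF exponent b_pos] True by (simp add: norm_contour_point_0)
next
  case False
  thus ?thesis using integrable_hankel_abs[of r b a] r_nonneg b_pos by (simp add: norm_contour_point)
qed

lemma powr_le_powr_ends:
  fixes u :: real
  assumes "u \<ge> 0" "\<bar>x - a\<bar> \<le> R"
  shows "u powr x \<le> u powr (a - R) + u powr (a + R)"
proof (cases "u \<ge> 1")
  case True
  hence "u powr x \<le> u powr (a + R)" using assms by (intro powr_mono) auto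
  thus ?thesis by (simp add: add_increasing)
next
  case False
  hence "u powr x \<le> u powr (a - R)" using assms by (intro powr_mono') auto
  thus ?thesis by (simp add: add_increasing2)
qed

lemma norm_hankel_powr_le:
  assumes r_pos: "r > 0"
  shows "norm (hankel_powr r t s) \<le> hankel_abs r t powr Re s * exp (\<bar>Im s\<bar> * (2 * pi))"
proof -
  have "norm (hankel_powr r t s) = hankel_abs r t powr Re s * exp (- (Im s * hankel_arg t))"
    using hankel_abs_ge[of r t] r_pos
    by (simp add: hankel_powr_def powr_def exp_diff exp_minus field_simps flip: exp_add)
  moreover have "- (Im s * hankel_arg t) \<le> \<bar>Im s\<bar> * (2 * pi)"
  proof -
    have "- (Im s * hankel_arg t) \<le> \<bar>Im s * hankel_arg t\<bar>" by simp
    also have "\<dots> \<le> \<bar>Im s\<bar> * (2 * pi)"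
      unfolding abs_mult by (intro mult_left_mono) (auto simp: hankel_arg_eq)
    finally show ?thesis .
  qed
  ultimately show ?thesis by (simp add: mult_left_mono)
qed

lemma norm_contour_kernel_le:
  assumes r_nonneg: "r \<ge> 0"
  obtains C where "C \<ge> 0"
    "\<And>s t. \<bar>Im s\<bar> \<le> Y \<Longrightarrow> norm (contour_kernel r s t) \<le> C * norm (contour_point r t) powr (Re s - 1)"
proof (cases "r = 0")
  case True
  have "norm (contour_kernel 0 s t) \<le> 1 * norm (contour_point 0 t) powr (Re s - 1)" for s t
    by (simp add: contour_kernel_def norm_contour_point_0 powr_def)
  thus ?thesis using that[of 1] True by simp
next
  case False
  with r_nonneg have r_pos: "r > 0" by simp
  obtain D where D_bound: "D > 0" "\<And>t. norm (vector_derivative (hankel r) (at t)) \<le> D"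
    using bounded_vector_derivative_hankel[OF r_pos] unfolding bounded_pos by auto
  show ?thesis
  proof (rule that[of "exp (Y * (2 * pi)) * D"])
    fix s t assume Im_le: "\<bar>Im s\<bar> \<le> Y"
    have "norm (hankel_powr r t (s - 1))
        \<le> hankel_abs r t powr Re (s - 1) * exp (\<bar>Im (s - 1)\<bar> * (2 * pi))"
      by (rule norm_hankel_powr_le[OF r_pos])
    also have "\<dots> \<le> hankel_abs r t powr (Re s - 1) * exp (Y * (2 * pi))"
      using Im_le by (intro mult_mono) auto
    finally have "norm (contour_kernel r s t)
        \<le> (hankel_abs r t powr (Re s - 1) * exp (Y * (2 * pi))) * D"
      using r_pos D_bound by (simp add: contour_kernel_def norm_mult mult_mono)
    thus "norm (contour_kernel r s t)
        \<le> exp (Y * (2 * pi)) * D * norm (contour_point r t) powr (Re s - 1)"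
      by (simp add: norm_contour_point[OF r_pos] mult_ac)
  qed (use D_bound in auto)
qed

lemma contour_kernel_majorant:
  assumes r_nonneg: "r \<ge> 0" and R_nonneg: "R \<ge> 0" and Re_s0: "r = 0 \<Longrightarrow> Re s0 > R" and b_pos: "b > 0"
  obtains k where "integrable lborel k"
    "\<And>s t. norm (s - s0) \<le> R \<Longrightarrow> norm (contour_kernel r s t) * exp (- (b * norm (contour_point r t)))
        \<le> k t"
proof -
  obtain C where kernel_le: "C \<ge> 0" "\<And>s t. \<bar>Im s\<bar> \<le> \<bar>Im s0\<bar> + R \<Longrightarrow>
      norm (contour_kernel r s t) \<le> C * norm (contour_point r t) powr (Re s - 1)"
    using norm_contour_kernel_le[OF r_nonneg] by blast
  define weight where "weight a t
      = norm (contour_point r t) powr a * exp (- (b * norm (contour_point r t)))" for a t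
  show ?thesis
  proof (rule that)
    show "integrable lborel (\<lambda>t. C * (weight (Re s0 - 1 - R) t + weight (Re s0 - 1 + R) t))"
      unfolding weight_def using Re_s0 R_nonneg
      by (intro integrable_mult_right Bochner_Integration.integrable_add integrable_contour_powr_exp
          r_nonneg b_pos) auto
    fix s t assume s_near: "norm (s - s0) \<le> R"
    have "\<bar>Im s\<bar> \<le> \<bar>Im s0\<bar> + R" using s_near abs_Im_le_cmod[of "s - s0"] by simp
    moreover have "norm (contour_point r t) powr (Re s - 1)
        \<le> norm (contour_point r t) powr (Re s0 - 1 - R)
          + norm (contour_point r t) powr (Re s0 - 1 + R)"
      using s_near abs_Re_le_cmod[of "s - s0"] by (intro powr_le_powr_ends) auto
    ultimately have "norm (contour_kernel r s t)
        \<le> C * (norm (contour_point r t) powr (Re s0 - 1 - R)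
            + norm (contour_point r t) powr (Re s0 - 1 + R))"
      using kernel_le by (meson mult_left_mono order_trans)
    hence "norm (contour_kernel r s t) * exp (- (b * norm (contour_point r t)))
        \<le> C * (norm (contour_point r t) powr (Re s0 - 1 - R)
            + norm (contour_point r t) powr (Re s0 - 1 + R))
            * exp (- (b * norm (contour_point r t)))"
      by (rule mult_right_mono) simp
    thus "norm (contour_kernel r s t) * exp (- (b * norm (contour_point r t)))
        \<le> C * (weight (Re s0 - 1 - R) t + weight (Re s0 - 1 + R) t)"
      by (simp add: weight_def algebra_simps)
  qed
qed

subsection \<open>The normalizing factors\<close>

lemma one_minus_nonpos_Ints_iff: "1 - s \<in> \<int>\<^sub>\<le>\<^sub>0 \<longleftrightarrow> s \<in> of_nat ` {1..}" for s :: complex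
proof
  assume "1 - s \<in> \<int>\<^sub>\<le>\<^sub>0"
  then obtain n where "1 - s = - of_nat n" by (rule nonpos_Ints_cases')
  hence "s = of_nat (Suc n)" by (simp, algebra)
  thus "s \<in> of_nat ` {1..}" by (rule image_eqI) simp
next
  assume "s \<in> of_nat ` {1..}"
  then obtain n where "s = of_nat n" "n \<ge> 1" by blast
  hence "1 - s = - of_nat (n - 1)" by (simp add: of_nat_diff)
  thus "1 - s \<in> \<int>\<^sub>\<le>\<^sub>0" by (simp only: minus_of_nat_in_nonpos_Ints)
qed

lemma monodromy_minus_1: "monodromy s - 1 = 2 * \<i> * sin (of_real pi * s) * exp (of_real pi * \<i> * s)"
proof -
  have "monodromy s = exp (of_real pi * \<i> * s) * exp (of_real pi * \<i> * s)"
    by (simp add: algebra_simps flip: exp_add)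
  thus ?thesis by (simp add: sin_exp_eq exp_minus field_simps)
qed

definition reflected_hankel_factor :: "complex \<Rightarrow> complex" where
  "reflected_hankel_factor s = Gamma (1 - s) * exp (- (of_real pi * \<i> * s)) / (2 * of_real pi * \<i>)"

lemma reflected_hankel_factor_mult:
  assumes "s \<notin> of_nat ` {1..}"
  shows "reflected_hankel_factor s * (monodromy s - 1) = rGamma s"
proof -
  have "reflected_hankel_factor s * (monodromy s - 1)
      = Gamma (1 - s) * (sin (of_real pi * s) / of_real pi)"
    unfolding monodromy_minus_1 reflected_hankel_factor_def by (simp add: exp_minus)
  also have "\<dots> = rGamma s * (Gamma (1 - s) * rGamma (1 - s))"
    by (simp flip: rGamma_reflection_complex)
  also have "Gamma (1 - s) * rGamma (1 - s) = 1"
    using assms by (simp add: Gamma_def rGamma_eq_zero_iff one_minus_nonpos_Ints_iff)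
  finally show ?thesis by simp
qed

lemma reflected_hankel_factor_field_differentiable:
  assumes "s \<notin> of_nat ` {1..}"
  shows "reflected_hankel_factor field_differentiable at s"
proof -
  have "open (- of_nat ` {1..} :: complex set)" using closed_of_nat_image open_Compl by blast
  moreover have "reflected_hankel_factor holomorphic_on - of_nat ` {1..}"
    unfolding reflected_hankel_factor_def[abs_def]
    by (intro holomorphic_intros) (auto simp: one_minus_nonpos_Ints_iff)
  ultimately show ?thesis using assms holomorphic_on_imp_differentiable_at by blast
qed

lemma hankel_factor_eq_reflected:
  assumes not_pole: "s \<notin> of_nat ` {1..}"
  shows "hankel_factor s = reflected_hankel_factor s"
  unfolding hankel_factor_def
proof (rule remove_sings_eqI, rule Lim_transform_eventually)
  show "reflected_hankel_factor \<midarrow>s\<rightarrow> reflected_hankel_factor s"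
    using field_differentiable_imp_continuous_at[OF
        reflected_hankel_factor_field_differentiable[OF not_pole]]
    by (rule isContD)
  have "open (- (\<int> - {s}))" by (intro open_Compl closed_subset_Ints) blast
  hence "\<forall>\<^sub>F z in at s. z \<in> - (\<int> - {s})" by (rule eventually_at_in_open') simp
  thus "\<forall>\<^sub>F z in at s. reflected_hankel_factor z = 1 / ((monodromy z - 1) * Gamma z)"
    using eventually_neq_at_within[of s]
  proof eventually_elim
    case (elim z)
    hence "z \<notin> of_nat ` {1..}" "z \<notin> \<int>\<^sub>\<le>\<^sub>0" using nonpos_Ints_subset_Ints by auto
    hence "reflected_hankel_factor z * (monodromy z - 1) * Gamma z = 1"
      by (simp add: reflected_hankel_factor_mult rGamma_inverse_Gamma Gamma_eq_zero_iff)
    thus ?case by (metis eq_divide_imp mult.assoc mult_zero_right zero_neq_one)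
  qed
qed

lemma hankel_factor_mult: "s \<notin> of_nat ` {1..} \<Longrightarrow> hankel_factor s * (monodromy s - 1) = rGamma s"
  by (metis hankel_factor_eq_reflected reflected_hankel_factor_mult)

lemma open_contour_domain: "open (contour_domain r)"
  unfolding contour_domain_def by (auto intro: open_halfspace_Re_gt open_Compl closed_of_nat_image)

lemma contour_factor_field_differentiable:
  assumes s_in: "s \<in> contour_domain r"
  shows "contour_factor r field_differentiable at s"
proof (cases "r = 0")
  case True
  thus ?thesis unfolding contour_factor_def[abs_def] field_differentiable_def
    by (auto intro: has_field_derivative_rGamma)
next
  case False
  hence "(reflected_hankel_factor has_field_derivative deriv reflected_hankel_factor s) (at s)"
    using s_in reflected_hankel_factor_field_differentiable
    by (simp add: contour_domain_def DERIV_deriv_iff_field_differentiable)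
  hence "(contour_factor r has_field_derivative deriv reflected_hankel_factor s) (at s)"
    by (rule has_field_derivative_transform_within_open[OF _ open_contour_domain s_in])
       (use False in \<open>simp add: contour_factor_def contour_domain_def hankel_factor_eq_reflected\<close>)
  thus ?thesis unfolding field_differentiable_def by blast
qed

section \<open>Contour integrals in one variable\<close>

locale keyhole_function =
  fixes g :: "complex \<Rightarrow> complex" and e b M :: real
  assumes e_pos: "e > 0" and b_pos: "b > 0"
    and holomorphic: "g holomorphic_on ball 0 e"
    and continuous: "continuous_on (keyhole e) g"
    and bound: "\<And>x. x \<in> keyhole e \<Longrightarrow> norm (g x) \<le> M * exp (- (b * norm x))"
begin

definition contour_integrand :: "real \<Rightarrow> complex \<Rightarrow> real \<Rightarrow> complex" where
  "contour_integrand r s t = contour_kernel r s t * g (contour_point r t)"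

definition kernel_integral :: "real \<Rightarrow> complex \<Rightarrow> complex" where
  "kernel_integral r s = (\<integral>t. contour_integrand r s t \<partial>lborel)"

definition tail_integral :: "real \<Rightarrow> complex \<Rightarrow> complex" where
  "tail_integral r s = (\<integral>u. indicator {r<..} u *\<^sub>R contour_integrand 0 s u \<partial>lborel)"

lemma M_nonneg: "M \<ge> 0"
proof -
  have "0 \<le> norm (g 0)" by simp
  also have "\<dots> \<le> M * exp (- (b * norm (0::complex)))" by (rule bound[OF zero_in_keyhole])
  finally show ?thesis by simp
qed

lemma measurable_contour_integrand:
  assumes "0 \<le> r" "r < e"
  shows "contour_integrand r s \<in> borel_measurable borel"
proof -
  have "continuous_on UNIV (\<lambda>t. g (contour_point r t))"
    by (rule continuous_on_compose2[OF continuous continuous_contour_point])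
       (use contour_point_in_keyhole assms in auto)
  hence [measurable]: "(\<lambda>t. g (contour_point r t)) \<in> borel_measurable borel"
    by (rule borel_measurable_continuous_onI)
  note [measurable] = measurable_contour_kernel[OF assms(1)]
  show ?thesis unfolding contour_integrand_def[abs_def] by measurable
qed

lemma norm_contour_integrand_le:
  assumes "0 \<le> r" "r < e"
  shows "norm (contour_integrand r s t)
      \<le> M * (norm (contour_kernel r s t) * exp (- (b * norm (contour_point r t))))"
proof -
  have "norm (contour_kernel r s t) * norm (g (contour_point r t))
      \<le> norm (contour_kernel r s t) * (M * exp (- (b * norm (contour_point r t))))"
    by (intro mult_left_mono bound contour_point_in_keyhole assms) auto
  thus ?thesis by (simp add: contour_integrand_def norm_mult mult_ac)
qed

lemma integrable_contour_integrand:
  assumes r_bounds: "0 \<le> r" "r < e" and Re_pos: "r = 0 \<Longrightarrow> Re s > 0"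
  shows "integrable lborel (contour_integrand r s)"
proof -
  obtain k where k_majorant: "integrable lborel k"
    "\<And>s' t. norm (s' - s) \<le> 0
        \<Longrightarrow> norm (contour_kernel r s' t) * exp (- (b * norm (contour_point r t))) \<le> k t"
    using contour_kernel_majorant[of r 0 s b] r_bounds Re_pos b_pos by auto
  show ?thesis
  proof (rule Bochner_Integration.integrable_bound)
    show "integrable lborel (\<lambda>t. M * k t)" using k_majorant(1) by simp
    have "norm (contour_integrand r s t) \<le> M * k t" for t
    proof (rule order_trans[OF norm_contour_integrand_le[OF r_bounds]])
      show "M * (norm (contour_kernel r s t) * exp (- (b * norm (contour_point r t)))) \<le> M * k t"
        using k_majorant(2)[of s t] M_nonneg by (intro mult_left_mono) auto
    qed
    thus "AE t in lborel. norm (contour_integrand r s t) \<le> norm (M * k t)"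
      by (intro AE_I2) (metis abs_ge_self order_trans real_norm_def)
  qed (use measurable_contour_integrand[OF r_bounds] in simp)
qed

lemma integrable_tail:
  assumes r_pos: "r > 0"
  shows "integrable lborel (\<lambda>u. indicator {r<..} u *\<^sub>R contour_integrand 0 s u)"
proof (rule Bochner_Integration.integrable_bound)
  let ?w = "\<lambda>u. M * (indicator {r..} u * (u powr (Re s - 1) * exp (- (b * u))))"
  show "integrable lborel ?w"
    by (intro integrable_mult_right integrable_powr_exp_truncated r_pos b_pos)
  have "norm (contour_integrand 0 s u) \<le> M * (u powr (Re s - 1) * exp (- (b * u)))" if "u > r" for u
    using norm_contour_integrand_le[of 0 s u] r_pos e_pos that
    by (simp add: contour_kernel_def norm_contour_point_0 powr_def)
  thus "AE u in lborel. norm (indicator {r<..} u *\<^sub>R contour_integrand 0 s u) \<le> norm (?w u)"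
    using M_nonneg by (intro AE_I2) (simp add: indicator_def)
qed (use measurable_contour_integrand[OF order.refl e_pos] in simp)

lemma has_integral_tail:
  assumes "r > 0"
  shows "has_bochner_integral lborel (\<lambda>u. indicator {r<..} u *\<^sub>R contour_integrand 0 s u)
           (tail_integral r s)"
  unfolding tail_integral_def using integrable_tail[OF assms] by (rule has_bochner_integral_integrable)

lemma has_integral_upper_arc:
  assumes r_pos: "0 < r"
  shows "has_bochner_integral lborel
           (\<lambda>t. indicator {..<0} t *\<^sub>R contour_integrand r s t) (- tail_integral r s)"
proof -
  from has_integral_tail[OF r_pos] have "has_bochner_integral lborel
      (\<lambda>t. - (indicator {r<..} (r + (-1) * t) *\<^sub>R contour_integrand 0 s (r + (-1) * t)))
      (- tail_integral r s)"
    by (subst (asm) lborel_has_bochner_integral_real_affine_iff[of "-1" _ _ r])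
       (auto intro: has_bochner_integral_minus)
  also have "(\<lambda>t. - (indicator {r<..} (r + (-1) * t) *\<^sub>R contour_integrand 0 s (r + (-1) * t)))
      = (\<lambda>t. indicator {..<0} t *\<^sub>R contour_integrand r s t)"
    using r_pos by (auto simp: fun_eq_iff indicator_def contour_integrand_def contour_upper)
  finally show ?thesis .
qed

lemma has_integral_lower_arc:
  assumes r_pos: "0 < r"
  shows "has_bochner_integral lborel (\<lambda>t. indicator {2 * pi<..} t *\<^sub>R contour_integrand r s t)
           (monodromy s * tail_integral r s)"
proof -
  from has_integral_tail[OF r_pos] have "has_bochner_integral lborel (\<lambda>t. monodromy s *
      (indicator {r<..} ((r - 2 * pi) + 1 * t) *\<^sub>R contour_integrand 0 s ((r - 2 * pi) + 1 * t)))
      (monodromy s * tail_integral r s)"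
    by (intro has_bochner_integral_mult_right)
       (subst (asm) lborel_has_bochner_integral_real_affine_iff[of 1 _ _ "r - 2 * pi"], auto)
  also have "(\<lambda>t. monodromy s
      * (indicator {r<..} ((r - 2 * pi) + 1 * t) *\<^sub>R contour_integrand 0 s ((r - 2 * pi) + 1 * t)))
      = (\<lambda>t. indicator {2 * pi<..} t *\<^sub>R contour_integrand r s t)"
    using r_pos by (auto simp: fun_eq_iff indicator_def contour_integrand_def contour_lower
        add_diff_eq diff_add_eq)
  finally show ?thesis .
qed

definition log_primitive :: "complex \<Rightarrow> (complex \<Rightarrow> complex) \<Rightarrow> bool" where
  "log_primitive s P \<longleftrightarrow>
     (\<forall>z. Re z < ln e \<longrightarrow> (P has_field_derivative exp (s * z) * g (exp z)) (at z))"

abbreviation circle_increment :: "(complex \<Rightarrow> complex) \<Rightarrow> real \<Rightarrow> complex" where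
  "circle_increment P r \<equiv> P (Complex (ln r) (2 * pi)) - P (Complex (ln r) 0)"

lemma log_primitiveD:
  "log_primitive s P \<Longrightarrow> Re z < ln e \<Longrightarrow> (P has_field_derivative exp (s * z) * g (exp z)) (at z)"
  by (simp add: log_primitive_def)

lemma ex_log_primitive:
  obtains P where "log_primitive s P"
proof -
  let ?E = "{z. Re z < ln e}"
  have halfplane: "open ?E" "convex ?E" by (auto intro: open_halfspace_Re_lt convex_halfspace_Re_lt)
  have "exp (Re z) < e" if "Re z < ln e" for z using e_pos that by (metis exp_less_mono exp_ln)
  hence "exp ` ?E \<subseteq> ball 0 e" by auto
  hence "(\<lambda>z. g (exp z)) holomorphic_on ?E"
    using holomorphic_on_compose_gen[OF _ holomorphic, of exp ?E]
    by (auto simp: o_def intro: holomorphic_intros)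
  hence "(\<lambda>z. exp (s * z) * g (exp z)) holomorphic_on ?E"
    by (intro holomorphic_intros)
  then obtain P where primitive:
      "\<And>z. z \<in> ?E \<Longrightarrow> (P has_field_derivative exp (s * z) * g (exp z)) (at z within ?E)"
    using holomorphic_convex_primitive'[OF halfplane(2,1)] by blast
  hence "log_primitive s P"
    using at_within_open[OF _ halfplane(1)] unfolding log_primitive_def by fastforce
  thus ?thesis by (rule that)
qed

context
  fixes s :: complex and P :: "complex \<Rightarrow> complex"
  assumes primitive: "log_primitive s P"
begin

lemma has_integral_circle_arc:
  assumes r_bounds: "0 < r" "r < e"
  shows "has_bochner_integral lborel
    (\<lambda>t. indicator {0..2 * pi} t *\<^sub>R (\<i> * (exp (s * Complex (ln r) t) * g (exp (Complex (ln r) t)))))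
    (circle_increment P r)"
proof (rule has_bochner_integral_FTC_Icc)
  have "(Complex (ln r) has_vector_derivative \<i>) (at t within S)" for t S
    unfolding Complex_eq by (auto intro!: derivative_eq_intros)
  moreover have "Re (Complex (ln r) t) < ln e" for t using r_bounds e_pos by simp
  ultimately show "((\<lambda>t. P (Complex (ln r) t)) has_vector_derivative
      \<i> * (exp (s * Complex (ln r) t) * g (exp (Complex (ln r) t)))) (at t within {0..2 * pi})" for t
    using field_vector_diff_chain_within[OF _
        has_field_derivative_at_within[OF log_primitiveD[OF primitive]]]
    by (simp add: o_def)
  have "exp (Complex (ln r) t) \<in> ball 0 e" for t using r_bounds by simp
  moreover have "continuous_on {0..2 * pi} (Complex (ln r))"
    unfolding Complex_eq by (intro continuous_intros)
  ultimately show "continuous_on {0..2 * pi}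
      (\<lambda>t. \<i> * (exp (s * Complex (ln r) t) * g (exp (Complex (ln r) t))))"
    by (intro continuous_intros
        continuous_on_compose2[OF holomorphic_on_imp_continuous_on[OF holomorphic]]) auto
qed simp

lemma kernel_integral_eq_tail:
  assumes r_bounds: "0 < r" "r < e"
  shows "kernel_integral r s = (monodromy s - 1) * tail_integral r s
    + circle_increment P r"
proof -
  let ?circle = "\<lambda>t. \<i> * (exp (s * Complex (ln r) t) * g (exp (Complex (ln r) t)))"
  let ?arcs =
      "\<lambda>t. indicator {..<0} t *\<^sub>R contour_integrand r s t + indicator {0..2 * pi} t *\<^sub>R ?circle t
      + indicator {2 * pi<..} t *\<^sub>R contour_integrand r s t"
  have arcs: "has_bochner_integral lborel ?arcs (- tail_integral r s
      + circle_increment P r + monodromy s * tail_integral r s)"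
    by (intro has_bochner_integral_add has_integral_upper_arc has_integral_circle_arc
        has_integral_lower_arc r_bounds)
  have "AE t in lborel. t \<noteq> 0 \<and> t \<noteq> 2 * pi"
    using AE_lborel_singleton[of 0] AE_lborel_singleton[of "2 * pi"] by eventually_elim simp
  hence "AE t in lborel. contour_integrand r s t = ?arcs t"
  proof eventually_elim
    case (elim t)
    then consider "t < 0" | "0 < t" "t < 2 * pi" | "2 * pi < t" by linarith
    thus ?case
      using pi_gt_zero
      by cases (use r_bounds in \<open>auto simp: indicator_def contour_integrand_def contour_circle
          simp del: pi_gt_zero\<close>)
  qed
  moreover have "contour_integrand r s \<in> borel_measurable lborel"
    using measurable_contour_integrand r_bounds by simp
  moreover have "?arcs \<in> borel_measurable lborel"
    using arcs by (rule borel_measurable_has_bochner_integral)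
  ultimately have "kernel_integral r s = integral\<^sup>L lborel ?arcs"
    unfolding kernel_integral_def by (intro integral_cong_AE)
  thus ?thesis using has_bochner_integral_integral_eq[OF arcs] by (simp add: algebra_simps)
qed

text \<open>
  The integrand \<open>e\<^bsup>sz\<^esup> g(e\<^sup>z)\<close> is quasi-periodic, hence so is its primitive up to a constant.
\<close>

lemma log_primitive_quasiperiodic:
  "\<exists>D. \<forall>z. Re z < ln e \<longrightarrow> P (z + 2 * of_real pi * \<i>) = monodromy s * P z + D"
proof -
  define \<omega> where "\<omega> = 2 * of_real pi * \<i>"
  have exp_\<omega>: "exp (z + \<omega>) = exp z" for z by (simp add: \<omega>_def exp_add)
  have "((\<lambda>z. P (z + \<omega>) - exp (\<omega> * s) * P z) has_field_derivative 0) (at z)"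
    if Re_z: "Re z < ln e" for z
  proof -
    have "(P has_field_derivative exp (s * (z + \<omega>)) * g (exp (z + \<omega>))) (at (z + \<omega>))"
      using Re_z by (intro log_primitiveD[OF primitive]) (simp add: \<omega>_def)
    hence "((\<lambda>z. P (z + \<omega>)) has_field_derivative exp (s * (z + \<omega>)) * g (exp z)) (at z)"
      by (simp add: DERIV_shift exp_\<omega>)
    from DERIV_diff[OF this DERIV_cmult[OF log_primitiveD[OF primitive Re_z], of "exp (\<omega> * s)"]]
    show ?thesis
      by (simp add: distrib_left exp_add mult_ac)
  qed
  hence "\<exists>D. \<forall>z\<in>{z. Re z < ln e}. P (z + \<omega>) - exp (\<omega> * s) * P z = D"
    by (intro has_field_derivative_zero_constant convex_halfspace_Re_lt)
       (auto intro: has_field_derivative_at_within)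
  thus ?thesis unfolding \<omega>_def by (auto simp: algebra_simps)
qed

lemma has_vector_derivative_log_primitive_ln:
  assumes u_bounds: "0 < u" "u < e"
  shows "((\<lambda>u. P (of_real (ln u))) has_vector_derivative contour_integrand 0 s u) (at u within S)"
proof -
  have "((\<lambda>u. of_real (ln u)) has_vector_derivative complex_of_real (1 / u)) (at u within S)"
    using u_bounds
    by (intro has_vector_derivative_of_real has_field_derivative_at_within[OF DERIV_ln_divide])
  moreover have "(P has_field_derivative exp (s * of_real (ln u)) * g (exp (of_real (ln u))))
      (at (of_real (ln u)))"
    using u_bounds by (intro log_primitiveD[OF primitive]) simp
  ultimately have "(P \<circ> (\<lambda>u. of_real (ln u)) has_vector_derivative
      of_real (1 / u) * (exp (s * of_real (ln u)) * g (exp (of_real (ln u))))) (at u within S)"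
    by (rule field_vector_diff_chain_within[OF _ has_field_derivative_at_within])
  moreover have "of_real (1 / u) * (exp (s * of_real (ln u)) * g (exp (of_real (ln u))))
      = contour_integrand 0 s u"
    using u_bounds by (simp add: contour_integrand_def contour_kernel_def contour_point_def
        left_diff_distrib exp_diff exp_of_real)
  ultimately show ?thesis by (simp add: o_def)
qed

lemma tail_integral_diff:
  assumes r_bounds: "0 < r" "r < r'" "r' < e"
  shows "tail_integral r s - tail_integral r' s = P (of_real (ln r')) - P (of_real (ln r))"
proof -
  note [measurable] = measurable_contour_integrand[OF order.refl e_pos]
  have "tail_integral r s - tail_integral r' s =
      (\<integral>u. indicator {r<..} u *\<^sub>R contour_integrand 0 s u
         - indicator {r'<..} u *\<^sub>R contour_integrand 0 s u \<partial>lborel)"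
    unfolding tail_integral_def
    using r_bounds integrable_tail by (intro Bochner_Integration.integral_diff[symmetric]) auto
  also have "\<dots> = (\<integral>u. indicator {r..r'} u *\<^sub>R contour_integrand 0 s u \<partial>lborel)"
  proof (rule integral_cong_AE)
    show "AE u in lborel. indicator {r<..} u *\<^sub>R contour_integrand 0 s u
        - indicator {r'<..} u *\<^sub>R contour_integrand 0 s u
        = indicator {r..r'} u *\<^sub>R contour_integrand 0 s u"
      using AE_lborel_singleton[of r] by eventually_elim (use r_bounds in \<open>auto simp: indicator_def\<close>)
  qed measurable
  also have "\<dots> = P (of_real (ln r')) - P (of_real (ln r))"
  proof (rule integral_FTC_Icc)
    show "((\<lambda>u. P (of_real (ln u))) has_vector_derivative contour_integrand 0 s u)
            (at u within {r..r'})" if "r \<le> u" "u \<le> r'" for u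
      using has_vector_derivative_log_primitive_ln that r_bounds by simp
  next
    have "continuous_on {r..r'} (\<lambda>u. exp ((s - 1) * of_real (ln u)) * g (of_real u))"
      by (intro continuous_intros
          continuous_on_compose2[OF holomorphic_on_imp_continuous_on[OF holomorphic]])
         (use r_bounds in auto)
    thus "continuous_on {r..r'} (contour_integrand 0 s)"
      by (rule continuous_on_eq)
         (use r_bounds in \<open>auto simp: contour_integrand_def contour_kernel_def contour_point_def\<close>)
  qed (use r_bounds in simp)
  finally show ?thesis .
qed

lemma kernel_integral_radius:
  assumes r_bounds: "0 < r" "r < r'" "r' < e"
  shows "kernel_integral r s = kernel_integral r' s"
proof -
  obtain D where "\<And>z. Re z < ln e \<Longrightarrow> P (z + 2 * of_real pi * \<i>) = monodromy s * P z + D"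
    using log_primitive_quasiperiodic by blast
  hence "P (Complex (ln \<rho>) (2 * pi)) = monodromy s * P (of_real (ln \<rho>)) + D"
    if "0 < \<rho>" "\<rho> < e" for \<rho>
    using that e_pos by (simp add: Complex_eq mult_ac)
  hence "kernel_integral \<rho> s = (monodromy s - 1) * (tail_integral \<rho> s + P (of_real (ln \<rho>))) + D"
    if "0 < \<rho>" "\<rho> < e" for \<rho>
    using kernel_integral_eq_tail[of \<rho>] that by (simp add: Complex_eq algebra_simps)
  moreover have "tail_integral r s + P (of_real (ln r)) = tail_integral r' s + P (of_real (ln r'))"
    using tail_integral_diff[OF r_bounds] by (simp add: algebra_simps)
  ultimately show ?thesis using r_bounds by simp
qed

lemma norm_circle_arc_le:
  assumes r_bounds: "0 < r" "r < e"
  shows "norm (circle_increment P r)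
    \<le> r powr Re s * (exp (\<bar>Im s\<bar> * (2 * pi)) * M * (2 * pi))"
proof -
  let ?B = "r powr Re s * exp (\<bar>Im s\<bar> * (2 * pi)) * M"
  let ?S = "closed_segment (Complex (ln r) 0) (Complex (ln r) (2 * pi))"
  have "norm (circle_increment P r)
      \<le> ?B * norm (Complex (ln r) (2 * pi) - Complex (ln r) 0)"
  proof (rule field_differentiable_bound[of ?S])
    fix z assume "z \<in> ?S"
    then obtain u
        where "0 \<le> u" "u \<le> 1" "z = (1 - u) *\<^sub>R Complex (ln r) 0 + u *\<^sub>R Complex (ln r) (2 * pi)"
      by (auto simp: closed_segment_def)
    hence z_parts: "Re z = ln r" "0 \<le> Im z" "Im z \<le> 2 * pi" by (auto simp: left_diff_distrib)
    show "(P has_field_derivative exp (s * z) * g (exp z)) (at z within ?S)"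
      by (rule has_field_derivative_at_within, rule log_primitiveD[OF primitive])
         (use r_bounds z_parts in simp)
    have "norm (g (exp z)) \<le> M * exp (- (b * norm (exp z)))"
      by (rule bound) (use r_bounds z_parts in \<open>auto simp: keyhole_def\<close>)
    also have "\<dots> \<le> M" using M_nonneg b_pos by (intro mult_left_le) auto
    finally have "norm (g (exp z)) \<le> M" .
    moreover have "- (Im s * Im z) \<le> \<bar>Im s\<bar> * (2 * pi)"
    proof -
      have "- (Im s * Im z) \<le> \<bar>Im s\<bar> * \<bar>Im z\<bar>" by (metis abs_ge_minus_self abs_mult)
      also have "\<dots> \<le> \<bar>Im s\<bar> * (2 * pi)" using z_parts by (intro mult_left_mono) auto
      finally show ?thesis .
    qed
    hence "norm (exp (s * z)) \<le> r powr Re s * exp (\<bar>Im s\<bar> * (2 * pi))"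
      using r_bounds by (simp add: z_parts powr_def flip: exp_add)
    ultimately show "norm (exp (s * z) * g (exp z)) \<le> ?B"
      unfolding norm_mult by (intro mult_mono) auto
  qed auto
  thus ?thesis by (simp add: complex_diff complex_norm real_sqrt_mult mult_ac)
qed

end

lemma tail_integral_tendsto:
  assumes Re_pos: "Re s > 0" and R_seq: "R \<longlonglongrightarrow> 0" "\<And>n. R n > 0"
  shows "(\<lambda>n. tail_integral (R n) s) \<longlonglongrightarrow> kernel_integral 0 s"
  unfolding tail_integral_def kernel_integral_def
proof (rule integral_dominated_convergence[where w = "\<lambda>u. norm (contour_integrand 0 s u)"])
  show "integrable lborel (\<lambda>u. norm (contour_integrand 0 s u))"
    using integrable_contour_integrand[of 0 s] e_pos Re_pos by (intro integrable_norm) auto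
  show "AE u in lborel. (\<lambda>n. indicator {R n<..} u *\<^sub>R contour_integrand 0 s u)
      \<longlonglongrightarrow> contour_integrand 0 s u"
  proof (intro AE_I2)
    fix u
    show "(\<lambda>n. indicator {R n<..} u *\<^sub>R contour_integrand 0 s u) \<longlonglongrightarrow> contour_integrand 0 s u"
    proof (cases "u > 0")
      case True
      have "\<forall>\<^sub>F n in sequentially. R n < u" using order_tendstoD(2)[OF R_seq(1) True] .
      hence "\<forall>\<^sub>F n in sequentially. indicator {R n<..} u *\<^sub>R contour_integrand 0 s u
          = contour_integrand 0 s u"
        by eventually_elim simp
      thus ?thesis by (rule tendsto_eventually)
    qed (simp add: contour_integrand_def contour_kernel_def)
  qed
  show "AE u in lborel. norm (indicator {R n<..} u *\<^sub>R contour_integrand 0 s u)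
      \<le> norm (contour_integrand 0 s u)" for n
    by (intro AE_I2) (auto simp: indicator_def)
qed (use measurable_contour_integrand[OF order.refl e_pos] in simp_all)

lemma kernel_integral_eq_ray:
  assumes r_bounds: "0 < r" "r < e" and Re_pos: "Re s > 0"
  shows "kernel_integral r s = (monodromy s - 1) * kernel_integral 0 s"
proof -
  obtain P where primitive: "log_primitive s P" by (rule ex_log_primitive)
  define R where "R n = r / real (n + 2)" for n
  have R_bounds: "0 < R n" "R n < r" for n
    using r_bounds by (auto simp: R_def field_simps intro: add_pos_nonneg)
  have R_lim: "R \<longlonglongrightarrow> 0"
    unfolding R_def using LIMSEQ_ignore_initial_segment[OF lim_const_over_n[of r], of 2] by simp
  have "(\<lambda>n. circle_increment P (R n)) \<longlonglongrightarrow> 0"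
  proof (rule Lim_null_comparison)
    let ?C = "exp (\<bar>Im s\<bar> * (2 * pi)) * M * (2 * pi)"
    show "\<forall>\<^sub>F n in sequentially. norm (circle_increment P (R n))
        \<le> R n powr Re s * ?C"
      by (intro always_eventually allI norm_circle_arc_le primitive)
         (use R_bounds r_bounds less_trans in blast)+
    have "(\<lambda>n. R n powr Re s * ?C) \<longlonglongrightarrow> 0 powr Re s * ?C"
      by (intro tendsto_mult tendsto_const tendsto_powr2 R_lim)
         (use Re_pos R_bounds in \<open>auto intro: always_eventually less_imp_le\<close>)
    thus "(\<lambda>n. R n powr Re s * ?C) \<longlonglongrightarrow> 0" by simp
  qed
  hence "(\<lambda>n. (monodromy s - 1) * tail_integral (R n) s
        + circle_increment P (R n))
      \<longlonglongrightarrow> (monodromy s - 1) * kernel_integral 0 s + 0"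
    by (intro tendsto_add tendsto_mult tendsto_const tail_integral_tendsto Re_pos R_lim R_bounds)
  moreover have "kernel_integral r s = (monodromy s - 1) * tail_integral (R n) s
        + circle_increment P (R n)" for n
    using kernel_integral_radius[OF primitive R_bounds r_bounds(2)]
        kernel_integral_eq_tail[OF primitive R_bounds(1) less_trans[OF R_bounds(2) r_bounds(2)]]
    by simp
  ultimately show ?thesis by (simp add: LIMSEQ_const_iff)
qed

theorem normalized_kernel_integral_independent:
  assumes r_bounds: "0 \<le> r" "r < e" "s \<in> contour_domain r"
    and r'_bounds: "0 \<le> r'" "r' < e" "s \<in> contour_domain r'"
  shows "contour_factor r s * kernel_integral r s = contour_factor r' s * kernel_integral r' s"
proof -
  obtain P where primitive: "log_primitive s P" by (rule ex_log_primitive)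
  have to_ray: "contour_factor \<rho> s * kernel_integral \<rho> s = rGamma s * kernel_integral 0 s"
    if "0 < \<rho>" "\<rho> < e" "s \<in> contour_domain \<rho>" "Re s > 0" for \<rho>
    using that kernel_integral_eq_ray[of \<rho> s] hankel_factor_mult[of s]
    by (simp add: contour_factor_def contour_domain_def flip: mult.assoc)
  consider "r = r'" | "r = 0" "r' > 0" | "r > 0" "r' = 0" | "0 < r" "r < r'" | "0 < r'" "r' < r"
    using r_bounds(1) r'_bounds(1) by linarith
  thus ?thesis
    by cases (use r_bounds r'_bounds to_ray[of r] to_ray[of r']
        kernel_integral_radius[OF primitive, of r r'] kernel_integral_radius[OF primitive, of r' r]
        in \<open>auto simp: contour_factor_def contour_domain_def\<close>)
qed

end

section \<open>Integrals over products of contours\<close>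

abbreviation lborel_fun :: "('d::finite \<Rightarrow> real) measure" where
  "lborel_fun \<equiv> \<Pi>\<^sub>M j\<in>UNIV. lborel"

lemma measurable_vec_lambda:
  "(\<lambda>\<omega>. \<chi> j. \<omega> j) \<in> borel_measurable lborel_fun"
proof (subst borel_measurable_euclidean_space, intro ballI)
  fix i :: "real^'d" assume "i \<in> Basis"
  then obtain l where "i = axis l 1" by (auto simp: Basis_vec_def)
  thus "(\<lambda>\<omega>. (\<chi> j. \<omega> j) \<bullet> i) \<in> borel_measurable lborel_fun"
    by (simp add: inner_axis)
qed

lemma prod_Basis_vec: "(\<Prod>b\<in>Basis. (x::real^'d) \<bullet> b) = (\<Prod>j\<in>UNIV. x $ j)"
proof -
  have Basis: "Basis = (\<lambda>j. axis j (1::real)) ` (UNIV :: 'd set)" by (auto simp: Basis_vec_def)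
  show ?thesis unfolding Basis by (subst prod.reindex) (auto simp: inj_on_def axis_eq_axis inner_axis)
qed

lemma lborel_vec_eq:
  "(lborel :: (real^'d) measure) = distr lborel_fun borel (\<lambda>\<omega>. \<chi> j. \<omega> j)"
proof (rule lborel_eqI)
  interpret product_sigma_finite "\<lambda>_::'d. lborel :: real measure" by standard
  fix l u :: "real^'d" assume box: "\<And>b. b \<in> Basis \<Longrightarrow> l \<bullet> b \<le> u \<bullet> b"
  have lower_le_upper: "l $ j \<le> u $ j" for j
    using box[of "axis j 1"] by (simp add: inner_axis axis_in_Basis_iff)
  have "emeasure (distr lborel_fun borel (\<lambda>\<omega>. \<chi> j. \<omega> j)) (box l u)
      = emeasure lborel_fun ((\<lambda>\<omega>. \<chi> j. \<omega> j) -` box l u \<inter> space lborel_fun)"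
    by (rule emeasure_distr[OF measurable_vec_lambda]) simp
  also have "(\<lambda>\<omega>. \<chi> j. \<omega> j) -` box l u \<inter> space lborel_fun = (\<Pi>\<^sub>E j\<in>UNIV. box (l $ j) (u $ j))"
    by (auto simp: space_PiM mem_box_cart PiE_def Pi_iff)
  also have "emeasure lborel_fun \<dots> = (\<Prod>j\<in>UNIV. emeasure lborel (box (l $ j) (u $ j)))"
    by (rule emeasure_PiM) auto
  also have "\<dots> = (\<Prod>j\<in>UNIV. ennreal (u $ j - l $ j))"
    using lower_le_upper by (intro prod.cong) auto
  also have "\<dots> = ennreal (\<Prod>b\<in>Basis. (u - l) \<bullet> b)"
    using lower_le_upper by (subst prod_ennreal) (auto simp: prod_Basis_vec)
  finally show "emeasure (distr lborel_fun borel (\<lambda>\<omega>. \<chi> j. \<omega> j)) (box l u) = (\<Prod>b\<in>Basis. (u - l) \<bullet> b)" .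
qed simp

lemma
  fixes f :: "real^'d \<Rightarrow> complex"
  assumes "f \<in> borel_measurable borel"
  shows integral_lborel_vec: "(\<integral>t. f t \<partial>lborel) = (\<integral>\<omega>. f (\<chi> j. \<omega> j) \<partial>lborel_fun)"
    and integrable_lborel_vec: "integrable lborel f \<longleftrightarrow> integrable lborel_fun (\<lambda>\<omega>. f (\<chi> j. \<omega> j))"
  unfolding lborel_vec_eq
  using integral_distr[OF measurable_vec_lambda assms]
      integrable_distr_eq[OF measurable_vec_lambda assms]
  by auto

definition vec_upd :: "'a^'d \<Rightarrow> 'd \<Rightarrow> 'a \<Rightarrow> 'a^'d" where
  "vec_upd x i z = (\<chi> j. if j = i then z else x $ j)"

lemma vec_upd_nth: "vec_upd x i z $ j = (if j = i then z else x $ j)"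
  by (simp add: vec_upd_def)

lemma continuous_vec_upd: "continuous_on S (vec_upd x i)"
  unfolding vec_upd_def[abs_def]
proof (rule continuous_on_vec_lambda)
  show "continuous_on S (\<lambda>z. if j = i then z else x $ j)" for j by (cases "j = i") auto
qed

abbreviation polykeyhole_set :: "real \<Rightarrow> (complex^'d) set" where
  "polykeyhole_set e \<equiv> {x. \<forall>j. x $ j \<in> keyhole e}"

locale polykeyhole =
  fixes e b :: real
  assumes e_pos: "e > 0" and b_pos: "b > 0"
begin

abbreviation domain :: "(complex^'d) set" where
  "domain \<equiv> polykeyhole_set e"

definition dominated :: "real \<Rightarrow> (complex^'d \<Rightarrow> complex) \<Rightarrow> bool" where
  "dominated M F \<longleftrightarrow> continuous_on domain F \<and>
     (\<forall>x\<in>domain. norm (F x) \<le> M * (\<Prod>j\<in>UNIV. exp (- (b * norm (x $ j)))))"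

definition point :: "('d \<Rightarrow> real) \<Rightarrow> ('d \<Rightarrow> real) \<Rightarrow> complex^'d" where
  "point r t = (\<chi> j. contour_point (r j) (t j))"

definition integrand ::
  "(complex^'d \<Rightarrow> complex) \<Rightarrow> ('d \<Rightarrow> real) \<Rightarrow> complex^'d \<Rightarrow> ('d \<Rightarrow> real) \<Rightarrow> complex" where
  "integrand F r s t = (\<Prod>j\<in>UNIV. contour_kernel (r j) (s $ j) (t j)) * F (point r t)"

definition contour_value :: "(complex^'d \<Rightarrow> complex) \<Rightarrow> ('d \<Rightarrow> real) \<Rightarrow> complex^'d \<Rightarrow> complex" where
  "contour_value F r s = (\<Prod>j\<in>UNIV. contour_factor (r j) (s $ j)) * (\<integral>t. integrand F r s t \<partial>lborel_fun)"

definition radii :: "('d \<Rightarrow> real) \<Rightarrow> bool" where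
  "radii r \<longleftrightarrow> (\<forall>j. 0 \<le> r j \<and> r j < e)"

definition admissible :: "('d \<Rightarrow> real) \<Rightarrow> complex^'d \<Rightarrow> bool" where
  "admissible r s \<longleftrightarrow> radii r \<and> (\<forall>j. s $ j \<in> contour_domain (r j))"

lemma dominated_nonneg:
  fixes F :: "complex^'d \<Rightarrow> complex"
  assumes "dominated M F"
  shows "M \<ge> 0"
proof -
  have "0 \<in> domain" using zero_in_keyhole by simp
  hence "norm (F 0) \<le> M * (\<Prod>j::'d\<in>UNIV. exp (- (b * norm ((0::complex^'d) $ j))))"
    using assms unfolding dominated_def by (blast dest: bspec)
  hence "norm (F 0) \<le> M" by simp
  thus ?thesis by (rule order_trans[OF norm_ge_zero])
qed

lemma point_in_domain: "radii r \<Longrightarrow> point r t \<in> domain"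
  using contour_point_in_keyhole by (auto simp: point_def radii_def)

lemma Re_pos_if_admissible: "admissible r s \<Longrightarrow> r j = 0 \<Longrightarrow> Re (s $ j) > 0"
  by (auto simp: admissible_def contour_domain_def dest: spec[of _ j])

lemma open_admissible:
  fixes r :: "'d::finite \<Rightarrow> real"
  shows "open {s. admissible r s}"
proof (cases "radii r")
  case True
  have "open {s::complex^'d. s $ j \<in> contour_domain (r j)}" for j
    by (rule open_vimage_vec_nth[unfolded vimage_def, OF open_contour_domain])
  hence "open (\<Inter>j. {s::complex^'d. s $ j \<in> contour_domain (r j)})" by (intro open_INT) auto
  also have "(\<Inter>j. {s. s $ j \<in> contour_domain (r j)}) = {s. admissible r s}"
    using True by (auto simp: admissible_def)
  finally show ?thesis .
qed (simp add: admissible_def)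

lemma measurable_integrand:
  fixes F :: "complex^'d \<Rightarrow> complex"
  assumes continuous_F: "continuous_on domain F" and r_radii: "radii r"
  shows "integrand F r s \<in> borel_measurable lborel_fun"
proof -
  have "continuous_on UNIV (\<lambda>t::real^'d. \<chi> j. contour_point (r j) (t $ j))"
    by (intro continuous_on_vec_lambda continuous_on_compose2[OF continuous_contour_point]
        continuous_intros) auto
  hence "continuous_on UNIV (\<lambda>t::real^'d. F (\<chi> j. contour_point (r j) (t $ j)))"
    by (rule continuous_on_compose2[OF continuous_F])
       (use r_radii contour_point_in_keyhole in \<open>auto simp: radii_def\<close>)
  hence "(\<lambda>t::real^'d. F (\<chi> j. contour_point (r j) (t $ j))) \<in> borel_measurable borel"
    by (rule borel_measurable_continuous_onI)
  from measurable_compose[OF measurable_vec_lambda this]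
  have "(\<lambda>t. F (point r t)) \<in> borel_measurable lborel_fun"
    by (simp add: point_def)
  moreover have "(\<lambda>t. contour_kernel (r j) (s $ j) (t j)) \<in> borel_measurable lborel_fun" for j
  proof -
    have "(\<lambda>t. t j) \<in> borel_measurable lborel_fun" by measurable
    from measurable_compose[OF this measurable_contour_kernel] r_radii show ?thesis
      by (auto simp: radii_def)
  qed
  ultimately show ?thesis
    unfolding integrand_def[abs_def] by (intro borel_measurable_times borel_measurable_prod) auto
qed

lemma integrand_majorant:
  fixes r :: "'d::finite \<Rightarrow> real" and s0 :: "complex^'d"
  assumes r_radii: "radii r" and R_nonneg: "R \<ge> 0" and Re_s0: "\<And>j. r j = 0 \<Longrightarrow> Re (s0 $ j) > R"
  obtains K where "integrable lborel_fun K"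
    "\<And>M F s t. dominated M F \<Longrightarrow> (\<And>j. norm (s $ j - s0 $ j) \<le> R) \<Longrightarrow> norm (integrand F r s t) \<le> M * K t"
proof -
  interpret product_sigma_finite "\<lambda>_::'d. lborel :: real measure" by standard
  let ?decay = "\<lambda>j t. exp (- (b * norm (contour_point (r j) t)))"
  have "\<exists>k. integrable lborel k \<and>
      (\<forall>s t. norm (s - s0 $ j) \<le> R \<longrightarrow> norm (contour_kernel (r j) s t) * ?decay j t \<le> k t)" for j
    using contour_kernel_majorant[of "r j" R "s0 $ j" b] r_radii R_nonneg Re_s0[of j] b_pos
    unfolding radii_def by metis
  then obtain k where k_majorant: "\<And>j. integrable lborel (k j)"
      "\<And>j s t. norm (s - s0 $ j) \<le> R \<Longrightarrow> norm (contour_kernel (r j) s t) * ?decay j t \<le> k j t"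
    by metis
  show ?thesis
  proof (rule that[of "\<lambda>t. \<Prod>j\<in>UNIV. k j (t j)"])
    show "integrable lborel_fun (\<lambda>t. \<Prod>j\<in>UNIV. k j (t j))"
      by (intro product_integrable_prod k_majorant) auto
    fix M and F :: "complex^'d \<Rightarrow> complex" and s :: "complex^'d" and t :: "'d \<Rightarrow> real"
    assume F_dominated: "dominated M F" and s_near: "\<And>j. norm (s $ j - s0 $ j) \<le> R"
    have "norm (integrand F r s t) \<le> (\<Prod>j\<in>UNIV. norm (contour_kernel (r j) (s $ j) (t j))) *
        (M * (\<Prod>j\<in>UNIV. exp (- (b * norm (point r t $ j)))))"
      unfolding integrand_def norm_mult prod_norm
      using F_dominated point_in_domain[OF r_radii, of t] unfolding dominated_def
      by (intro mult_left_mono) auto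
    also have "\<dots> = M * (\<Prod>j\<in>UNIV. norm (contour_kernel (r j) (s $ j) (t j)) * ?decay j (t j))"
      by (simp add: prod.distrib point_def mult_ac)
    also have "\<dots> \<le> M * (\<Prod>j\<in>UNIV. k j (t j))"
      by (intro mult_left_mono prod_mono dominated_nonneg[OF F_dominated] conjI k_majorant s_near) auto
    finally show "norm (integrand F r s t) \<le> M * (\<Prod>j\<in>UNIV. k j (t j))" .
  qed
qed

lemma integrand_majorant_at:
  fixes r :: "'d::finite \<Rightarrow> real" and s :: "complex^'d"
  assumes r_radii: "radii r" and Re_pos: "\<And>j. r j = 0 \<Longrightarrow> Re (s $ j) > 0"
  obtains K where "integrable lborel_fun K"
    "\<And>M F t. dominated M F \<Longrightarrow> norm (integrand F r s t) \<le> M * K t"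
  by (rule integrand_majorant[OF r_radii order.refl Re_pos]) (auto intro: that)

lemma integrable_integrand:
  fixes F :: "complex^'d \<Rightarrow> complex"
  assumes F_dominated: "dominated M F" and r_radii: "radii r"
    and Re_pos: "\<And>j. r j = 0 \<Longrightarrow> Re (s $ j) > 0"
  shows "integrable lborel_fun (integrand F r s)"
proof -
  obtain K where K_majorant: "integrable lborel_fun K"
    "\<And>M F t. dominated M F \<Longrightarrow> norm (integrand F r s t) \<le> M * K t"
    using integrand_majorant_at[OF r_radii Re_pos] by blast
  show ?thesis
  proof (rule Bochner_Integration.integrable_bound)
    show "integrable lborel_fun (\<lambda>t. M * K t)" using K_majorant(1) by simp
    show "integrand F r s \<in> borel_measurable lborel_fun"
      using F_dominated r_radii by (intro measurable_integrand) (auto simp: dominated_def)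
    show "AE t in lborel_fun. norm (integrand F r s t) \<le> norm (M * K t)"
      using K_majorant(2)[OF F_dominated] by (intro AE_I2) (auto intro: order_trans[OF _ abs_ge_self])
  qed
qed

lemma tendsto_integral_integrand:
  fixes F :: "'p::first_countable_topology \<Rightarrow> complex^'d \<Rightarrow> complex"
  assumes eventually_dominated: "\<forall>\<^sub>F c in at a. dominated M (F c)"
    and limit_dominated: "dominated M F1"
    and pointwise_limit: "\<And>x. x \<in> domain \<Longrightarrow> ((\<lambda>c. F c x) \<longlongrightarrow> F1 x) (at a)"
    and r_radii: "radii r" "\<And>j. r j = 0 \<Longrightarrow> Re (s $ j) > 0"
  shows "((\<lambda>c. \<integral>t. integrand (F c) r s t \<partial>lborel_fun) \<longlongrightarrow>
           (\<integral>t. integrand F1 r s t \<partial>lborel_fun)) (at a)"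
  unfolding tendsto_at_iff_sequentially
proof (intro allI impI)
  fix X :: "nat \<Rightarrow> 'p" assume "\<forall>i. X i \<in> UNIV - {a}" "X \<longlonglongrightarrow> a"
  hence X_tendsto: "filterlim X (at a) sequentially" by (auto simp: filterlim_at)
  obtain K where K_majorant: "integrable lborel_fun K"
    "\<And>M F t. dominated M F \<Longrightarrow> norm (integrand F r s t) \<le> M * K t"
    using integrand_majorant_at[OF r_radii] by blast
  have "\<forall>\<^sub>F n in sequentially. dominated M (F (X n))"
    using eventually_dominated X_tendsto by (rule eventually_compose_filterlim)
  then obtain N where X_dominated: "\<And>n. dominated M (F (X (n + N)))"
    unfolding eventually_sequentially by (metis le_add2)
  have "(\<lambda>n. \<integral>t. integrand (F (X n)) r s t \<partial>lborel_fun) \<longlonglongrightarrow>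
           (\<integral>t. integrand F1 r s t \<partial>lborel_fun)"
  proof (rule LIMSEQ_offset[of _ N], rule integral_dominated_convergence)
    show "integrable lborel_fun (\<lambda>t. M * K t)" using K_majorant(1) by simp
    show "integrand F1 r s \<in> borel_measurable lborel_fun"
      using limit_dominated r_radii(1) by (intro measurable_integrand) (auto simp: dominated_def)
    show "integrand (F (X (n + N))) r s \<in> borel_measurable lborel_fun" for n
      using X_dominated[of n] r_radii(1) by (intro measurable_integrand) (auto simp: dominated_def)
    show "AE t in lborel_fun. norm (integrand (F (X (n + N))) r s t) \<le> M * K t" for n
      by (intro AE_I2 K_majorant(2) X_dominated)
    have "(\<lambda>n. F (X n) (point r t)) \<longlonglongrightarrow> F1 (point r t)" for t
      using pointwise_limit[OF point_in_domain[OF r_radii(1)]] X_tendsto by (rule filterlim_compose)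
    hence "(\<lambda>n. integrand (F (X n)) r s t) \<longlonglongrightarrow> integrand F1 r s t" for t
      unfolding integrand_def by (intro tendsto_intros)
    hence "(\<lambda>n. integrand (F (X (n + N))) r s t) \<longlonglongrightarrow> integrand F1 r s t" for t
      by (rule LIMSEQ_ignore_initial_segment)
    thus "AE t in lborel_fun. (\<lambda>n. integrand (F (X (n + N))) r s t) \<longlonglongrightarrow> integrand F1 r s t" by simp
  qed
  thus "((\<lambda>c. \<integral>t. integrand (F c) r s t \<partial>lborel_fun) \<circ> X) \<longlonglongrightarrow>
           (\<integral>t. integrand F1 r s t \<partial>lborel_fun)"
    by (simp add: o_def)
qed

lemma integral_integrand_split:
  fixes F :: "complex^'d \<Rightarrow> complex"
  assumes "integrable lborel_fun (integrand F r s)"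
  shows "(\<integral>t. integrand F r s t \<partial>lborel_fun) =
    (\<integral>x. (\<Prod>j\<in>UNIV-{i}. contour_kernel (r j) (s $ j) (x j)) *
      (\<integral>y. contour_kernel (r i) (s $ i) y
         * F (vec_upd (point r x) i (contour_point (r i) y)) \<partial>lborel)
      \<partial>(\<Pi>\<^sub>M j\<in>UNIV-{i}. lborel))"
proof -
  interpret product_sigma_finite "\<lambda>_::'d. lborel :: real measure" by standard
  have split: "integrand F r s (x(i := y)) = (\<Prod>j\<in>UNIV-{i}. contour_kernel (r j) (s $ j) (x j)) *
      (contour_kernel (r i) (s $ i) y * F (vec_upd (point r x) i (contour_point (r i) y)))" for x y
  proof -
    have "(\<Prod>j\<in>UNIV. contour_kernel (r j) (s $ j) ((x(i := y)) j)) =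
        contour_kernel (r i) (s $ i) y * (\<Prod>j\<in>UNIV-{i}. contour_kernel (r j) (s $ j) (x j))"
      by (subst prod.remove[of _ i]) (auto intro: prod.cong)
    moreover have "point r (x(i := y)) = vec_upd (point r x) i (contour_point (r i) y)"
      by (simp add: point_def vec_eq_iff vec_upd_nth)
    ultimately show ?thesis by (simp add: integrand_def mult_ac)
  qed
  have "(\<integral>t. integrand F r s t \<partial>(\<Pi>\<^sub>M j\<in>insert i (UNIV-{i}). lborel)) =
      (\<integral>x. (\<integral>y. integrand F r s (x(i := y)) \<partial>lborel) \<partial>(\<Pi>\<^sub>M j\<in>UNIV-{i}. lborel))"
    by (rule product_integral_insert) (use assms in \<open>auto simp: insert_UNIV\<close>)
  thus ?thesis by (simp add: split insert_UNIV)
qed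

end

locale polykeyhole_function = polykeyhole +
  fixes F :: "complex^'d \<Rightarrow> complex" and M :: real
  assumes dominated: "dominated M F"
    and holomorphic_slice: "\<And>x j. x \<in> domain \<Longrightarrow> (\<lambda>z. F (vec_upd x j z)) holomorphic_on ball 0 e"
begin

lemma keyhole_function_slice:
  assumes x_in: "x \<in> domain"
  shows "keyhole_function (\<lambda>z. F (vec_upd x j z)) e b M"
proof
  have upd: "vec_upd x j z \<in> domain" if "z \<in> keyhole e" for z
    using x_in that by (simp add: vec_upd_nth)
  show "continuous_on (keyhole e) (\<lambda>z. F (vec_upd x j z))"
    by (rule continuous_on_compose2[OF _ continuous_vec_upd])
       (use dominated upd in \<open>auto simp: dominated_def\<close>)
  fix z assume z_in: "z \<in> keyhole e"
  have "norm (F (vec_upd x j z)) \<le> M * (\<Prod>l\<in>UNIV. exp (- (b * norm (vec_upd x j z $ l))))"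
    using dominated upd[OF z_in] unfolding dominated_def by blast
  also have "(\<Prod>l\<in>UNIV. exp (- (b * norm (vec_upd x j z $ l)))) =
      exp (- (b * norm z)) * (\<Prod>l\<in>UNIV-{j}. exp (- (b * norm (vec_upd x j z $ l))))"
    by (subst prod.remove[of _ j]) (auto simp: vec_upd_nth)
  also have "M * \<dots> \<le> M * (exp (- (b * norm z)) * 1)"
    using dominated_nonneg[OF dominated] b_pos by (intro mult_left_mono prod_le_1) auto
  finally show "norm (F (vec_upd x j z)) \<le> M * exp (- (b * norm z))" by simp
qed (use e_pos b_pos holomorphic_slice[OF x_in] in auto)

definition slice_integral :: "complex^'d \<Rightarrow> 'd \<Rightarrow> real \<Rightarrow> complex \<Rightarrow> complex" where
  "slice_integral x i \<rho> \<sigma> = (\<integral>y. contour_kernel \<rho> \<sigma> y * F (vec_upd x i (contour_point \<rho> y)) \<partial>lborel)"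

lemma normalized_slice_integral_independent:
  assumes "x \<in> domain"
    and "0 \<le> \<rho>" "\<rho> < e" "\<sigma> \<in> contour_domain \<rho>" and "0 \<le> \<rho>'" "\<rho>' < e" "\<sigma> \<in> contour_domain \<rho>'"
  shows "contour_factor \<rho> \<sigma> * slice_integral x i \<rho> \<sigma> = contour_factor \<rho>' \<sigma> * slice_integral x i \<rho>' \<sigma>"
proof -
  interpret slice: keyhole_function "\<lambda>z. F (vec_upd x i z)" e b M
    by (rule keyhole_function_slice[OF assms(1)])
  show ?thesis
    using slice.normalized_kernel_integral_independent[OF assms(2-)]
    by (simp add: slice_integral_def slice.kernel_integral_def slice.contour_integrand_def)
qed

lemma contour_value_slice:
  assumes r_admissible: "admissible r s"
  shows "contour_value F r s =
    (\<integral>x. (\<Prod>j\<in>UNIV-{i}. contour_factor (r j) (s $ j) * contour_kernel (r j) (s $ j) (x j)) *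
      (contour_factor (r i) (s $ i) * slice_integral (point r x) i (r i) (s $ i))
      \<partial>(\<Pi>\<^sub>M j\<in>UNIV-{i}. lborel))"
proof -
  have "radii r" using r_admissible by (simp add: admissible_def)
  note split = integral_integrand_split
    [OF integrable_integrand[OF dominated this Re_pos_if_admissible[OF r_admissible]], of i]
  have "(\<Prod>j\<in>UNIV. contour_factor (r j) (s $ j)) =
      contour_factor (r i) (s $ i) * (\<Prod>j\<in>UNIV-{i}. contour_factor (r j) (s $ j))"
    by (rule prod.remove) auto
  thus ?thesis
    unfolding contour_value_def slice_integral_def using split
    by (simp add: prod.distrib mult_ac flip: Bochner_Integration.integral_mult_right_zero)
qed

lemma contour_value_update:
  assumes r_admissible: "admissible r s" and upd_admissible: "admissible (r(i := \<rho>)) s"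
  shows "contour_value F (r(i := \<rho>)) s = contour_value F r s"
proof -
  have same_slice: "slice_integral (point (r(i := \<rho>)) x) i = slice_integral (point r x) i" for x
    by (simp add: fun_eq_iff slice_integral_def vec_upd_def point_def if_distrib cong: if_cong)
  have "\<forall>j. 0 \<le> (r(i := \<rho>)) j \<and> (r(i := \<rho>)) j < e \<and> s $ j \<in> contour_domain ((r(i := \<rho>)) j)"
    using upd_admissible unfolding admissible_def radii_def by blast
  hence "0 \<le> \<rho>" "\<rho> < e" "s $ i \<in> contour_domain \<rho>" by (auto dest: spec[of _ i])
  hence same_value: "contour_factor \<rho> (s $ i) * slice_integral (point r x) i \<rho> (s $ i)
      = contour_factor (r i) (s $ i) * slice_integral (point r x) i (r i) (s $ i)" for x
    using r_admissible
    by (intro normalized_slice_integral_independent point_in_domain)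
       (auto simp: admissible_def radii_def)
  have "(\<Prod>j\<in>UNIV-{i}. contour_factor ((r(i := \<rho>)) j) (s $ j)
      * contour_kernel ((r(i := \<rho>)) j) (s $ j) (x j)) =
      (\<Prod>j\<in>UNIV-{i}. contour_factor (r j) (s $ j) * contour_kernel (r j) (s $ j) (x j))" for x
    by (rule prod.cong) auto
  thus ?thesis
    unfolding contour_value_slice[OF r_admissible, of i]
        contour_value_slice[OF upd_admissible, of i] same_slice
    by (simp only: fun_upd_same same_value)
qed

lemma contour_value_independent:
  assumes "admissible r s" "admissible r' s"
  shows "contour_value F r' s = contour_value F r s"
proof -
  have mixed_admissible: "admissible (\<lambda>j. if j \<in> A then r' j else r j) s" for A
    using assms by (simp add: admissible_def radii_def)
  have "contour_value F (\<lambda>j. if j \<in> A then r' j else r j) s = contour_value F r s" if "finite A" for A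
    using that
  proof (induction A)
    case (insert i A)
    let ?r = "\<lambda>A j. if j \<in> A then r' j else r j"
    have "?r (insert i A) = (?r A)(i := r' i)" by auto
    thus ?case
      using insert.IH contour_value_update[OF mixed_admissible[of A], of i "r' i"]
        mixed_admissible[of "insert i A"] by simp
  qed simp
  from this[of UNIV] show ?thesis by simp
qed

lemma complex_differentiable_integral_integrand:
  assumes r_admissible: "admissible r s0"
  shows "complex_differentiable_at (\<lambda>s. \<integral>t. integrand F r s t \<partial>lborel_fun) s0"
proof -
  have r_radii: "radii r" using r_admissible by (simp add: admissible_def)
  define R where "R = Min (insert 1 ((\<lambda>j. Re (s0 $ j) / 2) ` {j. r j = 0}))"
  have R_pos: "R > 0" using Re_pos_if_admissible[OF r_admissible] by (auto simp: R_def)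
  have R_less: "Re (s0 $ j) > R" if "r j = 0" for j
  proof -
    have "R \<le> Re (s0 $ j) / 2" unfolding R_def by (rule Min_le) (use that in auto)
    thus ?thesis using Re_pos_if_admissible[OF r_admissible that] by simp
  qed
  obtain K where K_majorant: "integrable lborel_fun K"
    "\<And>M F s t. dominated M F \<Longrightarrow> (\<And>j. norm (s $ j - s0 $ j) \<le> R) \<Longrightarrow> norm (integrand F r s t) \<le> M * K t"
    using integrand_majorant[OF r_radii less_imp_le[OF R_pos], of s0] R_less by blast
  show ?thesis
  proof (rule complex_differentiable_at_integral[OF R_pos])
    show "integrable lborel_fun (\<lambda>t. M * K t)" using K_majorant(1) by simp
    fix s :: "complex^'d" assume s_in: "s \<in> ball s0 R"
    show "integrand F r s \<in> borel_measurable lborel_fun"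
      using dominated r_radii by (intro measurable_integrand) (auto simp: dominated_def)
    show "complex_differentiable_at (\<lambda>s. integrand F r s t) s" for t
      unfolding integrand_def
      by (intro complex_differentiable_at_mult complex_differentiable_at_prod
          complex_differentiable_at_const
            complex_differentiable_at_component[where h = "\<lambda>z. contour_kernel _ z _"]
            contour_kernel_field_differentiable)
    have "norm (s $ j - s0 $ j) \<le> R" for j
      using s_in Finite_Cartesian_Product.norm_nth_le[of "s - s0" j]
      by (simp add: dist_norm norm_minus_commute)
    thus "norm (integrand F r s t) \<le> M * K t" for t by (rule K_majorant(2)[OF dominated])
  qed
qed

lemma complex_differentiable_contour_value:
  assumes r_admissible: "admissible r s"
  shows "complex_differentiable_at (contour_value F r) s"
proof -
  have "contour_factor (r j) field_differentiable at (s $ j)" for j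
    using r_admissible by (intro contour_factor_field_differentiable) (simp add: admissible_def)
  thus ?thesis
    unfolding contour_value_def[abs_def]
    by (intro complex_differentiable_at_mult complex_differentiable_at_prod
        complex_differentiable_at_component complex_differentiable_integral_integrand r_admissible)
qed

lemma entire_continuation:
  obtains Z where "entire_fun Z" "\<And>r s. admissible r s \<Longrightarrow> Z s = contour_value F r s"
proof -
  define radius where "radius s j = (if Re (s $ j) > 1/2 then 0 else e / 2)"
    for s :: "complex^'d" and j
  have radius_admissible: "admissible (radius s) s" for s
    using e_pos by (auto simp: admissible_def radii_def radius_def contour_domain_def)
  define Z where "Z s = contour_value F (radius s) s" for s
  have Z_eq: "Z s = contour_value F r s" if "admissible r s" for r s
    unfolding Z_def by (rule contour_value_independent[OF that radius_admissible])
  have "complex_differentiable_at Z s0" for s0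
    by (rule complex_differentiable_at_transform_open
          [OF complex_differentiable_contour_value[OF radius_admissible[of s0]]
            open_admissible[of "radius s0"]])
       (use radius_admissible Z_eq in auto)
  hence "entire_fun Z" by (simp add: entire_fun_iff)
  thus ?thesis using that Z_eq by blast
qed

end

section \<open>The factors of the integrand\<close>

subsection \<open>Difference quotients\<close>

definition difference_quotient :: "(complex \<Rightarrow> complex) \<Rightarrow> complex \<Rightarrow> complex \<Rightarrow> complex" where
  "difference_quotient f x y = (if x = y then deriv f y else (f y - f x) / (y - x))"

lemma isCont_difference_quotient:
  assumes "(f has_field_derivative deriv f y) (at y)"
  shows "isCont (\<lambda>x. difference_quotient f x y) y"
proof -
  have "((\<lambda>x. (f x - f y) / (x - y)) \<longlongrightarrow> deriv f y) (at y)"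
    using assms by (simp add: has_field_derivative_iff)
  moreover have "\<forall>\<^sub>F x in at y. (f x - f y) / (x - y) = difference_quotient f x y"
    using eventually_neq_at_within[of y]
  proof eventually_elim
    case (elim x)
    thus ?case using minus_divide_divide[of "f y - f x" "y - x"] by (simp add: difference_quotient_def)
  qed
  ultimately have "((\<lambda>x. difference_quotient f x y) \<longlongrightarrow> deriv f y) (at y)"
    by (rule Lim_transform_eventually)
  thus ?thesis by (simp add: isCont_def difference_quotient_def)
qed

lemma norm_difference_quotient_le:
  assumes deriv: "\<And>z. z \<in> closed_segment x y \<Longrightarrow> (f has_field_derivative deriv f z) (at z)"
    and bound: "\<And>z. z \<in> closed_segment x y \<Longrightarrow> norm (deriv f z) \<le> K"
  shows "norm (difference_quotient f x y) \<le> K"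
proof (cases "x = y")
  case True
  thus ?thesis using bound[of y] by (simp add: difference_quotient_def)
next
  case False
  have "norm (f y - f x) \<le> K * norm (y - x)"
    by (rule field_differentiable_bound[of "closed_segment x y"])
       (auto intro: deriv bound has_field_derivative_at_within)
  thus ?thesis using False by (simp add: difference_quotient_def norm_divide field_simps)
qed

subsection \<open>The function \<open>y / (e\<^sup>y - 1)\<close>\<close>

definition bernoulli_fun :: "complex \<Rightarrow> complex" where
  "bernoulli_fun y = (if y = 0 then 1 else y / (exp y - 1))"

definition bernoulli_dom :: "complex set" where
  "bernoulli_dom = {y. Re y > 0} \<union> ball 0 (2 * pi)"

lemma open_bernoulli_dom: "open bernoulli_dom"
  unfolding bernoulli_dom_def by (intro open_Un open_halfspace_Re_gt open_ball)

lemma exp_eq_1_in_bernoulli_dom: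
  assumes "y \<in> bernoulli_dom" "exp y = 1"
  shows "y = 0"
proof -
  from assms(2) obtain n :: int where y_parts: "Re y = 0" "Im y = of_int (2 * n) * pi"
    unfolding exp_eq_1 by auto
  hence "norm y < 2 * pi" using assms(1) by (auto simp: bernoulli_dom_def)
  moreover have "\<bar>real_of_int n\<bar> * (2 * pi) \<le> norm y"
    using abs_Im_le_cmod[of y] y_parts by (simp add: abs_mult mult_ac)
  ultimately have "\<bar>real_of_int n\<bar> * (2 * pi) < 1 * (2 * pi)" by linarith
  hence "\<bar>real_of_int n\<bar> < 1" by (rule mult_right_less_imp_less) simp
  thus ?thesis using y_parts by (simp add: complex_eq_iff)
qed

lemma bernoulli_fun_holomorphic: "bernoulli_fun holomorphic_on bernoulli_dom"
proof -
  let ?q = "\<lambda>z. if z = 0 then deriv exp 0 else (exp z - exp 0) / (z - 0) :: complex"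
  have deriv_exp: "deriv exp (0::complex) = 1"
    by (rule DERIV_imp_deriv) (auto intro!: derivative_eq_intros)
  have "?q holomorphic_on bernoulli_dom"
    by (rule pole_lemma_open) (auto intro: holomorphic_intros open_bernoulli_dom)
  moreover have "?q z \<noteq> 0" if "z \<in> bernoulli_dom" for z
    using exp_eq_1_in_bernoulli_dom[OF that] deriv_exp by auto
  ultimately have "(\<lambda>z. 1 / ?q z) holomorphic_on bernoulli_dom"
    by (intro holomorphic_intros) auto
  thus ?thesis by (rule holomorphic_transform) (auto simp: bernoulli_fun_def deriv_exp)
qed

lemma deriv_bernoulli_fun_holomorphic: "deriv bernoulli_fun holomorphic_on bernoulli_dom"
  by (rule holomorphic_deriv[OF bernoulli_fun_holomorphic open_bernoulli_dom])

lemma DERIV_bernoulli_fun: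
  "y \<in> bernoulli_dom \<Longrightarrow> (bernoulli_fun has_field_derivative deriv bernoulli_fun y) (at y)"
  by (rule holomorphic_derivI[OF bernoulli_fun_holomorphic open_bernoulli_dom])

lemma deriv_bernoulli_fun:
  assumes "y \<in> bernoulli_dom" "y \<noteq> 0"
  shows "deriv bernoulli_fun y = 1 / (exp y - 1) - y * exp y / (exp y - 1)\<^sup>2"
proof (rule DERIV_imp_deriv)
  have nonzero: "exp y - 1 \<noteq> 0" using exp_eq_1_in_bernoulli_dom assms by auto
  have "((\<lambda>y. y / (exp y - 1)) has_field_derivative
      (1 * (exp y - 1) - y * (exp y - 0)) / ((exp y - 1) * (exp y - 1))) (at y)"
    by (intro DERIV_divide DERIV_ident DERIV_diff DERIV_exp DERIV_const nonzero)
  also have "(1 * (exp y - 1) - y * (exp y - 0)) / ((exp y - 1) * (exp y - 1))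
      = 1 / (exp y - 1) - y * exp y / (exp y - 1)\<^sup>2"
    using nonzero by (simp add: diff_divide_distrib[of "exp y - 1"] power2_eq_square)
  finally show "(bernoulli_fun has_field_derivative
      1 / (exp y - 1) - y * exp y / (exp y - 1)\<^sup>2) (at y)"
    by (rule has_field_derivative_transform_within_open[where S = "bernoulli_dom - {0}"])
       (use assms open_bernoulli_dom in \<open>auto simp: bernoulli_fun_def open_delete\<close>)
qed

lemma norm_deriv_bernoulli_fun_le:
  assumes Re_z_ge: "Re z \<ge> 1"
  shows "norm (deriv bernoulli_fun z) \<le> exp (- Re z) * (2 + 4 * norm z)"
proof -
  have z_in: "z \<in> bernoulli_dom" "z \<noteq> 0" using Re_z_ge by (auto simp: bernoulli_dom_def)
  have "(2::real) \<le> exp (Re z)" using Re_z_ge exp_ge_add_one_self[of "Re z"] by linarith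
  hence "exp (Re z) / 2 \<le> norm (exp z) - norm (1::complex)" by simp
  also have "\<dots> \<le> norm (exp z - 1)" by (rule norm_triangle_ineq2)
  finally have exp_half_le: "exp (Re z) / 2 \<le> norm (exp z - 1)" .
  have inverse: "1 / norm (exp z - 1) \<le> 2 * exp (- Re z)"
  proof -
    have "1 / norm (exp z - 1) \<le> 1 / (exp (Re z) / 2)"
      by (intro frac_le exp_half_le) auto
    thus ?thesis by (simp add: exp_minus field_simps)
  qed
  have "norm (deriv bernoulli_fun z) \<le> norm (1 / (exp z - 1)) + norm (z * exp z / (exp z - 1)\<^sup>2)"
    unfolding deriv_bernoulli_fun[OF z_in] by (rule norm_triangle_ineq4)
  also have "\<dots> = 1 / norm (exp z - 1) + norm z * exp (Re z) * (1 / norm (exp z - 1))\<^sup>2"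
    by (simp add: norm_divide norm_mult norm_power power_divide)
  also have "\<dots> \<le> 2 * exp (- Re z) + norm z * exp (Re z) * (2 * exp (- Re z))\<^sup>2"
    using inverse by (intro add_mono mult_left_mono power_mono) auto
  also have "\<dots> = exp (- Re z) * (2 + 4 * norm z)"
    by (simp add: power2_eq_square exp_minus field_simps)
  finally show ?thesis .
qed

subsection \<open>Sectors\<close>

definition sector :: "real \<Rightarrow> real \<Rightarrow> complex set" where
  "sector A \<eta> = {y. norm y \<le> A * Re y + \<eta>}"

lemma sector_mono: "\<eta> \<le> \<eta>' \<Longrightarrow> sector A \<eta> \<subseteq> sector A \<eta>'"
  by (auto simp: sector_def)

lemma scale_in_sector:
  assumes "y \<in> sector A \<eta>" "\<mu> \<ge> 0"
  shows "of_real \<mu> * y \<in> sector A (\<mu> * \<eta>)"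
proof -
  have "\<mu> * norm y \<le> \<mu> * (A * Re y + \<eta>)" using assms by (intro mult_left_mono) (auto simp: sector_def)
  thus ?thesis using assms(2) by (simp add: sector_def norm_mult algebra_simps)
qed

lemma sector_norm_le:
  assumes "y \<in> sector A \<eta>" "A \<ge> 0" "Re y \<le> 0"
  shows "norm y \<le> \<eta>"
  using assms mult_nonneg_nonpos[of A "Re y"] by (simp add: sector_def)

lemma sector_Re_ge:
  assumes "y \<in> sector A \<eta>" "A \<ge> 0" "\<eta> \<ge> 0"
  shows "Re y \<ge> - \<eta>"
proof (cases "Re y \<le> 0")
  case True
  thus ?thesis using sector_norm_le[OF assms(1,2) True] abs_Re_le_cmod[of y] by linarith
qed (use assms in auto)

lemma sector_subset_bernoulli_dom:
  assumes "A \<ge> 0" "\<eta> < 2 * pi"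
  shows "sector A \<eta> \<subseteq> bernoulli_dom"
  using sector_norm_le[of _ A \<eta>] assms by (force simp: bernoulli_dom_def not_less)

lemma compact_truncated_sector:
  assumes "A \<ge> 0"
  shows "compact (sector A \<eta> \<inter> {y. Re y \<le> 1})"
proof (rule compact_eq_bounded_closed[THEN iffD2, OF conjI])
  have "norm y \<le> A + \<eta>" if "y \<in> sector A \<eta> \<inter> {y. Re y \<le> 1}" for y
    using that assms mult_left_mono[of "Re y" 1 A] by (simp add: sector_def)
  thus "bounded (sector A \<eta> \<inter> {y. Re y \<le> 1})" by (auto simp: bounded_iff)
  show "closed (sector A \<eta> \<inter> {y. Re y \<le> 1})"
    unfolding sector_def by (intro closed_Int closed_Collect_le continuous_intros)
qed

lemma bounded_on_sector:
  fixes f :: "complex \<Rightarrow> 'a::real_normed_vector"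
  assumes A_nonneg: "A \<ge> 0" and f_continuous: "continuous_on (sector A \<eta>) f"
    and far_bound: "\<And>y. y \<in> sector A \<eta> \<Longrightarrow> Re y \<ge> 1 \<Longrightarrow> norm (f y) \<le> C"
  obtains B where "\<And>y. y \<in> sector A \<eta> \<Longrightarrow> norm (f y) \<le> B"
proof -
  have "bounded (f ` (sector A \<eta> \<inter> {y. Re y \<le> 1}))"
    by (intro compact_imp_bounded compact_continuous_image compact_truncated_sector A_nonneg
        continuous_on_subset[OF f_continuous]) auto
  then obtain B where "\<And>y. y \<in> sector A \<eta> \<inter> {y. Re y \<le> 1} \<Longrightarrow> norm (f y) \<le> B"
    unfolding bounded_iff by blast
  hence "norm (f y) \<le> max B C" if "y \<in> sector A \<eta>" for y
    using far_bound[of y] that by (cases "Re y \<ge> 1") (auto simp: le_max_iff_disj)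
  thus ?thesis by (rule that)
qed

lemma deriv_bernoulli_fun_decay:
  assumes A_nonneg: "A \<ge> 0" and \<eta>_bounds: "0 \<le> \<eta>" "\<eta> < 2 * pi" and \<kappa>_pos: "\<kappa> > 0"
  obtains K where "\<And>z. z \<in> sector A \<eta> \<Longrightarrow> norm (deriv bernoulli_fun z) \<le> K * exp (- ((1 - \<kappa>) * Re z))"
proof -
  let ?f = "\<lambda>z. deriv bernoulli_fun z * exp (of_real (1 - \<kappa>) * z)"
  have "norm (?f z) \<le> 2 + 4 * \<eta> + 4 * A / \<kappa>" if z_in: "z \<in> sector A \<eta>" "Re z \<ge> 1" for z
  proof -
    let ?x = "Re z"
    have "norm (deriv bernoulli_fun z) \<le> exp (- ?x) * (2 + 4 * norm z)"
      by (rule norm_deriv_bernoulli_fun_le[OF z_in(2)])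
    also have "\<dots> \<le> exp (- ?x) * (2 + 4 * (A * ?x + \<eta>))"
      using z_in by (intro mult_left_mono) (auto simp: sector_def)
    finally have "norm (?f z) \<le> exp (- ?x) * (2 + 4 * (A * ?x + \<eta>)) * exp ((1 - \<kappa>) * ?x)"
      by (simp add: norm_mult)
    also have "\<dots> = (exp (- ?x) * exp ((1 - \<kappa>) * ?x)) * (2 + 4 * (A * ?x + \<eta>))"
      by (simp only: mult_ac)
    also have "exp (- ?x) * exp ((1 - \<kappa>) * ?x) = exp (- (\<kappa> * ?x))"
      by (simp add: algebra_simps flip: exp_add)
    also have "exp (- (\<kappa> * ?x)) * (2 + 4 * (A * ?x + \<eta>))
        = (2 + 4 * \<eta>) * exp (- (\<kappa> * ?x)) + 4 * A / \<kappa> * (\<kappa> * ?x * exp (- (\<kappa> * ?x)))"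
      using \<kappa>_pos by (simp add: field_simps)
    also have "\<dots> \<le> (2 + 4 * \<eta>) * 1 + 4 * A / \<kappa> * 1"
    proof (intro add_mono mult_left_mono)
      show "exp (- (\<kappa> * ?x)) \<le> 1" using \<kappa>_pos z_in by simp
      have "\<kappa> * ?x \<le> exp (\<kappa> * ?x)" using exp_ge_add_one_self[of "\<kappa> * ?x"] by linarith
      thus "\<kappa> * ?x * exp (- (\<kappa> * ?x)) \<le> 1" by (simp add: exp_minus field_simps)
    qed (use A_nonneg \<eta>_bounds \<kappa>_pos in auto)
    finally show ?thesis by simp
  qed
  moreover have "continuous_on (sector A \<eta>) ?f"
    by (intro continuous_intros holomorphic_on_imp_continuous_on
          holomorphic_on_subset[OF deriv_bernoulli_fun_holomorphic
            sector_subset_bernoulli_dom[OF A_nonneg \<eta>_bounds(2)]])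
  ultimately obtain B where "\<And>z. z \<in> sector A \<eta> \<Longrightarrow> norm (?f z) \<le> B"
    using bounded_on_sector[OF A_nonneg] by blast
  thus ?thesis
    by (intro that[of B], unfold exp_minus divide_inverse[symmetric])
       (subst pos_le_divide_eq, auto simp: norm_mult)
qed

lemma exp_neg_mult_le:
  fixes x p q \<eta> :: real
  assumes "q \<le> p" "- \<eta> \<le> x"
  shows "exp (- (p * x)) \<le> exp ((p - q) * \<eta>) * exp (- (q * x))"
proof -
  have "0 \<le> (p - q) * (x + \<eta>)" using assms by (intro mult_nonneg_nonneg) auto
  thus ?thesis by (simp add: algebra_simps flip: exp_add)
qed

lemma deriv_bernoulli_fun_scaled_decay:
  assumes A_nonneg: "A \<ge> 0" and \<eta>_bounds: "0 \<le> \<eta>" "\<eta> < pi" and \<kappa>_bounds: "0 < \<kappa>" "\<kappa> < 1"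
  obtains K where "\<And>\<mu> y. \<bar>\<mu> - 1\<bar> < \<kappa> / 2 \<Longrightarrow> y \<in> sector A \<eta> \<Longrightarrow>
      norm (deriv bernoulli_fun (of_real \<mu> * y)) \<le> K * exp (- ((1 - \<kappa>) * Re y))"
proof -
  obtain K where decay: "\<And>z. z \<in> sector A (2 * \<eta>) \<Longrightarrow>
      norm (deriv bernoulli_fun z) \<le> K * exp (- ((1 - \<kappa> / 2) * Re z))"
    using deriv_bernoulli_fun_decay[of A "2 * \<eta>" "\<kappa> / 2"] A_nonneg \<eta>_bounds \<kappa>_bounds by auto
  have "norm (deriv bernoulli_fun 0) \<le> K" using decay[of 0] \<eta>_bounds by (simp add: sector_def)
  hence K_nonneg: "K \<ge> 0" by (rule order_trans[OF norm_ge_zero])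
  show ?thesis
  proof (rule that[of "K * exp (2 * \<eta>)"])
    fix \<mu> y assume \<mu>_near_1: "\<bar>\<mu> - 1\<bar> < \<kappa> / 2" and y_in: "y \<in> sector A \<eta>"
    define p where "p = (1 - \<kappa> / 2) * \<mu>"
    have \<mu>_bounds: "1 - \<kappa> / 2 \<le> \<mu>" "0 \<le> \<mu>" "\<mu> \<le> 2"
      using \<mu>_near_1 \<kappa>_bounds by (auto simp: abs_if split: if_splits)
    have "of_real \<mu> * y \<in> sector A (2 * \<eta>)"
      using scale_in_sector[OF y_in \<mu>_bounds(2)] sector_mono[of "\<mu> * \<eta>" "2 * \<eta>" A] \<mu>_bounds(3)
          \<eta>_bounds(1)
      by (auto intro: mult_right_mono)
    from decay[OF this] have "norm (deriv bernoulli_fun (of_real \<mu> * y)) \<le> K * exp (- (p * Re y))"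
      by (simp add: p_def mult.assoc)
    also have "exp (- (p * Re y)) \<le> exp ((p - (1 - \<kappa>)) * \<eta>) * exp (- ((1 - \<kappa>) * Re y))"
    proof (rule exp_neg_mult_le)
      have "1 - \<kappa> \<le> (1 - \<kappa> / 2) * (1 - \<kappa> / 2)" by (simp add: algebra_simps)
      also have "\<dots> \<le> p" unfolding p_def using \<kappa>_bounds \<mu>_bounds by (intro mult_left_mono) auto
      finally show "1 - \<kappa> \<le> p" .
    qed (rule sector_Re_ge[OF y_in A_nonneg \<eta>_bounds(1)])
    also have "exp ((p - (1 - \<kappa>)) * \<eta>) \<le> exp (2 * \<eta>)"
    proof -
      have "p \<le> 1 * 2" unfolding p_def using \<kappa>_bounds \<mu>_bounds by (intro mult_mono) auto
      thus ?thesis using \<kappa>_bounds \<eta>_bounds by (auto intro: mult_right_mono)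
    qed
    finally show "norm (deriv bernoulli_fun (of_real \<mu> * y))
        \<le> K * exp (2 * \<eta>) * exp (- ((1 - \<kappa>) * Re y))"
      using K_nonneg by (simp add: mult_left_mono mult.assoc)
  qed
qed

subsection \<open>Exact and approximate factors\<close>

definition exact_factor :: "complex \<Rightarrow> complex \<Rightarrow> complex" where
  "exact_factor \<xi> = remove_sings (\<lambda>y. des_F (delta_one \<xi>) y \<xi>)"

definition approx_factor :: "real \<Rightarrow> complex \<Rightarrow> complex \<Rightarrow> complex" where
  "approx_factor c \<xi> y
      = remove_sings (\<lambda>y. des_F_approx c (delta_one \<xi>) y \<xi>) y / (1 - delta_one \<xi> * of_real c)"

lemma exact_factor_1:
  assumes y_in: "y \<in> bernoulli_dom"
  shows "exact_factor 1 y = deriv bernoulli_fun y"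
  unfolding exact_factor_def
proof (rule remove_sings_eqI)
  have "isCont (deriv bernoulli_fun) y"
    using holomorphic_on_imp_continuous_on[OF deriv_bernoulli_fun_holomorphic] y_in
    by (simp add: continuous_on_eq_continuous_at[OF open_bernoulli_dom])
  hence "deriv bernoulli_fun \<midarrow>y\<rightarrow> deriv bernoulli_fun y" by (rule isContD)
  moreover have "\<forall>\<^sub>F w in at y. w \<in> bernoulli_dom" "\<forall>\<^sub>F w in at y. w \<noteq> 0"
    by (rule eventually_at_in_open'[OF open_bernoulli_dom y_in], rule eventually_neq_at_within)
  hence "\<forall>\<^sub>F w in at y. deriv bernoulli_fun w = des_F (delta_one 1) w 1"
    by eventually_elim (simp add: deriv_bernoulli_fun des_F_def delta_one_def)
  ultimately show "(\<lambda>y. des_F (delta_one 1) y 1) \<midarrow>y\<rightarrow> deriv bernoulli_fun y"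
    by (rule Lim_transform_eventually)
qed

lemma isCont_scaled_bernoulli_quotient:
  assumes y_in: "y \<in> bernoulli_dom" "of_real c * y \<in> bernoulli_dom" and c_neq: "c \<noteq> 1"
  shows "isCont (\<lambda>w. difference_quotient bernoulli_fun (of_real c * w) w) y"
proof -
  let ?f = "\<lambda>w. bernoulli_fun w - bernoulli_fun (of_real c * w)"
  have deriv_f: "(?f has_field_derivative
      deriv bernoulli_fun y - deriv bernoulli_fun (of_real c * y) * of_real c) (at y)"
    by (intro DERIV_diff DERIV_bernoulli_fun y_in DERIV_chain2[OF DERIV_bernoulli_fun DERIV_cmult_Id])
  have quotient: "difference_quotient bernoulli_fun (of_real c * w) w = ?f w / (w * (1 - of_real c))"
    if "w \<noteq> 0" for w
    using that c_neq by (simp add: difference_quotient_def algebra_simps)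
  show ?thesis
  proof (cases "y = 0")
    case True
    have "((\<lambda>w. ?f w / w / (1 - of_real c))
        \<longlongrightarrow> deriv bernoulli_fun 0 * (1 - of_real c) / (1 - of_real c)) (at 0)"
      using deriv_f True c_neq
      by (intro tendsto_divide tendsto_const) (auto simp: has_field_derivative_iff algebra_simps)
    moreover have "\<forall>\<^sub>F w in at 0. ?f w / w / (1 - of_real c)
        = difference_quotient bernoulli_fun (of_real c * w) w"
      using eventually_neq_at_within[of 0] by eventually_elim (simp add: quotient)
    ultimately have "((\<lambda>w. difference_quotient bernoulli_fun (of_real c * w) w) \<longlongrightarrow>
        deriv bernoulli_fun 0 * (1 - of_real c) / (1 - of_real c)) (at 0)"
      by (rule Lim_transform_eventually)
    thus ?thesis using True c_neq by (simp add: isCont_def difference_quotient_def)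
  next
    case False
    have "isCont (\<lambda>w. ?f w / (w * (1 - of_real c))) y"
      using False c_neq
      by (intro isCont_divide[OF DERIV_isCont[OF deriv_f]]) (auto intro: continuous_intros)
    moreover have "\<forall>\<^sub>F w in nhds y. ?f w / (w * (1 - of_real c))
        = difference_quotient bernoulli_fun (of_real c * w) w"
      using t1_space_nhds[OF False] by eventually_elim (simp add: quotient)
    ultimately show ?thesis by (simp add: isCont_cong)
  qed
qed

lemma approx_factor_1:
  assumes y_in: "y \<in> bernoulli_dom" "of_real c * y \<in> bernoulli_dom" and c_neq: "c \<noteq> 0" "c \<noteq> 1"
  shows "approx_factor c 1 y = difference_quotient bernoulli_fun (of_real c * y) y"
proof -
  let ?q = "\<lambda>w. difference_quotient bernoulli_fun (of_real c * w) w * (1 - of_real c)"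
  have "remove_sings (\<lambda>w. des_F_approx c (delta_one 1) w 1) y = ?q y"
  proof (rule remove_sings_eqI, rule Lim_transform_eventually)
    show "?q \<midarrow>y\<rightarrow> ?q y"
      using isCont_scaled_bernoulli_quotient[OF y_in c_neq(2)]
      by (intro tendsto_mult tendsto_const isContD)
    show "\<forall>\<^sub>F w in at y. ?q w = des_F_approx c (delta_one 1) w 1"
      using eventually_neq_at_within[of 0]
    proof eventually_elim
      case (elim w)
      have "?q w = (w / (exp w - 1) - of_real c * w / (exp (of_real c * w) - 1)) / w"
        using elim c_neq
        by (simp add: difference_quotient_def bernoulli_fun_def divide_simps)
           (simp add: algebra_simps)
      also have "\<dots> = 1 / (exp w - 1) - of_real c / (exp (of_real c * w) - 1)"
        using elim by (simp add: diff_divide_distrib)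
      finally show ?case by (simp add: des_F_approx_def delta_one_def)
    qed
  qed
  thus ?thesis using c_neq by (simp add: approx_factor_def delta_one_def)
qed

lemma isCont_approx_factor_1:
  assumes y_in: "y \<in> bernoulli_dom" "of_real c * y \<in> bernoulli_dom" and c_neq: "c \<noteq> 0" "c \<noteq> 1"
  shows "isCont (approx_factor c 1) y"
proof -
  have "open ((\<lambda>y. complex_of_real c * y) -` bernoulli_dom)"
    by (intro open_vimage open_bernoulli_dom continuous_intros)
  hence "\<forall>\<^sub>F w in nhds y. w \<in> bernoulli_dom \<inter> (\<lambda>y. of_real c * y) -` bernoulli_dom"
    using y_in open_bernoulli_dom by (intro eventually_nhds_in_open) auto
  hence "\<forall>\<^sub>F w in nhds y. difference_quotient bernoulli_fun (of_real c * w) w = approx_factor c 1 w"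
    by eventually_elim (use c_neq in \<open>simp add: approx_factor_1\<close>)
  thus ?thesis using isCont_scaled_bernoulli_quotient[OF y_in c_neq(2)] by (simp add: isCont_cong)
qed

definition decays_on :: "real \<Rightarrow> real \<Rightarrow> complex set \<Rightarrow> (complex \<Rightarrow> complex) \<Rightarrow> bool" where
  "decays_on \<kappa> K Y g \<longleftrightarrow> (\<forall>y\<in>Y. isCont g y \<and> norm (g y) \<le> K * exp (- ((1 - \<kappa>) * Re y)))"

definition desingularizes_on :: "real \<Rightarrow> real \<Rightarrow> complex set \<Rightarrow> complex \<Rightarrow> bool" where
  "desingularizes_on \<kappa> K Y \<xi> \<longleftrightarrow>
     exact_factor \<xi> analytic_on Y \<and> decays_on \<kappa> K Y (exact_factor \<xi>) \<and>
     (\<forall>\<^sub>F c in at 1. decays_on \<kappa> K Y (approx_factor c \<xi>)) \<and>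
     (\<forall>y\<in>Y. ((\<lambda>c. approx_factor c \<xi> y) \<longlongrightarrow> exact_factor \<xi> y) (at 1))"

lemma decays_on_mono: "decays_on \<kappa> K Y g \<Longrightarrow> Y' \<subseteq> Y \<Longrightarrow> K \<le> K' \<Longrightarrow> decays_on \<kappa> K' Y' g"
  unfolding decays_on_def by (blast intro: order_trans mult_right_mono[OF _ exp_ge_zero])

lemma desingularizes_on_mono:
  assumes "desingularizes_on \<kappa> K Y \<xi>" "Y' \<subseteq> Y" "K \<le> K'"
  shows "desingularizes_on \<kappa> K' Y' \<xi>"
proof -
  have "\<forall>\<^sub>F c in at 1. decays_on \<kappa> K' Y' (approx_factor c \<xi>)"
    using assms(1) unfolding desingularizes_on_def
    by (elim conjE eventually_mono) (rule decays_on_mono[OF _ assms(2,3)])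
  thus ?thesis
    using assms(1,2) decays_on_mono[OF _ assms(2,3)] analytic_on_subset[OF _ assms(2)]
    unfolding desingularizes_on_def by blast
qed

lemma desingularizes_on_if_bounded:
  assumes \<xi>_neq_1: "\<xi> \<noteq> 1" and \<kappa>_nonneg: "\<kappa> \<ge> 0" and Re_ge: "\<And>y. y \<in> Y \<Longrightarrow> Re y \<ge> - \<eta>"
    and nonzero: "\<And>y. y \<in> Y \<Longrightarrow> 1 - \<xi> * exp (- y) \<noteq> 0"
    and bound: "\<And>y. y \<in> Y \<Longrightarrow> norm (1 / (1 - \<xi> * exp (- y))) \<le> B"
  shows "\<exists>K. desingularizes_on \<kappa> K Y \<xi>"
proof -
  let ?g = "\<lambda>y. 1 / (exp y - \<xi>)"
  have factors: "exact_factor \<xi> = remove_sings ?g" "approx_factor c \<xi> = remove_sings ?g" for c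
    using \<xi>_neq_1
    by (simp_all add: fun_eq_iff exact_factor_def approx_factor_def des_F_def des_F_approx_def
        delta_one_def)
  have g_eq: "?g y = exp (- y) * (1 / (1 - \<xi> * exp (- y)))" for y
    by (simp add: exp_minus field_simps)
  have analytic: "?g analytic_on {y}" if "y \<in> Y" for y
  proof -
    have "exp y - \<xi> = exp y * (1 - \<xi> * exp (- y))" by (simp add: exp_minus field_simps)
    thus ?thesis using nonzero[OF that] by (intro analytic_intros) auto
  qed
  have "decays_on \<kappa> (B * exp (\<kappa> * \<eta>)) Y (remove_sings ?g)"
    unfolding decays_on_def
  proof (intro ballI conjI)
    fix y assume y_in: "y \<in> Y"
    show "isCont (remove_sings ?g) y"
      using analytic[OF y_in] by (intro analytic_at_imp_isCont remove_sings_analytic_on)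
    have "norm (remove_sings ?g y) = exp (- (1 * Re y)) * norm (1 / (1 - \<xi> * exp (- y)))"
      using analytic[OF y_in] by (simp add: g_eq norm_mult del: times_divide_eq_right)
    also have "\<dots> \<le> (exp ((1 - (1 - \<kappa>)) * \<eta>) * exp (- ((1 - \<kappa>) * Re y))) * B"
      using \<kappa>_nonneg by (intro mult_mono bound exp_neg_mult_le Re_ge y_in) auto
    finally show "norm (remove_sings ?g y) \<le> B * exp (\<kappa> * \<eta>) * exp (- ((1 - \<kappa>) * Re y))"
      by (simp add: mult_ac)
  qed
  moreover have "remove_sings ?g analytic_on Y"
    using analytic analytic_on_analytic_at by (blast intro: remove_sings_analytic_on)
  ultimately show ?thesis unfolding desingularizes_on_def factors by auto
qed

lemma desingularizes_on_halfplane: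
  assumes \<xi>_less_1: "norm \<xi> < 1" and \<kappa>_nonneg: "\<kappa> \<ge> 0"
  shows "\<exists>\<eta>>0. \<exists>K. desingularizes_on \<kappa> K {y. Re y \<ge> - \<eta>} \<xi>"
proof -
  have "((\<lambda>\<eta>. norm \<xi> * exp \<eta>) \<longlongrightarrow> norm \<xi> * exp 0) (at_right (0::real))" by (intro tendsto_intros)
  hence "\<forall>\<^sub>F \<eta> in at_right (0::real). norm \<xi> * exp \<eta> < 1"
    using \<xi>_less_1 by (intro order_tendstoD(2)) auto
  hence "\<forall>\<^sub>F \<eta> in at_right (0::real). norm \<xi> * exp \<eta> < 1 \<and> \<eta> > 0"
    using eventually_at_right_less by (rule eventually_conj)
  then obtain \<eta> :: real where \<eta>_small: "norm \<xi> * exp \<eta> < 1" "\<eta> > 0"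
    using eventually_happens trivial_limit_at_right_real by blast
  have norm_ge: "norm (1 - \<xi> * exp (- y)) \<ge> 1 - norm \<xi> * exp \<eta>" if "Re y \<ge> - \<eta>" for y
  proof -
    have "norm (\<xi> * exp (- y)) \<le> norm \<xi> * exp \<eta>"
      using that by (simp add: norm_mult mult_left_mono)
    thus ?thesis using norm_triangle_ineq2[of 1 "\<xi> * exp (- y)"] by simp
  qed
  have "\<exists>K. desingularizes_on \<kappa> K {y. Re y \<ge> - \<eta>} \<xi>"
  proof (rule desingularizes_on_if_bounded[OF _ \<kappa>_nonneg])
    fix y assume "y \<in> {y. Re y \<ge> - \<eta>}"
    hence "0 < 1 - norm \<xi> * exp \<eta>" "1 - norm \<xi> * exp \<eta> \<le> norm (1 - \<xi> * exp (- y))"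
      using norm_ge \<eta>_small by auto
    thus "1 - \<xi> * exp (- y) \<noteq> 0" "norm (1 / (1 - \<xi> * exp (- y))) \<le> 1 / (1 - norm \<xi> * exp \<eta>)"
      by (auto simp: norm_divide intro: frac_le)
  qed (use \<xi>_less_1 in auto)
  thus ?thesis using \<eta>_small by blast
qed

lemma desingularizes_on_sector_ne_1:
  assumes \<xi>_unit: "norm \<xi> = 1" "\<xi> \<noteq> 1" and \<kappa>_nonneg: "\<kappa> \<ge> 0" and A_nonneg: "A \<ge> 0"
  shows "\<exists>\<eta>>0. \<exists>K. desingularizes_on \<kappa> K (sector A \<eta>) \<xi>"
proof -
  have "isCont (exp :: complex \<Rightarrow> complex) 0" by simp
  moreover have "norm (\<xi> - 1) > 0" using \<xi>_unit(2) by simp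
  ultimately obtain d where exp_near_1: "d > 0"
      "\<And>y::complex. dist y 0 < d \<Longrightarrow> dist (exp y) (exp 0) < norm (\<xi> - 1)"
    unfolding continuous_at_eps_delta by blast
  define \<eta> where "\<eta> = d / 2"
  have \<eta>_less: "\<eta> > 0" "\<eta> < d" using exp_near_1 by (auto simp: \<eta>_def)
  have nonzero: "1 - \<xi> * exp (- y) \<noteq> 0" if y_in: "y \<in> sector A \<eta>" for y
  proof
    assume "1 - \<xi> * exp (- y) = 0"
    hence exp_y: "exp y = \<xi>" by (simp add: exp_minus field_simps)
    hence "Re y = 0" using \<xi>_unit(1) norm_exp_eq_Re[of y] by simp
    hence "norm y < d" using sector_norm_le[OF y_in A_nonneg] \<eta>_less by simp
    thus False using exp_near_1(2)[of y] exp_y by (simp add: dist_norm)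
  qed
  have far_bound: "norm (1 / (1 - \<xi> * exp (- y))) \<le> 1 / (1 - exp (-1))"
    if "y \<in> sector A \<eta>" "Re y \<ge> 1" for y
  proof -
    have "norm (\<xi> * exp (- y)) \<le> exp (-1)" using that(2) \<xi>_unit by (simp add: norm_mult)
    hence "1 - exp (-1) \<le> norm (1 - \<xi> * exp (- y))"
      using norm_triangle_ineq2[of 1 "\<xi> * exp (- y)"] by simp
    moreover have "(0::real) < 1 - exp (-1)" by simp
    ultimately show ?thesis by (auto simp: norm_divide intro: frac_le)
  qed
  have continuous: "continuous_on (sector A \<eta>) (\<lambda>y. 1 / (1 - \<xi> * exp (- y)))"
    by (intro continuous_intros ballI nonzero)
  obtain B where "\<And>y. y \<in> sector A \<eta> \<Longrightarrow> norm (1 / (1 - \<xi> * exp (- y))) \<le> B"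
    using bounded_on_sector[OF A_nonneg continuous far_bound] by blast
  hence "\<exists>K. desingularizes_on \<kappa> K (sector A \<eta>) \<xi>"
    using \<eta>_less
    by (intro desingularizes_on_if_bounded[OF \<xi>_unit(2) \<kappa>_nonneg, of _ \<eta> B] nonzero
        sector_Re_ge[OF _ A_nonneg]) auto
  thus ?thesis using \<eta>_less by blast
qed

lemma scale_in_bernoulli_dom:
  assumes "y \<in> sector A 1" "A \<ge> 0" "\<bar>\<mu> - 1\<bar> < 1"
  shows "of_real \<mu> * y \<in> bernoulli_dom"
proof -
  have "0 \<le> \<mu>" "\<mu> < 2 * pi" using assms(3) pi_gt3 by auto
  thus ?thesis using scale_in_sector[OF assms(1)] sector_subset_bernoulli_dom[OF assms(2)] by auto
qed

lemma closed_segment_scale: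
  assumes "z \<in> closed_segment (of_real c * y) y"
  obtains \<mu> where "\<bar>\<mu> - 1\<bar> \<le> \<bar>c - 1\<bar>" "z = of_real \<mu> * (y::complex)"
proof -
  obtain u where segment: "0 \<le> u" "u \<le> 1" "z = (1 - u) *\<^sub>R (of_real c * y) + u *\<^sub>R y"
    using assms by (auto simp: closed_segment_def)
  have "\<bar>((1 - u) * c + u) - 1\<bar> = (1 - u) * \<bar>c - 1\<bar>"
    using segment abs_mult[of "1 - u" "c - 1"] by (simp add: algebra_simps)
  also have "\<dots> \<le> 1 * \<bar>c - 1\<bar>" using segment by (intro mult_right_mono) auto
  finally have "\<bar>((1 - u) * c + u) - 1\<bar> \<le> \<bar>c - 1\<bar>" by simp
  moreover have "z = of_real ((1 - u) * c + u) * y"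
    using segment by (simp add: scaleR_conv_of_real algebra_simps)
  ultimately show ?thesis by (rule that)
qed

lemma exact_factor_1_analytic: "exact_factor 1 analytic_on bernoulli_dom"
proof -
  have "exact_factor 1 holomorphic_on bernoulli_dom"
    using deriv_bernoulli_fun_holomorphic by (rule holomorphic_transform) (simp add: exact_factor_1)
  thus ?thesis by (simp add: analytic_on_open[OF open_bernoulli_dom])
qed

lemma approx_factor_1_tendsto:
  assumes y_in: "y \<in> bernoulli_dom"
  shows "((\<lambda>c. approx_factor c 1 y) \<longlongrightarrow> exact_factor 1 y) (at 1)"
proof (rule Lim_transform_eventually)
  have scaled: "((\<lambda>c. complex_of_real c * y) \<longlongrightarrow> of_real 1 * y) (at 1)" by (intro tendsto_intros)
  hence "((\<lambda>c. difference_quotient bernoulli_fun (of_real c * y) y)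
      \<longlongrightarrow> difference_quotient bernoulli_fun y y) (at 1)"
    using isCont_tendsto_compose[OF isCont_difference_quotient[OF DERIV_bernoulli_fun[OF y_in]]]
    by simp
  thus "((\<lambda>c. difference_quotient bernoulli_fun (of_real c * y) y) \<longlongrightarrow> exact_factor 1 y) (at 1)"
    using y_in by (simp add: difference_quotient_def exact_factor_1)
  have "\<forall>\<^sub>F c in at 1. of_real c * y \<in> bernoulli_dom"
    by (rule topological_tendstoD[OF scaled open_bernoulli_dom]) (use y_in in simp)
  moreover have "\<forall>\<^sub>F c in at 1. c \<noteq> (0::real)"
    using tendsto_ident_at by (rule tendsto_imp_eventually_ne) simp
  moreover have "\<forall>\<^sub>F c in at 1. c \<noteq> (1::real)" by (rule eventually_neq_at_within)
  ultimately show "\<forall>\<^sub>F c in at 1. difference_quotient bernoulli_fun (of_real c * y) y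
      = approx_factor c 1 y"
    by eventually_elim (simp add: approx_factor_1 y_in)
qed

lemma approx_factor_1_decays:
  assumes A_nonneg: "A \<ge> 0" and \<kappa>_less_1: "\<kappa> < 1" and c_near_1: "\<bar>c - 1\<bar> < \<kappa> / 2" "c \<noteq> 1"
    and bound: "\<And>\<mu> y. \<bar>\<mu> - 1\<bar> < \<kappa> / 2 \<Longrightarrow> y \<in> sector A 1 \<Longrightarrow>
      norm (deriv bernoulli_fun (of_real \<mu> * y)) \<le> K * exp (- ((1 - \<kappa>) * Re y))"
  shows "decays_on \<kappa> K (sector A 1) (approx_factor c 1)"
  unfolding decays_on_def
proof (intro ballI conjI)
  fix y assume y_in: "y \<in> sector A 1"
  have scaled_in_dom: "of_real \<mu> * y \<in> bernoulli_dom" if "\<bar>\<mu> - 1\<bar> < \<kappa> / 2" for \<mu>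
    using that \<kappa>_less_1 by (intro scale_in_bernoulli_dom[OF y_in A_nonneg]) auto
  have in_dom: "y \<in> bernoulli_dom" "of_real c * y \<in> bernoulli_dom" "c \<noteq> 0"
    using scaled_in_dom[of 1] scaled_in_dom[of c] c_near_1 \<kappa>_less_1 abs_ge_zero[of "c - 1"] by auto
  show "isCont (approx_factor c 1) y"
    using in_dom c_near_1(2) by (intro isCont_approx_factor_1)
  have "norm (difference_quotient bernoulli_fun (of_real c * y) y) \<le> K * exp (- ((1 - \<kappa>) * Re y))"
  proof (rule norm_difference_quotient_le)
    fix z assume "z \<in> closed_segment (of_real c * y) y"
    then obtain \<mu> where "\<bar>\<mu> - 1\<bar> \<le> \<bar>c - 1\<bar>" "z = of_real \<mu> * y"
      by (rule closed_segment_scale)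
    thus "norm (deriv bernoulli_fun z) \<le> K * exp (- ((1 - \<kappa>) * Re y))"
      and "(bernoulli_fun has_field_derivative deriv bernoulli_fun z) (at z)"
      using bound[OF _ y_in] DERIV_bernoulli_fun[OF scaled_in_dom] c_near_1(1) by auto
  qed
  thus "norm (approx_factor c 1 y) \<le> K * exp (- ((1 - \<kappa>) * Re y))"
    using in_dom c_near_1(2) by (simp add: approx_factor_1)
qed

lemma desingularizes_on_sector_1:
  assumes \<kappa>_bounds: "0 < \<kappa>" "\<kappa> < 1" and A_nonneg: "A \<ge> 0"
  shows "\<exists>K. desingularizes_on \<kappa> K (sector A 1) 1"
proof -
  obtain K where bound: "\<And>\<mu> y. \<bar>\<mu> - 1\<bar> < \<kappa> / 2 \<Longrightarrow> y \<in> sector A 1 \<Longrightarrow>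
      norm (deriv bernoulli_fun (of_real \<mu> * y)) \<le> K * exp (- ((1 - \<kappa>) * Re y))"
    using deriv_bernoulli_fun_scaled_decay[of A 1 \<kappa>] A_nonneg \<kappa>_bounds pi_gt3 by auto
  have sector_in_dom: "sector A 1 \<subseteq> bernoulli_dom"
    using A_nonneg pi_gt3 by (intro sector_subset_bernoulli_dom) auto
  have "\<forall>\<^sub>F c in at (1::real). \<bar>c - 1\<bar> < \<kappa> / 2 \<and> c \<noteq> 1"
    using \<kappa>_bounds by (auto simp: eventually_at dist_real_def intro!: exI[of _ "\<kappa> / 2"])
  hence "\<forall>\<^sub>F c in at 1. decays_on \<kappa> K (sector A 1) (approx_factor c 1)"
    by eventually_elim (use approx_factor_1_decays[OF A_nonneg \<kappa>_bounds(2) _ _ bound] in blast)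
  moreover have "decays_on \<kappa> K (sector A 1) (exact_factor 1)"
    unfolding decays_on_def
  proof (intro ballI conjI)
    fix y assume y_in: "y \<in> sector A 1"
    show "isCont (exact_factor 1) y"
      using exact_factor_1_analytic sector_in_dom y_in
      by (intro analytic_at_imp_isCont analytic_on_subset[OF exact_factor_1_analytic]) auto
    show "norm (exact_factor 1 y) \<le> K * exp (- ((1 - \<kappa>) * Re y))"
      using bound[OF _ y_in, of 1] \<kappa>_bounds sector_in_dom y_in by (auto simp: exact_factor_1)
  qed
  ultimately show ?thesis
    using analytic_on_subset[OF exact_factor_1_analytic sector_in_dom] approx_factor_1_tendsto
        sector_in_dom
    unfolding desingularizes_on_def by blast
qed

lemma desingularizes_on_sector:
  assumes "norm \<xi> = 1" "0 < \<kappa>" "\<kappa> < 1" "A \<ge> 0"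
  shows "\<exists>\<eta>>0. \<exists>K. desingularizes_on \<kappa> K (sector A \<eta>) \<xi>"
  using assms desingularizes_on_sector_1 desingularizes_on_sector_ne_1
  by (cases "\<xi> = 1") (auto intro: exI[of _ 1])

section \<open>Domination of the integrand\<close>

lemma linear_form_Re_ge:
  fixes a x :: "'d::finite \<Rightarrow> complex"
  assumes Re_a: "\<And>j. Re (a j) \<ge> 0" and e_pos: "e > 0" and x_in: "\<And>j. x j \<in> keyhole e"
  shows "Re (\<Sum>j\<in>UNIV. a j * x j) \<ge> - ((\<Sum>j\<in>UNIV. norm (a j)) * e)"
proof -
  have "- (norm (a j) * e) \<le> Re (a j * x j)" for j
    using x_in[of j]
  proof (cases rule: keyhole_cases)
    case disc
    have "\<bar>Re (a j * x j)\<bar> \<le> norm (a j) * norm (x j)"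
      using abs_Re_le_cmod[of "a j * x j"] by (simp add: norm_mult)
    also have "\<dots> \<le> norm (a j) * e" using disc by (intro mult_left_mono) auto
    finally show ?thesis by simp
  next
    case (ray u)
    have "- (norm (a j) * e) \<le> 0" using e_pos by simp
    also have "0 \<le> Re (a j * x j)" using Re_a[of j] ray by simp
    finally show ?thesis .
  qed
  hence "(\<Sum>j\<in>UNIV. - (norm (a j) * e)) \<le> (\<Sum>j\<in>UNIV. Re (a j * x j))" by (intro sum_mono)
  thus ?thesis by (simp add: sum_negf sum_distrib_right)
qed

lemma linear_form_in_sector:
  fixes a x :: "'d::finite \<Rightarrow> complex"
  assumes aperture: "\<And>j. norm (a j) \<le> A * Re (a j)" and A_nonneg: "A \<ge> 0"
    and e_pos: "e > 0" and x_in: "\<And>j. x j \<in> keyhole e"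
  shows "(\<Sum>j\<in>UNIV. a j * x j) \<in> sector A ((1 + A) * (\<Sum>j\<in>UNIV. norm (a j)) * e)"
proof -
  have "norm (a j * x j) \<le> A * Re (a j * x j) + (1 + A) * norm (a j) * e" for j
    using x_in[of j]
  proof (cases rule: keyhole_cases)
    case disc
    have norm_le: "norm (a j * x j) \<le> norm (a j) * e"
      unfolding norm_mult using disc by (intro mult_left_mono) auto
    hence "- Re (a j * x j) \<le> norm (a j) * e" using abs_Re_le_cmod[of "a j * x j"] by linarith
    hence "A * - Re (a j * x j) \<le> A * (norm (a j) * e)" using A_nonneg by (rule mult_left_mono)
    thus ?thesis using norm_le by (simp add: algebra_simps)
  next
    case (ray u)
    have "norm (a j) * u \<le> A * Re (a j) * u" using aperture ray by (intro mult_right_mono) auto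
    moreover have "(1 + A) * norm (a j) * e \<ge> 0" using A_nonneg e_pos by simp
    ultimately show ?thesis using ray by (simp add: norm_mult)
  qed
  hence "(\<Sum>j\<in>UNIV. norm (a j * x j)) \<le> (\<Sum>j\<in>UNIV. A * Re (a j * x j) + (1 + A) * norm (a j) * e)"
    by (intro sum_mono)
  also have "\<dots> = A * Re (\<Sum>j\<in>UNIV. a j * x j) + (1 + A) * (\<Sum>j\<in>UNIV. norm (a j)) * e"
    by (simp add: sum.distrib sum_distrib_left sum_distrib_right)
  finally show ?thesis unfolding sector_def using norm_sum[of "\<lambda>j. a j * x j" UNIV] by simp
qed

lemma ex_aperture:
  fixes a :: "'d::finite \<Rightarrow> complex"
  assumes a_cases: "\<And>j. a j = 0 \<or> Re (a j) > 0"
  obtains A where "A \<ge> 0" "\<And>j. norm (a j) \<le> A * Re (a j)"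
proof (rule that)
  have nonneg: "norm (a j) / Re (a j) \<ge> 0" for j using a_cases[of j] by auto
  show "(\<Sum>j\<in>UNIV. norm (a j) / Re (a j)) \<ge> 0" by (intro sum_nonneg nonneg)
  show "norm (a j) \<le> (\<Sum>j\<in>UNIV. norm (a j) / Re (a j)) * Re (a j)" for j
  proof (cases "a j = 0")
    case False
    hence "Re (a j) > 0" using a_cases[of j] by auto
    moreover have "norm (a j) / Re (a j) \<le> (\<Sum>j\<in>UNIV. norm (a j) / Re (a j))"
      by (rule member_le_sum) (auto intro: nonneg)
    ultimately show ?thesis by (simp only: pos_divide_le_eq)
  qed simp
qed

lemma eventually_mult_less_at_right_0:
  fixes C \<eta> :: real
  assumes "\<eta> > 0"
  shows "\<forall>\<^sub>F e in at_right 0. C * e < \<eta>"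
proof -
  have "((\<lambda>e. C * e) \<longlongrightarrow> C * 0) (at_right 0)" by (intro tendsto_intros)
  thus ?thesis using assms by (intro order_tendstoD(2)) auto
qed

abbreviation form_values :: "complex^'r^'d \<Rightarrow> 'r \<Rightarrow> real \<Rightarrow> complex set" where
  "form_values \<gamma> k e \<equiv> (\<lambda>x. (x v* \<gamma>) $ k) ` polykeyhole_set e"

lemma vector_matrix_mult_nth: "(x v* \<gamma>) $ k = (\<Sum>j\<in>UNIV. \<gamma> $ j $ k * x $ j)" for x :: "complex^'d"
  by (simp add: vector_matrix_mult_def mult.commute)

lemma form_values_subset_halfplane:
  assumes "\<And>j. Re (\<gamma> $ j $ k) \<ge> 0" "e > 0"
  shows "form_values \<gamma> k e \<subseteq> {y. Re y \<ge> - ((\<Sum>j\<in>UNIV. norm (\<gamma> $ j $ k)) * e)}"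
  using linear_form_Re_ge[of "\<lambda>j. \<gamma> $ j $ k"] assms by (auto simp: vector_matrix_mult_nth)

lemma form_values_subset_sector:
  assumes "\<And>j. norm (\<gamma> $ j $ k) \<le> A * Re (\<gamma> $ j $ k)" "A \<ge> 0" "e > 0"
  shows "form_values \<gamma> k e \<subseteq> sector A ((1 + A) * (\<Sum>j\<in>UNIV. norm (\<gamma> $ j $ k)) * e)"
  using linear_form_in_sector[of "\<lambda>j. \<gamma> $ j $ k", OF assms]
  by (auto simp: vector_matrix_mult_nth)

lemma eventually_desingularizes_on_form_values:
  fixes \<gamma> :: "complex^'r^'d"
  assumes \<xi>_le_1: "norm \<xi> \<le> 1" and \<gamma>_nonneg: "\<And>j. Re (\<gamma> $ j $ k) \<ge> 0"
    and regular: "norm \<xi> = 1 \<Longrightarrow> (\<forall>j. \<gamma> $ j $ k = 0 \<or> Re (\<gamma> $ j $ k) > 0)"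
    and \<kappa>_bounds: "0 < \<kappa>" "\<kappa> < 1"
  shows "\<forall>\<^sub>F e in at_right 0. \<exists>K. desingularizes_on \<kappa> K (form_values \<gamma> k e) \<xi>"
proof (cases "norm \<xi> = 1")
  case False
  then obtain \<eta> K where \<eta>_good: "\<eta> > 0" "desingularizes_on \<kappa> K {y. Re y \<ge> - \<eta>} \<xi>"
    using desingularizes_on_halfplane[of \<xi> \<kappa>] \<xi>_le_1 \<kappa>_bounds by auto
  show ?thesis
    using eventually_mult_less_at_right_0[OF \<eta>_good(1), of "\<Sum>j\<in>UNIV. norm (\<gamma> $ j $ k)"]
        eventually_at_right_less[of 0]
  proof eventually_elim
    case (elim e)
    have "form_values \<gamma> k e \<subseteq> {y. Re y \<ge> - ((\<Sum>j\<in>UNIV. norm (\<gamma> $ j $ k)) * e)}"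
      using \<gamma>_nonneg elim(2) by (intro form_values_subset_halfplane) auto
    also have "\<dots> \<subseteq> {y. Re y \<ge> - \<eta>}" using elim(1) by auto
    finally show ?case using desingularizes_on_mono[OF \<eta>_good(2)] by blast
  qed
next
  case True
  obtain A where aperture: "A \<ge> 0" "\<And>j. norm (\<gamma> $ j $ k) \<le> A * Re (\<gamma> $ j $ k)"
    using ex_aperture[of "\<lambda>j. \<gamma> $ j $ k"] regular[OF True] by blast
  obtain \<eta> K where \<eta>_good: "\<eta> > 0" "desingularizes_on \<kappa> K (sector A \<eta>) \<xi>"
    using desingularizes_on_sector[OF True \<kappa>_bounds aperture(1)] by blast
  show ?thesis
    using eventually_mult_less_at_right_0[OF \<eta>_good(1), of "(1 + A) * (\<Sum>j\<in>UNIV. norm (\<gamma> $ j $ k))"]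
      eventually_at_right_less[of 0]
  proof eventually_elim
    case (elim e)
    have "form_values \<gamma> k e \<subseteq> sector A ((1 + A) * (\<Sum>j\<in>UNIV. norm (\<gamma> $ j $ k)) * e)"
      using aperture elim(2) by (intro form_values_subset_sector) auto
    also have "\<dots> \<subseteq> sector A \<eta>" using elim(1) by (intro sector_mono) simp
    finally show ?case using desingularizes_on_mono[OF \<eta>_good(2)] by blast
  qed
qed

lemma ex_uniform_desingularization:
  fixes \<xi> :: "complex^'r" and \<gamma> :: "complex^'r^'d"
  assumes "\<And>k. norm (\<xi> $ k) \<le> 1" "\<And>j k. Re (\<gamma> $ j $ k) \<ge> 0" "hankel_regular \<xi> \<gamma>"
    and \<kappa>_bounds: "0 < \<kappa>" "\<kappa> < 1"
  obtains e K where "e > 0" "\<And>k. desingularizes_on \<kappa> K (form_values \<gamma> k e) (\<xi> $ k)"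
proof -
  have "\<forall>\<^sub>F e in at_right 0. \<forall>k. \<exists>K. desingularizes_on \<kappa> K (form_values \<gamma> k e) (\<xi> $ k)"
    using assms hankel_regular_iff[of \<xi> \<gamma>]
    by (intro eventually_all_finite eventually_desingularizes_on_form_values) auto
  hence "\<forall>\<^sub>F e in at_right 0. (\<forall>k. \<exists>K. desingularizes_on \<kappa> K (form_values \<gamma> k e) (\<xi> $ k)) \<and> e > 0"
    using eventually_at_right_less by (rule eventually_conj)
  from eventually_happens'[OF trivial_limit_at_right_real this]
  obtain e K where e_pos: "e > 0"
      and desingularizes_K: "\<And>k. desingularizes_on \<kappa> (K k) (form_values \<gamma> k e) (\<xi> $ k)"
    by metis
  have "desingularizes_on \<kappa> (Max (range K)) (form_values \<gamma> k e) (\<xi> $ k)" for k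
    by (rule desingularizes_on_mono[OF desingularizes_K]) auto
  with e_pos show ?thesis by (rule that)
qed

definition row_sum :: "complex^'r^'d \<Rightarrow> 'd \<Rightarrow> complex" where
  "row_sum \<gamma> j = (\<Sum>k\<in>UNIV. \<gamma> $ j $ k)"

definition keyhole_integrand ::
  "complex^'r^'d \<Rightarrow> complex^'d \<Rightarrow> ('r \<Rightarrow> complex \<Rightarrow> complex) \<Rightarrow> complex^'d \<Rightarrow> complex" where
  "keyhole_integrand \<gamma> \<beta> g x =
     (\<Prod>j\<in>UNIV. exp ((row_sum \<gamma> j - \<beta> $ j) * x $ j)) * (\<Prod>k\<in>UNIV. g k ((x v* \<gamma>) $ k))"

lemma sum_vector_matrix_mult: "(\<Sum>k\<in>UNIV. (x v* \<gamma>) $ k) = (\<Sum>j\<in>UNIV. row_sum \<gamma> j * x $ j)"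
  unfolding vector_matrix_mult_nth row_sum_def sum_distrib_right by (rule sum.swap)

lemma keyhole_weight_eq:
  "(\<Prod>j\<in>UNIV. norm (exp ((row_sum \<gamma> j - \<beta> $ j) * x $ j)))
      * (\<Prod>k\<in>UNIV. exp (- ((1 - \<kappa>) * Re ((x v* \<gamma>) $ k))))
    = (\<Prod>j\<in>UNIV. norm (exp ((of_real \<kappa> * row_sum \<gamma> j - \<beta> $ j) * x $ j)))"
proof -
  have "(\<Prod>j\<in>UNIV. exp ((row_sum \<gamma> j - \<beta> $ j) * x $ j))
      * (\<Prod>k\<in>UNIV. exp (- (of_real (1 - \<kappa>) * (x v* \<gamma>) $ k)))
      = exp ((\<Sum>j\<in>UNIV. (row_sum \<gamma> j - \<beta> $ j) * x $ j)
          + (\<Sum>k\<in>UNIV. - (of_real (1 - \<kappa>) * (x v* \<gamma>) $ k)))"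
    by (simp only: exp_add exp_sum[OF finite_class.finite_UNIV])
  also have "\<dots> = (\<Prod>j\<in>UNIV. exp ((of_real \<kappa> * row_sum \<gamma> j - \<beta> $ j) * x $ j))"
    unfolding sum_negf sum_distrib_left[symmetric] sum_vector_matrix_mult
        exp_sum[OF finite_class.finite_UNIV, symmetric]
    by (simp add: sum_distrib_left algebra_simps flip: sum_subtractf sum.distrib)
  finally have "norm ((\<Prod>j\<in>UNIV. exp ((row_sum \<gamma> j - \<beta> $ j) * x $ j)) *
        (\<Prod>k\<in>UNIV. exp (- (of_real (1 - \<kappa>) * (x v* \<gamma>) $ k))))
      = norm (\<Prod>j\<in>UNIV. exp ((of_real \<kappa> * row_sum \<gamma> j - \<beta> $ j) * x $ j))" by (rule arg_cong)
  thus ?thesis by (simp add: norm_mult prod_norm[symmetric])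
qed

lemma norm_exp_mult_keyhole_le:
  assumes x_in: "x \<in> keyhole e" and e_nonneg: "e \<ge> 0" and b_nonneg: "b \<ge> 0" and Re_a: "Re a \<le> - b"
  shows "norm (exp (a * x)) \<le> exp ((norm a + b) * e) * exp (- (b * norm x))"
proof -
  have "Re (a * x) \<le> (norm a + b) * e - b * norm x"
    using x_in
  proof (cases rule: keyhole_cases)
    case disc
    have "Re (a * x) \<le> norm a * norm x" using complex_Re_le_cmod[of "a * x"] by (simp only: norm_mult)
    also have "\<dots> \<le> norm a * e" using disc by (intro mult_left_mono) auto
    finally have "Re (a * x) \<le> norm a * e" .
    moreover have "b * norm x \<le> b * e" using disc b_nonneg by (intro mult_left_mono) auto
    ultimately show ?thesis unfolding distrib_right by linarith
  next
    case (ray u)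
    have "Re a * u \<le> - b * u" using Re_a ray by (intro mult_right_mono) auto
    moreover have "(norm a + b) * e \<ge> 0" using e_nonneg b_nonneg by simp
    ultimately show ?thesis using ray by simp
  qed
  thus ?thesis by (simp flip: exp_add)
qed

lemma decays_on_nonneg: "decays_on \<kappa> K Y g \<Longrightarrow> 0 \<in> Y \<Longrightarrow> K \<ge> 0"
  unfolding decays_on_def by (fastforce intro: order_trans[OF norm_ge_zero])

lemma keyhole_integrand_scale:
  assumes "\<And>k y. g k y = a k * h k y"
  shows "keyhole_integrand \<gamma> \<beta> g x = (\<Prod>k\<in>UNIV. a k) * keyhole_integrand \<gamma> \<beta> h x"
  by (simp add: keyhole_integrand_def assms prod.distrib mult_ac)

lemma keyhole_integrand_tendsto:
  assumes "\<And>k. ((\<lambda>c. g c k ((x v* \<gamma>) $ k)) \<longlongrightarrow> h k ((x v* \<gamma>) $ k)) F"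
  shows "((\<lambda>c. keyhole_integrand \<gamma> \<beta> (g c) x) \<longlongrightarrow> keyhole_integrand \<gamma> \<beta> h x) F"
  unfolding keyhole_integrand_def by (intro tendsto_mult tendsto_const tendsto_prod assms)

context polykeyhole
begin

lemma continuous_keyhole_integrand:
  fixes \<gamma> :: "complex^'r^'d"
  assumes "\<And>k. continuous_on (form_values \<gamma> k e) (g k)"
  shows "continuous_on domain (keyhole_integrand \<gamma> \<beta> g)"
  unfolding keyhole_integrand_def[abs_def]
proof (intro continuous_on_mult continuous_on_prod)
  have "continuous_on domain (\<lambda>x. (x v* \<gamma>) $ k)" for k
    by (auto simp: vector_matrix_mult_def intro!: continuous_intros)
  thus "continuous_on domain (\<lambda>x. g k ((x v* \<gamma>) $ k))" for k
    by (rule continuous_on_compose2[OF assms]) auto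
qed (auto intro!: continuous_intros)

definition majorant :: "real \<Rightarrow> real \<Rightarrow> complex^'r^'d \<Rightarrow> complex^'d \<Rightarrow> real" where
  "majorant \<kappa> K \<gamma> \<beta> = K ^ CARD('r) * (\<Prod>j\<in>UNIV. exp ((norm (of_real \<kappa> * row_sum \<gamma> j - \<beta> $ j) + b) * e))"

lemma dominated_keyhole_integrand:
  fixes \<gamma> :: "complex^'r^'d" and \<beta> :: "complex^'d"
  assumes \<kappa>_nonneg: "\<kappa> \<ge> 0" and rate: "\<And>j. b \<le> Re (\<beta> $ j) - \<kappa> * norm (row_sum \<gamma> j)"
    and decays: "\<And>k. decays_on \<kappa> K (form_values \<gamma> k e) (g k)"
  shows "dominated (majorant \<kappa> K \<gamma> \<beta>) (keyhole_integrand \<gamma> \<beta> g)"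
  unfolding dominated_def
proof (intro conjI ballI)
  show "continuous_on domain (keyhole_integrand \<gamma> \<beta> g)"
    using decays unfolding decays_on_def
    by (intro continuous_keyhole_integrand continuous_at_imp_continuous_on) blast
  have "(0 v* \<gamma>) $ k \<in> form_values \<gamma> k e" for k by (rule imageI) (simp add: zero_in_keyhole)
  hence K_nonneg: "K \<ge> 0" using decays_on_nonneg[OF decays] by simp
  fix x :: "complex^'d" assume x_in: "x \<in> domain"
  let ?W = "\<lambda>j. norm (exp ((row_sum \<gamma> j - \<beta> $ j) * x $ j))"
  have "norm (keyhole_integrand \<gamma> \<beta> g x) = (\<Prod>j\<in>UNIV. ?W j) * (\<Prod>k\<in>UNIV. norm (g k ((x v* \<gamma>) $ k)))"
    by (simp add: keyhole_integrand_def norm_mult prod_norm[symmetric])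
  also have "\<dots> \<le> (\<Prod>j\<in>UNIV. ?W j) * (\<Prod>k\<in>UNIV. K * exp (- ((1 - \<kappa>) * Re ((x v* \<gamma>) $ k))))"
    using decays x_in unfolding decays_on_def by (intro mult_left_mono prod_mono prod_nonneg) auto
  also have "\<dots> = K ^ CARD('r) * ((\<Prod>j\<in>UNIV. ?W j)
      * (\<Prod>k\<in>UNIV. exp (- ((1 - \<kappa>) * Re ((x v* \<gamma>) $ k)))))"
    by (simp only: prod.distrib prod_constant mult_ac)
  also have "\<dots> = K ^ CARD('r) * (\<Prod>j\<in>UNIV. norm (exp ((of_real \<kappa> * row_sum \<gamma> j - \<beta> $ j) * x $ j)))"
    unfolding keyhole_weight_eq ..
  also have "\<dots> \<le> K ^ CARD('r) *
      (\<Prod>j\<in>UNIV. exp ((norm (of_real \<kappa> * row_sum \<gamma> j - \<beta> $ j) + b) * e)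
        * exp (- (b * norm (x $ j))))"
  proof (intro mult_left_mono prod_mono conjI norm_exp_mult_keyhole_le)
    fix j
    have "Re (of_real \<kappa> * row_sum \<gamma> j) \<le> \<kappa> * norm (row_sum \<gamma> j)"
      using complex_Re_le_cmod[of "row_sum \<gamma> j"] \<kappa>_nonneg by (simp add: mult_left_mono)
    thus "Re (of_real \<kappa> * row_sum \<gamma> j - \<beta> $ j) \<le> - b" using rate[of j] by simp
  qed (use K_nonneg x_in e_pos b_pos in auto)
  finally show "norm (keyhole_integrand \<gamma> \<beta> g x)
      \<le> majorant \<kappa> K \<gamma> \<beta> * (\<Prod>j\<in>UNIV. exp (- (b * norm (x $ j))))"
    by (simp add: majorant_def prod.distrib mult.assoc)
qed

lemma holomorphic_keyhole_integrand:
  fixes \<gamma> :: "complex^'r^'d" and \<beta> :: "complex^'d"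
  assumes g_analytic: "\<And>k. g k analytic_on form_values \<gamma> k e" and x_in: "x \<in> domain"
  shows "(\<lambda>z. keyhole_integrand \<gamma> \<beta> g (vec_upd x j z)) holomorphic_on ball 0 e"
proof (rule analytic_imp_holomorphic)
  have component: "(\<lambda>z. c * vec_upd x j z $ l) analytic_on ball 0 e" for c l
    by (cases "l = j") (auto simp: vec_upd_nth intro!: analytic_intros)
  have "(g k \<circ> (\<lambda>z. (vec_upd x j z v* \<gamma>) $ k)) analytic_on ball 0 e" for k
  proof (rule analytic_on_compose_gen)
    show "(\<lambda>z. (vec_upd x j z v* \<gamma>) $ k) analytic_on ball 0 e"
      unfolding vector_matrix_mult_nth by (intro analytic_on_sum component)
    have "vec_upd x j z \<in> domain" if "z \<in> ball 0 e" for z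
      using that x_in by (simp add: vec_upd_nth keyhole_def)
    thus "(vec_upd x j z v* \<gamma>) $ k \<in> form_values \<gamma> k e" if "z \<in> ball 0 e" for z
      using that by blast
  qed (rule g_analytic)
  hence "(\<lambda>z. g k ((vec_upd x j z v* \<gamma>) $ k)) analytic_on ball 0 e" for k by (simp add: o_def)
  thus "(\<lambda>z. keyhole_integrand \<gamma> \<beta> g (vec_upd x j z)) analytic_on ball 0 e"
    unfolding keyhole_integrand_def by (intro analytic_intros component)
qed

lemma hankel_integrand_eq:
  fixes \<gamma> :: "complex^'r^'d"
  assumes "\<epsilon> \<noteq> 0"
  shows "hankel_integrand \<epsilon> \<gamma> \<beta> s G t
    = integrand (keyhole_integrand \<gamma> \<beta> (\<lambda>k. remove_sings (G k))) (\<lambda>_. \<epsilon>) s (vec_nth t)"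
  using assms
  by (simp add: hankel_integrand_def integrand_def keyhole_integrand_def row_sum_def point_def
      contour_point_def
      contour_kernel_def hankel_form_def vector_matrix_mult_def prod.distrib mult_ac)

lemma
  fixes \<gamma> :: "complex^'r^'d"
  assumes continuous_F: "continuous_on domain (keyhole_integrand \<gamma> \<beta> (\<lambda>k. remove_sings (G k)))"
    and \<epsilon>_bounds: "0 < \<epsilon>" "\<epsilon> < e"
  shows integral_hankel_integrand: "(\<integral>t. hankel_integrand \<epsilon> \<gamma> \<beta> s G t \<partial>lborel)
      = (\<integral>t. integrand (keyhole_integrand \<gamma> \<beta> (\<lambda>k. remove_sings (G k))) (\<lambda>_. \<epsilon>) s t \<partial>lborel_fun)"
    and integrable_hankel_integrand: "integrable lborel (hankel_integrand \<epsilon> \<gamma> \<beta> s G) \<longleftrightarrow>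
      integrable lborel_fun (integrand (keyhole_integrand \<gamma> \<beta> (\<lambda>k. remove_sings (G k))) (\<lambda>_. \<epsilon>) s)"
proof -
  let ?F = "keyhole_integrand \<gamma> \<beta> (\<lambda>k. remove_sings (G k))"
  have "integrand ?F (\<lambda>_. \<epsilon>) s \<in> borel_measurable lborel_fun"
    using \<epsilon>_bounds by (intro measurable_integrand continuous_F) (simp add: radii_def)
  moreover have "(\<lambda>t::real^'d. \<lambda>j. t $ j) \<in> borel \<rightarrow>\<^sub>M lborel_fun"
    by (rule measurable_abs_UNIV) (auto intro!: borel_measurable_continuous_onI continuous_intros)
  moreover have "hankel_integrand \<epsilon> \<gamma> \<beta> s G = (\<lambda>t. integrand ?F (\<lambda>_. \<epsilon>) s (vec_nth t))"
    by (rule ext, rule hankel_integrand_eq) (use \<epsilon>_bounds in simp)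
  ultimately have measurable: "hankel_integrand \<epsilon> \<gamma> \<beta> s G \<in> borel_measurable borel"
    using measurable_compose by fastforce
  have integrand_eq: "hankel_integrand \<epsilon> \<gamma> \<beta> s G (\<chi> j. \<omega> j) = integrand ?F (\<lambda>_. \<epsilon>) s \<omega>" for \<omega>
    using \<epsilon>_bounds by (simp add: hankel_integrand_eq vec_lambda_inverse)
  show "(\<integral>t. hankel_integrand \<epsilon> \<gamma> \<beta> s G t \<partial>lborel) = (\<integral>t. integrand ?F (\<lambda>_. \<epsilon>) s t \<partial>lborel_fun)"
    unfolding integral_lborel_vec[OF measurable] integrand_eq ..
  show "integrable lborel (hankel_integrand \<epsilon> \<gamma> \<beta> s G)
      \<longleftrightarrow> integrable lborel_fun (integrand ?F (\<lambda>_. \<epsilon>) s)"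
    unfolding integrable_lborel_vec[OF measurable] integrand_eq ..
qed

lemma admissible_const_iff:
  "0 < \<epsilon> \<Longrightarrow> \<epsilon> < e \<Longrightarrow> admissible (\<lambda>_. \<epsilon>) s \<longleftrightarrow> (\<forall>j. s $ j \<notin> of_nat ` {1..})"
  by (simp add: admissible_def radii_def contour_domain_def)

end

section \<open>The desingularized zeta-function\<close>

locale desingularization = polykeyhole +
  fixes \<xi> :: "complex^'r" and \<gamma> :: "complex^'r^'d" and \<beta> :: "complex^'d" and \<kappa> K :: real
  assumes \<kappa>_nonneg: "\<kappa> \<ge> 0" and rate: "\<And>j. b \<le> Re (\<beta> $ j) - \<kappa> * norm (row_sum \<gamma> j)"
    and desingularizes: "\<And>k. desingularizes_on \<kappa> K (form_values \<gamma> k e) (\<xi> $ k)"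
begin

definition exact_fun :: "complex^'d \<Rightarrow> complex" where
  "exact_fun = keyhole_integrand \<gamma> \<beta> (\<lambda>k. exact_factor (\<xi> $ k))"

definition approx_fun :: "real \<Rightarrow> complex^'d \<Rightarrow> complex" where
  "approx_fun c = keyhole_integrand \<gamma> \<beta> (\<lambda>k. approx_factor c (\<xi> $ k))"

definition normalization :: "real \<Rightarrow> complex" where
  "normalization c = (\<Prod>k\<in>UNIV. 1 - delta_one (\<xi> $ k) * of_real c)"

abbreviation exact_integrand :: "real \<Rightarrow> complex^'d \<Rightarrow> real^'d \<Rightarrow> complex" where
  "exact_integrand \<epsilon> s \<equiv> hankel_integrand \<epsilon> \<gamma> \<beta> s (\<lambda>k y. des_F (delta_one (\<xi> $ k)) y (\<xi> $ k))"

abbreviation approx_integrand :: "real \<Rightarrow> complex^'d \<Rightarrow> real \<Rightarrow> real^'d \<Rightarrow> complex" where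
  "approx_integrand \<epsilon> s c
      \<equiv> hankel_integrand \<epsilon> \<gamma> \<beta> s (\<lambda>k y. des_F_approx c (delta_one (\<xi> $ k)) y (\<xi> $ k))"

lemma dominated_exact_fun: "dominated (majorant \<kappa> K \<gamma> \<beta>) exact_fun"
  unfolding exact_fun_def using desingularizes
  by (intro dominated_keyhole_integrand \<kappa>_nonneg rate) (simp add: desingularizes_on_def)

lemma eventually_dominated_approx_fun: "\<forall>\<^sub>F c in at 1. dominated (majorant \<kappa> K \<gamma> \<beta>) (approx_fun c)"
proof -
  have "\<forall>\<^sub>F c in at 1. \<forall>k. decays_on \<kappa> K (form_values \<gamma> k e) (approx_factor c (\<xi> $ k))"
    using desingularizes by (intro eventually_all_finite) (simp add: desingularizes_on_def)
  thus ?thesis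
    by eventually_elim
       (use dominated_keyhole_integrand[OF \<kappa>_nonneg rate] in \<open>simp add: approx_fun_def\<close>)
qed

lemma approx_fun_tendsto: "x \<in> domain \<Longrightarrow> ((\<lambda>c. approx_fun c x) \<longlongrightarrow> exact_fun x) (at 1)"
  unfolding approx_fun_def exact_fun_def using desingularizes
  by (intro keyhole_integrand_tendsto) (auto simp: desingularizes_on_def)

sublocale polykeyhole_function e b exact_fun "majorant \<kappa> K \<gamma> \<beta>"
  by unfold_locales
     (use dominated_exact_fun desingularizes in
       \<open>auto simp: exact_fun_def desingularizes_on_def intro!: holomorphic_keyhole_integrand\<close>)

lemma normalization_nonzero: "c \<noteq> 1 \<Longrightarrow> normalization c \<noteq> 0"
  by (auto simp: normalization_def delta_one_def split: if_splits)

lemma keyhole_integrand_exact: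
  "keyhole_integrand \<gamma> \<beta> (\<lambda>k. remove_sings (\<lambda>y. des_F (delta_one (\<xi> $ k)) y (\<xi> $ k))) = exact_fun"
  by (simp add: exact_fun_def exact_factor_def[abs_def])

lemma keyhole_integrand_approx:
  assumes "c \<noteq> 1"
  shows "keyhole_integrand \<gamma> \<beta> (\<lambda>k. remove_sings (\<lambda>y. des_F_approx c (delta_one (\<xi> $ k)) y (\<xi> $ k)))
    = (\<lambda>x. normalization c * approx_fun c x)"
  unfolding normalization_def approx_fun_def using assms
  by (intro ext keyhole_integrand_scale) (auto simp: approx_factor_def delta_one_def)

context
  fixes \<epsilon> :: real and s :: "complex^'d"
  assumes \<epsilon>_bounds: "0 < \<epsilon>" "\<epsilon> < e"
begin

lemma radii_const: "radii (\<lambda>_. \<epsilon>)"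
  using \<epsilon>_bounds by (simp add: radii_def)

lemma integrable_if_dominated:
  assumes "dominated M F"
  shows "integrable lborel_fun (integrand F (\<lambda>_. \<epsilon>) s)"
  using integrable_integrand[OF assms radii_const] \<epsilon>_bounds by simp

lemma integrable_exact: "integrable lborel (exact_integrand \<epsilon> s)"
proof (subst integrable_hankel_integrand[OF _ \<epsilon>_bounds], unfold keyhole_integrand_exact)
  show "continuous_on domain exact_fun" using dominated_exact_fun by (simp add: dominated_def)
qed (rule integrable_if_dominated[OF dominated_exact_fun])

lemma hankel_value_exact:
  "hankel_value \<epsilon> \<gamma> \<beta> s (\<lambda>k y. des_F (delta_one (\<xi> $ k)) y (\<xi> $ k))
      = contour_value exact_fun (\<lambda>_. \<epsilon>) s"
  unfolding hankel_value_def
proof (subst integral_hankel_integrand[OF _ \<epsilon>_bounds], unfold keyhole_integrand_exact)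
  show "continuous_on domain exact_fun" using dominated_exact_fun by (simp add: dominated_def)
qed (use \<epsilon>_bounds in \<open>simp add: contour_value_def contour_factor_def\<close>)

lemma
  assumes dominated: "dominated M (approx_fun c)" and c_neq_1: "c \<noteq> 1"
  shows integrable_approx: "integrable lborel (approx_integrand \<epsilon> s c)"
    and integral_approx: "(\<integral>t. approx_integrand \<epsilon> s c t \<partial>lborel) =
      normalization c * (\<integral>t. integrand (approx_fun c) (\<lambda>_. \<epsilon>) s t \<partial>lborel_fun)"
proof -
  have continuous: "continuous_on domain (keyhole_integrand \<gamma> \<beta>
      (\<lambda>k. remove_sings (\<lambda>y. des_F_approx c (delta_one (\<xi> $ k)) y (\<xi> $ k))))"
    unfolding keyhole_integrand_approx[OF c_neq_1] using dominated
    by (intro continuous_intros) (simp add: dominated_def)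
  have scale: "integrand (\<lambda>x. normalization c * approx_fun c x) (\<lambda>_. \<epsilon>) s
      = (\<lambda>t. normalization c * integrand (approx_fun c) (\<lambda>_. \<epsilon>) s t)"
    by (simp add: fun_eq_iff integrand_def mult_ac)
  show "integrable lborel (approx_integrand \<epsilon> s c)"
    unfolding integrable_hankel_integrand[OF continuous \<epsilon>_bounds]
        keyhole_integrand_approx[OF c_neq_1] scale
    by (intro integrable_mult_right integrable_if_dominated[OF dominated])
  show "(\<integral>t. approx_integrand \<epsilon> s c t \<partial>lborel) =
      normalization c * (\<integral>t. integrand (approx_fun c) (\<lambda>_. \<epsilon>) s t \<partial>lborel_fun)"
    unfolding integral_hankel_integrand[OF continuous \<epsilon>_bounds] keyhole_integrand_approx[OF c_neq_1]
        scale by simp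
qed

lemma eventually_integrable_approx: "\<forall>\<^sub>F c in at 1. integrable lborel (approx_integrand \<epsilon> s c)"
  using eventually_dominated_approx_fun eventually_neq_at_within[of 1]
  by eventually_elim (rule integrable_approx)

lemma zeta_des_approx_tendsto:
  "(zeta_des_approx \<epsilon> \<xi> \<gamma> \<beta> s \<longlongrightarrow> contour_value exact_fun (\<lambda>_. \<epsilon>) s) (at 1)"
proof (rule Lim_transform_eventually)
  show "((\<lambda>c. contour_value (approx_fun c) (\<lambda>_. \<epsilon>) s) \<longlongrightarrow> contour_value exact_fun (\<lambda>_. \<epsilon>) s) (at 1)"
    unfolding contour_value_def using \<epsilon>_bounds
    by (intro tendsto_mult tendsto_const approx_fun_tendsto radii_const
        tendsto_integral_integrand[OF eventually_dominated_approx_fun dominated_exact_fun]) auto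
  show "\<forall>\<^sub>F c in at 1. contour_value (approx_fun c) (\<lambda>_. \<epsilon>) s = zeta_des_approx \<epsilon> \<xi> \<gamma> \<beta> s c"
    using eventually_dominated_approx_fun eventually_neq_at_within[of 1]
  proof eventually_elim
    case (elim c)
    thus ?case
      using \<epsilon>_bounds normalization_nonzero integral_approx[OF elim]
      by (simp add: zeta_des_approx_def hankel_value_def contour_value_def contour_factor_def
          flip: normalization_def)
  qed
qed

lemma zeta_des_eq: "zeta_des \<epsilon> \<xi> \<gamma> \<beta> s = contour_value exact_fun (\<lambda>_. \<epsilon>) s"
  unfolding zeta_des_def using zeta_des_approx_tendsto by (intro tendsto_Lim) auto

end

end

lemma ex_desingularization:
  fixes \<xi> :: "complex^'r" and \<gamma> :: "complex^'r^'d" and \<beta> :: "complex^'d"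
  assumes "\<And>k. norm (\<xi> $ k) \<le> 1" "\<And>j k. Re (\<gamma> $ j $ k) \<ge> 0" "\<And>j. Re (\<beta> $ j) > 0" "hankel_regular \<xi> \<gamma>"
  obtains e b \<kappa> K where "desingularization e b \<xi> \<gamma> \<beta> \<kappa> K"
proof -
  have "\<forall>\<^sub>F \<kappa> in at_right 0. \<forall>j. norm (row_sum \<gamma> j) * \<kappa> < Re (\<beta> $ j)"
    using assms(3) by (intro eventually_all_finite eventually_mult_less_at_right_0)
  hence "\<forall>\<^sub>F \<kappa> in at_right 0. (\<forall>j. norm (row_sum \<gamma> j) * \<kappa> < Re (\<beta> $ j)) \<and> 1 * \<kappa> < 1 \<and> 0 < \<kappa>"
    by (intro eventually_conj eventually_mult_less_at_right_0 eventually_at_right_less) auto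
  then obtain \<kappa> where \<kappa>_bounds: "0 < \<kappa>" "\<kappa> < 1" and less: "\<And>j. norm (row_sum \<gamma> j) * \<kappa> < Re (\<beta> $ j)"
    using eventually_happens'[OF trivial_limit_at_right_real] by force
  obtain e K where e_pos: "e > 0"
      and desingularizes_K: "\<And>k. desingularizes_on \<kappa> K (form_values \<gamma> k e) (\<xi> $ k)"
    using ex_uniform_desingularization[OF assms(1,2,4) \<kappa>_bounds] by blast
  define b where "b = Min (range (\<lambda>j. Re (\<beta> $ j) - \<kappa> * norm (row_sum \<gamma> j)))"
  have "b > 0" using less by (simp add: b_def mult.commute)
  moreover have "b \<le> Re (\<beta> $ j) - \<kappa> * norm (row_sum \<gamma> j)" for j unfolding b_def by (rule Min_le) auto
  ultimately show ?thesis using e_pos desingularizes_K \<kappa>_bounds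
    by (intro that[of e b \<kappa> K]) (unfold_locales, auto)
qed

theorem theorem2p3:
  fixes \<xi> :: "complex^'r" and \<gamma> :: "complex^'r^'d" and \<beta> :: "complex^'d"
  assumes "\<And>k. norm (\<xi> $ k) \<le> 1"
    and "\<And>j k. Re (\<gamma> $ j $ k) \<ge> 0"
    and "\<And>j. Re (\<beta> $ j) > 0"
    and "\<And>j. \<exists>k. Re (\<gamma> $ j $ k) > 0"
    and "hankel_regular \<xi> \<gamma>"
  shows "\<exists>Z. entire_fun Z \<and>
    (\<forall>\<^sub>F \<epsilon> in at_right 0. \<forall>s.
      (\<forall>\<^sub>F c in at 1. integrable lborel
         (hankel_integrand \<epsilon> \<gamma> \<beta> s (\<lambda>k y. des_F_approx c (delta_one (\<xi> $ k)) y (\<xi> $ k)))) \<and>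
      integrable lborel
         (hankel_integrand \<epsilon> \<gamma> \<beta> s (\<lambda>k y. des_F (delta_one (\<xi> $ k)) y (\<xi> $ k))) \<and>
      ((\<forall>j. s $ j \<notin> of_nat ` {1..}) \<longrightarrow>
         (zeta_des_approx \<epsilon> \<xi> \<gamma> \<beta> s \<longlongrightarrow> zeta_des \<epsilon> \<xi> \<gamma> \<beta> s) (at 1) \<and>
         zeta_des \<epsilon> \<xi> \<gamma> \<beta> s
           = hankel_value \<epsilon> \<gamma> \<beta> s (\<lambda>k y. des_F (delta_one (\<xi> $ k)) y (\<xi> $ k)) \<and>
         Z s = zeta_des \<epsilon> \<xi> \<gamma> \<beta> s))"
proof -
  obtain e b \<kappa> K where "desingularization e b \<xi> \<gamma> \<beta> \<kappa> K"
    using ex_desingularization[OF assms(1,2,3,5)] by blast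
  then interpret desingularization e b \<xi> \<gamma> \<beta> \<kappa> K .
  obtain Z where continuation: "entire_fun Z"
      "\<And>r s. admissible r s \<Longrightarrow> Z s = contour_value exact_fun r s"
    using entire_continuation by blast
  have "\<forall>\<^sub>F \<epsilon> in at_right 0. 0 < \<epsilon> \<and> \<epsilon> < e" using e_pos by (auto simp: eventually_at_right_field)
  thus ?thesis
  proof (intro exI[of _ Z] conjI continuation(1), eventually_elim)
    case (elim \<epsilon>)
    have "Z s = zeta_des \<epsilon> \<xi> \<gamma> \<beta> s" if "\<forall>j. s $ j \<notin> of_nat ` {1..}" for s
      using elim that by (simp add: continuation(2) zeta_des_eq admissible_const_iff)
    thus ?case
      using elim eventually_integrable_approx integrable_exact zeta_des_approx_tendsto
      by (simp add: zeta_des_eq hankel_value_exact)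
  qed
qed

end
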